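(* Let $F$ be a fatgraph and $\widehat{\mathcal C}(F)$ its restricted Bollobás–Riordan chain complex. Then the Euler characteristic of the homology $\widehat H(\widehat{\mathcal C}(F))$ equals the restricted Bollobás–Riordan polynomial \[ \widehat R(F,q)=\sum_{H\in\mathcal S(F)}(q+q^{-1})^{v(H)+p(H)+2g(H)}(-q)^{e(F)-e(H)}. \]
   Context: A fatgraph is a finite graph (loops and multiple edges allowed) with a cyclic order of half-edges at each vertex; it determines a compact orientable surface with boundary. For a fatgraph $H$: $v(H),e(H)$ numbers of vertices and edges, $p(H)$ number of boundary components, $g(H)$ genus. A state is a spanning fatsubgraph $H=(V(F),W)$, $W\subseteq E(F)$; $\mathcal S(F)$ is the set of states; height $h(H)=e(F)-e(H)$. Graded modules: $\operatorname{qdim}(M)=\sum_i q^i\operatorname{rk}M_i$, $M\{l\}_m=M_{m-l}$; the Euler characteristic of the homology $(H^i)$ of a cochain complex is $\sum_i(-1)^i\operatorname{qdim}H^i$. Restricted complex: $V$ is the free graded $\mathbb Z$-module on $v_\pm$ in degrees $\pm1$. Maps: $\widetilde m':V\otimes V\to V$, $v_+\otimes v_+\mapsto v_+$, $v_\pm\otimes v_\mp\mapsto v_-$, $v_-\otimes v_-\mapsto0$; $\widetilde\Delta':V\to V\otimes V$, $v_+\mapsto v_+\otimes v_-+v_-\otimes v_+$, $v_-\mapsto v_-\otimes v_-$; $\widehat m_g:V^{\otimes2g}\to V^{\otimes2(g-1)}$ sends a basis tensor to the sum of all basis tensors of the same degree. Each state $H$ gets $B(H)=V^{\otimes v(H)}\otimes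 V^{\otimes p(H)}\otimes V^{\otimes 2g(H)}\{h(H)\}$ (factors of $V^{\otimes p(H)}$ indexed by boundary components). Number edges $1,\dots,n$ and encode states by $\alpha\in\{0,1\}^n$ ($\alpha_i=0$ iff edge $i$ present). For edge $j$ in $H$, $H'=H-e_j$ either merges two boundary components or splits one, and $g(H')\in\{g(H),g(H)-1\}$; the per-edge map $B(H)\to B(H')$ is $(-1)^{\sum_{i<j}\alpha_i}$ times the tensor of the identity on $V^{\otimes v}$, $\widetilde m'$ (merge) or $\widetilde\Delta'$ (split) on the affected boundary factors and identity elsewhere, and the identity or $\widehat m_g$ on $V^{\otimes2g}$ according as the genus is unchanged or drops. $\widehat{\mathcal C}^h(F)=\bigoplus_{h(H)=h}B(H)$, with differential the sum of per-edge maps; $\widehat H$ is its homology. *)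

theory Defs
  imports
    "HOL-Algebra.Free_Abelian_Groups"
    "HOL-Combinatorics.Orbits"
    "HOL-Computational_Algebra.Formal_Laurent_Series"
begin

section \<open>Fatgraphs\<close>

text \<open>
  A fatgraph is given by its vertices and half-edges: \<open>vert_of h\<close> is the vertex at which the
  half-edge \<open>h\<close> is attached, \<open>opp h\<close> is the other half of the edge containing \<open>h\<close>, and \<open>nxt h\<close>
  is the successor of \<open>h\<close> in the cyclic order at \<open>vert_of h\<close>. Vertices without half-edges are
  allowed. Only the values of the three functions on \<open>halfs\<close> matter.
\<close>

record ('v, 'h) fatgraph =
  verts :: "'v set"
  halfs :: "'h set"
  vert_of :: "'h \<Rightarrow> 'v"
  opp :: "'h \<Rightarrow> 'h"
  nxt :: "'h \<Rightarrow> 'h"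

definition halfs_at :: "('v, 'h) fatgraph \<Rightarrow> 'v \<Rightarrow> 'h set" where
  "halfs_at F v = {h \<in> halfs F. vert_of F h = v}"

definition is_fatgraph :: "('v, 'h) fatgraph \<Rightarrow> bool" where
  "is_fatgraph F \<longleftrightarrow>
     finite (verts F) \<and> finite (halfs F) \<and>
     (\<forall>h \<in> halfs F. vert_of F h \<in> verts F) \<and>
     (\<forall>h \<in> halfs F. opp F h \<in> halfs F \<and> opp F h \<noteq> h \<and> opp F (opp F h) = h) \<and>
     (\<forall>v \<in> verts F. halfs_at F v = {} \<or> cyclic_on (nxt F) (halfs_at F v))"

definition edge_of :: "('v, 'h) fatgraph \<Rightarrow> 'h \<Rightarrow> 'h set" where
  "edge_of F h = {h, opp F h}"

definition edges :: "('v, 'h) fatgraph \<Rightarrow> 'h set set" where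
  "edges F = edge_of F ` halfs F"

definition num_verts :: "('v, 'h) fatgraph \<Rightarrow> nat" where
  "num_verts F = card (verts F)"

definition num_edges :: "('v, 'h) fatgraph \<Rightarrow> nat" where
  "num_edges F = card (edges F)"

text \<open>
  Walking along the side of an edge starting at the half-edge \<open>h\<close> one arrives at \<open>opp h\<close> and turns
  into \<open>nxt (opp h)\<close>. Hence the boundary components of the surface that meet an edge are the orbits
  of \<open>nxt \<circ> opp\<close>, and every isolated vertex (a disc) contributes one further boundary component.
\<close>

definition bdry_comps :: "('v, 'h) fatgraph \<Rightarrow> ('h set + 'v) set" where
  "bdry_comps F =
     (\<lambda>h. Inl (orbit (nxt F \<circ> opp F) h)) ` halfs F \<union> Inr ` {v \<in> verts F. halfs_at F v = {}}"

definition num_bdry :: "('v, 'h) fatgraph \<Rightarrow> nat" where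
  "num_bdry F = card (bdry_comps F)"

definition adj :: "('v, 'h) fatgraph \<Rightarrow> ('v \<times> 'v) set" where
  "adj F = {(vert_of F h, vert_of F (opp F h)) | h. h \<in> halfs F}"

definition num_comps :: "('v, 'h) fatgraph \<Rightarrow> nat" where
  "num_comps F = card (verts F // (adj F)\<^sup>*)"

text \<open>
  The genus of the (possibly disconnected) surface, i.e. the sum of the genera of its components,
  from the Euler characteristic \<open>v - e = 2 k - 2 g - p\<close> of a compact orientable surface with \<open>k\<close>
  components and \<open>p\<close> boundary circles.
\<close>

definition genus :: "('v, 'h) fatgraph \<Rightarrow> nat" where
  "genus F = nat ((2 * int (num_comps F) - int (num_verts F) + int (num_edges F)
                   - int (num_bdry F)) div 2)"

text \<open>
  The spanning fatsubgraph with edge set \<open>W\<close>. Its cyclic orders are the induced ones: the successor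
  of \<open>h\<close> is the first half-edge after \<open>h\<close> which belongs to an edge in \<open>W\<close>.
\<close>

definition subfat :: "('v, 'h) fatgraph \<Rightarrow> 'h set set \<Rightarrow> ('v, 'h) fatgraph" where
  "subfat F W =
     F\<lparr>halfs := {h \<in> halfs F. edge_of F h \<in> W},
       nxt := (\<lambda>h. (nxt F ^^ (LEAST k. 0 < k \<and> (nxt F ^^ k) h \<in> halfs F
                                       \<and> edge_of F ((nxt F ^^ k) h) \<in> W)) h)\<rparr>"

text \<open>A state \<open>subfat F W\<close> is represented by its edge set \<open>W\<close>.\<close>

definition states :: "('v, 'h) fatgraph \<Rightarrow> 'h set set set" where
  "states F = Pow (edges F)"

definition height :: "('v, 'h) fatgraph \<Rightarrow> 'h set set \<Rightarrow> int" where
  "height F W = int (num_edges F) - int (num_edges (subfat F W))"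


section \<open>The module V and its tensor powers\<close>

datatype sign = Plus | Minus

primrec sdeg :: "sign \<Rightarrow> int" where
  "sdeg Plus = 1"
| "sdeg Minus = -1"

text \<open>
  The tensor power of \<open>V\<close> with factors indexed by a finite set \<open>I\<close> is the free abelian group on its
  basis tensors, which are the maps \<open>I \<rightarrow> {v\<^sub>+, v\<^sub>-}\<close>. Elements of free abelian groups are
  finitely supported functions \<open>'b \<Rightarrow>\<^sub>0 int\<close>, and a linear map is given by its values on basis
  elements.
\<close>

definition tensors :: "'i set \<Rightarrow> ('i \<Rightarrow> sign) set" where
  "tensors I = (I \<rightarrow>\<^sub>E UNIV)"

definition tdeg :: "'i set \<Rightarrow> ('i \<Rightarrow> sign) \<Rightarrow> int" where
  "tdeg I t = (\<Sum>i\<in>I. sdeg (t i))"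

fun merge_sign :: "sign \<Rightarrow> sign \<Rightarrow> (sign \<Rightarrow>\<^sub>0 int)" where
  "merge_sign Plus Plus = frag_of Plus"
| "merge_sign Plus Minus = frag_of Minus"
| "merge_sign Minus Plus = frag_of Minus"
| "merge_sign Minus Minus = 0"

fun split_sign :: "sign \<Rightarrow> (sign \<times> sign \<Rightarrow>\<^sub>0 int)" where
  "split_sign Plus = frag_of (Plus, Minus) + frag_of (Minus, Plus)"
| "split_sign Minus = frag_of (Minus, Minus)"

definition genus_drop :: "nat \<Rightarrow> (nat \<Rightarrow> sign) \<Rightarrow> ((nat \<Rightarrow> sign) \<Rightarrow>\<^sub>0 int)" where
  "genus_drop g t =
     (\<Sum>t' \<in> {t' \<in> tensors {..<2 * (g - 1)}. tdeg {..<2 * (g - 1)} t' = tdeg {..<2 * g} t}.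
        frag_of t')"


section \<open>The restricted complex\<close>

text \<open>
  The map on boundary factors when \<open>P\<close> and \<open>P'\<close> are the sets of boundary components before and
  after the removal of an edge. A boundary component which does not meet the edge is the same orbit
  of half-edges (or the same isolated vertex) before and after, so \<open>P - P'\<close> and \<open>P' - P\<close> are the
  affected components: two components are merged into one, or one is split into two. The choice of
  an order on the two components is immaterial, as \<open>merge_sign\<close> and \<open>split_sign\<close> are symmetric.
\<close>

definition ordered_pair_of :: "'i set \<Rightarrow> 'i \<times> 'i" where
  "ordered_pair_of A = (SOME (c, d). c \<noteq> d \<and> A = {c, d})"

definition bdry_map :: "'i set \<Rightarrow> 'i set \<Rightarrow> ('i \<Rightarrow> sign) \<Rightarrow> (('i \<Rightarrow> sign) \<Rightarrow>\<^sub>0 int)" where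
  "bdry_map P P' t =
     (if card (P - P') = 2
      then let (c, d) = ordered_pair_of (P - P'); c' = the_elem (P' - P)
           in frag_extend (\<lambda>s. frag_of (restrict (t(c' := s)) P')) (merge_sign (t c) (t d))
      else let c = the_elem (P - P'); (c', d') = ordered_pair_of (P' - P)
           in frag_extend (\<lambda>(s, s'). frag_of (restrict (t(c' := s, d' := s')) P'))
                (split_sign (t c)))"

definition genus_map :: "nat \<Rightarrow> nat \<Rightarrow> (nat \<Rightarrow> sign) \<Rightarrow> ((nat \<Rightarrow> sign) \<Rightarrow>\<^sub>0 int)" where
  "genus_map g g' t = (if g' = g then frag_of t else genus_drop g t)"

text \<open>
  A basis element \<open>(W, a, b, c)\<close> of the chain complex consists of a state \<open>W\<close> and basis tensors
  \<open>a\<close>, \<open>b\<close>, \<open>c\<close> of the three tensor powers of \<open>V\<close> in \<open>B(W)\<close>.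
\<close>

type_synonym ('v, 'h) gen =
  "'h set set \<times> ('v \<Rightarrow> sign) \<times> ('h set + 'v \<Rightarrow> sign) \<times> (nat \<Rightarrow> sign)"

definition state_basis :: "('v, 'h) fatgraph \<Rightarrow> 'h set set \<Rightarrow> ('v, 'h) gen set" where
  "state_basis F W =
     {W} \<times> tensors (verts (subfat F W)) \<times> tensors (bdry_comps (subfat F W))
         \<times> tensors {..<2 * genus (subfat F W)}"

text \<open>The degree in \<open>B(W)\<close>, including the shift \<open>{h(W)}\<close>.\<close>

fun gen_deg :: "('v, 'h) fatgraph \<Rightarrow> ('v, 'h) gen \<Rightarrow> int" where
  "gen_deg F (W, a, b, c) =
     tdeg (verts (subfat F W)) a + tdeg (bdry_comps (subfat F W)) b
     + tdeg {..<2 * genus (subfat F W)} c + height F W"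

definition homogeneous ::
    "('v, 'h) fatgraph \<Rightarrow> int \<Rightarrow> (('v, 'h) gen \<Rightarrow>\<^sub>0 int) \<Rightarrow> bool" where
  "homogeneous F m x \<longleftrightarrow> (\<forall>y \<in> Poly_Mapping.keys x. gen_deg F y = m)"

fun edge_map :: "('v, 'h) fatgraph \<Rightarrow> 'h set \<Rightarrow> ('v, 'h) gen \<Rightarrow> (('v, 'h) gen \<Rightarrow>\<^sub>0 int)" where
  "edge_map F e (W, a, b, c) =
     (let W' = W - {e}; H = subfat F W; H' = subfat F W'
      in frag_extend (\<lambda>b'. frag_extend (\<lambda>c'. frag_of (W', a, b', c'))
                             (genus_map (genus H) (genus H') c))
           (bdry_map (bdry_comps H) (bdry_comps H') b))"

text \<open>
  The numbering of the edges is a bijection \<open>\<nu> : {1..n} \<rightarrow> edges F\<close>. The exponent of the sign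
  is the number of edges numbered below \<open>j\<close> that are absent from \<open>W\<close>.
\<close>

definition differential ::
    "('v, 'h) fatgraph \<Rightarrow> (nat \<Rightarrow> 'h set) \<Rightarrow> (('v, 'h) gen \<Rightarrow>\<^sub>0 int) \<Rightarrow> (('v, 'h) gen \<Rightarrow>\<^sub>0 int)"
  where
  "differential F \<nu> =
     frag_extend (\<lambda>x. \<Sum>j \<in> {j \<in> {1..num_edges F}. \<nu> j \<in> fst x}.
       frag_cmul ((-1) ^ (\<Sum>i \<in> {1..<j}. if \<nu> i \<in> fst x then 0 else 1)) (edge_map F (\<nu> j) x))"

text \<open>Heights are integers, so that the chain group of height \<open>-1\<close> is trivial.\<close>

definition chain_group :: "('v, 'h) fatgraph \<Rightarrow> int \<Rightarrow> (('v, 'h) gen \<Rightarrow>\<^sub>0 int) monoid" where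
  "chain_group F h = free_Abelian_group (\<Union>W \<in> {W \<in> states F. height F W = h}. state_basis F W)"

definition cycles ::
    "('v, 'h) fatgraph \<Rightarrow> (nat \<Rightarrow> 'h set) \<Rightarrow> int \<Rightarrow> (('v, 'h) gen \<Rightarrow>\<^sub>0 int) set" where
  "cycles F \<nu> h = kernel (chain_group F h) (chain_group F (h + 1)) (differential F \<nu>)"

definition boundaries ::
    "('v, 'h) fatgraph \<Rightarrow> (nat \<Rightarrow> 'h set) \<Rightarrow> int \<Rightarrow> (('v, 'h) gen \<Rightarrow>\<^sub>0 int) set" where
  "boundaries F \<nu> h = differential F \<nu> ` carrier (chain_group F (h - 1))"

definition cycle_group ::
    "('v, 'h) fatgraph \<Rightarrow> (nat \<Rightarrow> 'h set) \<Rightarrow> int \<Rightarrow> (('v, 'h) gen \<Rightarrow>\<^sub>0 int) monoid" where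
  "cycle_group F \<nu> h = subgroup_generated (chain_group F h) (cycles F \<nu> h)"

definition homology ::
    "('v, 'h) fatgraph \<Rightarrow> (nat \<Rightarrow> 'h set) \<Rightarrow> int \<Rightarrow> (('v, 'h) gen \<Rightarrow>\<^sub>0 int) set monoid" where
  "homology F \<nu> h = cycle_group F \<nu> h Mod boundaries F \<nu> h"

text \<open>The degree \<open>m\<close> part of the homology consists of the classes of homogeneous cycles.\<close>

definition homology_deg ::
    "('v, 'h) fatgraph \<Rightarrow> (nat \<Rightarrow> 'h set) \<Rightarrow> int \<Rightarrow> int \<Rightarrow> (('v, 'h) gen \<Rightarrow>\<^sub>0 int) set monoid"
  where
  "homology_deg F \<nu> h m =
     subgroup_generated (homology F \<nu> h)
       ((\<lambda>x. boundaries F \<nu> h #>\<^bsub>cycle_group F \<nu> h\<^esub> x) ` {x \<in> cycles F \<nu> h. homogeneous F m x})"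


section \<open>Graded rank and Euler characteristic\<close>

text \<open>
  The rank of an abelian group: the largest size of a finite family of integrally independent
  elements. (The supremum is meaningful for groups of finite rank, e.g. finitely generated ones.)
\<close>

definition indep_in :: "('a, 'b) monoid_scheme \<Rightarrow> 'a set \<Rightarrow> bool" where
  "indep_in G S \<longleftrightarrow>
     (\<forall>c :: 'a \<Rightarrow> int. finprod G (\<lambda>x. x [^]\<^bsub>G\<^esub> c x) S = \<one>\<^bsub>G\<^esub> \<longrightarrow> (\<forall>x \<in> S. c x = 0))"

definition abelian_rank :: "('a, 'b) monoid_scheme \<Rightarrow> nat" where
  "abelian_rank G = Sup {card S | S. finite S \<and> S \<subseteq> carrier G \<and> indep_in G S}"

text \<open>
  Laurent polynomials in \<open>q\<close> are taken inside the ring of formal Laurent series over the integers;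
  \<open>q\<close> is \<open>fls_X\<close>, its inverse is \<open>fls_X_inv\<close>, and its \<open>m\<close>-th power is \<open>fls_X_intpow m\<close>. The argument
  of \<open>qdim\<close> is the family of the graded pieces.
\<close>

definition qdim :: "(int \<Rightarrow> ('a, 'b) monoid_scheme) \<Rightarrow> int fls" where
  "qdim M = (\<Sum>m | abelian_rank (M m) \<noteq> 0. fls_X_intpow m * of_nat (abelian_rank (M m)))"

text \<open>The complex is concentrated in heights \<open>0, \<dots>, e(F)\<close>.\<close>

definition homology_euler_char :: "('v, 'h) fatgraph \<Rightarrow> (nat \<Rightarrow> 'h set) \<Rightarrow> int fls" where
  "homology_euler_char F \<nu> =
     (\<Sum>h \<le> num_edges F. (-1) ^ h * qdim (homology_deg F \<nu> (int h)))"

definition restricted_BR_poly :: "('v, 'h) fatgraph \<Rightarrow> int fls" where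
  "restricted_BR_poly F =
     (\<Sum>W \<in> states F. let H = subfat F W in
        (fls_X + fls_X_inv) ^ (num_verts H + num_bdry H + 2 * genus H)
        * (- fls_X) ^ (num_edges F - num_edges H))"

end

theory Submission
  imports Defs
begin

text \<open>
  The complex is finitely generated in every bidegree and its differential preserves the degree, so
  the Euler characteristic of the homology is that of the chain groups, which is the state sum
  defining the polynomial. Apart from the rank computation this needs \<open>d\<^sup>2 = 0\<close>, i.e. that the maps
  for the two orders of removing edges \<open>e\<close> and \<open>f\<close> coincide. Both boundary maps send a basis tensor
  \<open>b\<close> to the sum of all basis tensors of degree \<open>tdeg b - 1\<close> that agree with \<open>b\<close> on the unaffected
  factors. The coefficients of a composite therefore count intermediate tensors. If some boundary
  component meets both \<open>e\<close> and \<open>f\<close>, the count is determined by the initial and the final set of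
  components alone; otherwise the two removals change disjoint sets of factors.
\<close>


section \<open>Ranks of quotients of subgroups of free abelian groups\<close>

text \<open>Homology may have torsion and \<open>abelian_rank\<close> is a supremum over independent
  families, so ranks are compared over the rationals, where independent sets extend to bases. The
  degree \<open>m\<close> part of the homology is defined through homogeneous cycles; relations
  among their classes are understood only once a homogeneous boundary is seen to bound a homogeneous
  chain. Boundary components of different states are sets of different half-edges, which makes two
  removals hard to compare. Encoding all states by permutations of the same half-edges turns a
  removal into multiplication by a transposition, which joins two cycles or cuts one. If some
  component meets both edges, one or two components are created by the first removal and destroyed
  by the second. They are two exactly when a component is cut and its parts are joined again, which
  is visible from the ends, as then one component is lost and one gained overall. Cutting and
  joining both lower the degree by one, the genus map keeps it, and the shift by the height restores
  it.\<close>

definition rat_scale :: "rat \<Rightarrow> ('a \<Rightarrow>\<^sub>0 rat) \<Rightarrow> ('a \<Rightarrow>\<^sub>0 rat)" where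
  "rat_scale c = Poly_Mapping.map ((*) c)"

definition rat_frag :: "('a \<Rightarrow>\<^sub>0 int) \<Rightarrow> ('a \<Rightarrow>\<^sub>0 rat)" where
  "rat_frag = Poly_Mapping.map of_int"

lemma lookup_rat_scale [simp]: "Poly_Mapping.lookup (rat_scale c f) k = c * Poly_Mapping.lookup f k"
  by (simp add: rat_scale_def Poly_Mapping.map.rep_eq when_def)

lemma lookup_rat_frag [simp]: "Poly_Mapping.lookup (rat_frag f) k = of_int (Poly_Mapping.lookup f k)"
  by (simp add: rat_frag_def Poly_Mapping.map.rep_eq when_def)

interpretation Q: vector_space rat_scale
  by unfold_locales
    (auto intro!: poly_mapping_eqI simp: lookup_add algebra_simps)

lemma inj_rat_frag: "inj rat_frag"
proof (rule injI)
  fix x y :: "'a \<Rightarrow>\<^sub>0 int"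
  assume "rat_frag x = rat_frag y"
  then have "(of_int (Poly_Mapping.lookup x k) :: rat) = of_int (Poly_Mapping.lookup y k)" for k
    by (metis lookup_rat_frag)
  then show "x = y" by (intro poly_mapping_eqI) simp
qed

lemma rat_frag_0 [simp]: "rat_frag 0 = 0"
  by (auto intro: poly_mapping_eqI)

lemma rat_frag_eq_0_iff: "rat_frag x = 0 \<longleftrightarrow> x = 0"
  using inj_rat_frag by (metis injD rat_frag_0)

lemma rat_frag_sum_cmul:
  "rat_frag (\<Sum>x\<in>T. frag_cmul (c x) (g x)) = (\<Sum>x\<in>T. rat_scale (of_int (c x)) (rat_frag (g x)))"
  by (rule poly_mapping_eqI) (simp add: lookup_sum)

text \<open>Serves to turn a rational linear relation into an integral one.\<close>

lemma common_denominator: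
  assumes "finite T"
  shows "\<exists>N :: int. N \<noteq> 0 \<and> (\<forall>x\<in>T. \<exists>n. of_int N * (u x :: rat) = of_int n)"
  using assms
proof induction
  case empty
  show ?case by (rule exI[of _ 1]) simp
next
  case (insert t T)
  then obtain N :: int where N: "N \<noteq> 0" "\<forall>x\<in>T. \<exists>n. of_int N * u x = of_int n" by blast
  obtain a b where ab: "quotient_of (u t) = (a, b)" by fastforce
  then have b: "b > 0" "u t = of_int a / of_int b"
    using quotient_of_denom_pos quotient_of_div by auto
  have "\<exists>n. of_int (N * b) * u x = of_int n" if x: "x \<in> insert t T" for x
  proof (cases "x = t")
    case True
    then have "of_int (N * b) * u x = of_int (N * a)" using b by simp
    then show ?thesis by (rule exI)
  next
    case False
    then obtain n where n: "of_int N * u x = of_int n" using N(2) x by auto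
    have "of_int (N * b) * u x = of_int b * (of_int N * u x)" by simp
    also have "\<dots> = of_int (b * n)" unfolding n by simp
    finally show ?thesis by (rule exI)
  qed
  then show ?case using N b by (intro exI[of _ "N * b"]) simp
qed

text \<open>An integral relation is in particular a rational one. Conversely, multiplying a finite
  rational relation by a common denominator makes its coefficients integral without killing any of
  them.\<close>

lemma independent_rat_frag_iff:
  assumes "finite T"
  shows "Q.independent (rat_frag ` T) \<longleftrightarrow>
    (\<forall>c. (\<Sum>x\<in>T. frag_cmul (c x) x) = 0 \<longrightarrow> (\<forall>x\<in>T. c x = 0))"
proof
  have inj: "inj_on rat_frag T" using inj_rat_frag inj_on_subset by blast
  assume L: "Q.independent (rat_frag ` T)"
  show "\<forall>c. (\<Sum>x\<in>T. frag_cmul (c x) x) = 0 \<longrightarrow> (\<forall>x\<in>T. c x = 0)"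
  proof (intro allI impI ballI)
    fix c :: "('a \<Rightarrow>\<^sub>0 int) \<Rightarrow> int" and x
    assume s: "(\<Sum>x\<in>T. frag_cmul (c x) x) = 0" and x: "x \<in> T"
    define u where "u = (\<lambda>v. of_int (c (the_inv_into T rat_frag v)) :: rat)"
    have u: "u (rat_frag x) = of_int (c x)" if "x \<in> T" for x
      using that inj by (simp add: u_def the_inv_into_f_f)
    have "(\<Sum>v\<in>rat_frag ` T. rat_scale (u v) v) = (\<Sum>x\<in>T. rat_scale (u (rat_frag x)) (rat_frag x))"
      by (simp add: sum.reindex[OF inj])
    also have "\<dots> = rat_frag (\<Sum>x\<in>T. frag_cmul (c x) x)"
      by (simp add: rat_frag_sum_cmul u cong: sum.cong)
    finally have "(\<Sum>v\<in>rat_frag ` T. rat_scale (u v) v) = 0" using s by simp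
    then have "u (rat_frag x) = 0"
      using Q.independentD[OF L, of "rat_frag ` T" u "rat_frag x"] assms x by simp
    then show "c x = 0" using u x by simp
  qed
next
  have inj: "inj_on rat_frag T" using inj_rat_frag inj_on_subset by blast
  assume R: "\<forall>c. (\<Sum>x\<in>T. frag_cmul (c x) x) = 0 \<longrightarrow> (\<forall>x\<in>T. c x = 0)"
  show "Q.independent (rat_frag ` T)"
  proof (rule Q.independent_if_scalars_zero)
    fix u v assume s: "(\<Sum>v\<in>rat_frag ` T. rat_scale (u v) v) = 0" and v: "v \<in> rat_frag ` T"
    obtain N :: int where N: "N \<noteq> 0" "\<forall>x\<in>T. \<exists>n. of_int N * u (rat_frag x) = of_int n"
      using common_denominator[OF assms, of "u \<circ> rat_frag"] by auto
    then obtain c where c: "\<And>x. x \<in> T \<Longrightarrow> of_int N * u (rat_frag x) = of_int (c x)"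
      by metis
    have "rat_frag (\<Sum>x\<in>T. frag_cmul (c x) x) = (\<Sum>x\<in>T. rat_scale (of_int (c x)) (rat_frag x))"
      by (rule rat_frag_sum_cmul)
    also have "\<dots> = (\<Sum>x\<in>T. rat_scale (of_int N) (rat_scale (u (rat_frag x)) (rat_frag x)))"
      by (intro sum.cong refl) (simp only: c[symmetric] Q.scale_scale)
    also have "\<dots> = rat_scale (of_int N) (\<Sum>v\<in>rat_frag ` T. rat_scale (u v) v)"
      by (simp add: sum.reindex[OF inj] Q.scale_sum_right)
    finally have "(\<Sum>x\<in>T. frag_cmul (c x) x) = 0" using s by (simp add: rat_frag_eq_0_iff)
    then have "\<forall>x\<in>T. c x = 0" using R by blast
    then have "\<forall>x\<in>T. u (rat_frag x) = 0" using c N by (metis mult_eq_0_iff of_int_0 of_int_eq_0_iff)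
    then show "u v = 0" using v by blast
  qed (use assms in simp)
qed

text \<open>\<open>Q.dim\<close> of a set is the dimension of its span, so for a subgroup of a free
  abelian group this is the dimension after extending scalars to the rationals.\<close>

definition frag_rank :: "('a \<Rightarrow>\<^sub>0 int) set \<Rightarrow> nat" where
  "frag_rank A = Q.dim (rat_frag ` A)"

lemma frag_rank_zero: "frag_rank {0} = 0"
  unfolding frag_rank_def by (rule Q.dim_unique[where B="{}"]) (auto simp: Q.dependent_def)

lemma rat_frag_in_span:
  assumes "finite S" "Poly_Mapping.keys x \<subseteq> S"
  shows "rat_frag x \<in> Q.span (rat_frag ` frag_of ` S)"
proof -
  have "rat_frag x = (\<Sum>s\<in>S. rat_scale (of_int (Poly_Mapping.lookup x s)) (rat_frag (frag_of s)))"
  proof (rule poly_mapping_eqI)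
    fix k
    have "(\<Sum>s\<in>S. of_int (Poly_Mapping.lookup x s) * of_int (Poly_Mapping.lookup (frag_of s) k))
        = (\<Sum>s\<in>S. if s = k then (of_int (Poly_Mapping.lookup x s) :: rat) else 0)"
      by (intro sum.cong) (auto simp: lookup_single when_def)
    then show "Poly_Mapping.lookup (rat_frag x) k = Poly_Mapping.lookup
      (\<Sum>s\<in>S. rat_scale (of_int (Poly_Mapping.lookup x s)) (rat_frag (frag_of s))) k"
      using assms by (auto simp: lookup_sum not_in_keys_iff_lookup_eq_zero subset_iff)
  qed
  also have "\<dots> \<in> Q.span (rat_frag ` frag_of ` S)"
    by (intro Q.span_sum Q.span_scale Q.span_base) auto
  finally show ?thesis .
qed

lemma frag_rank_free:
  assumes "finite S"
  shows "frag_rank {x. Poly_Mapping.keys x \<subseteq> S} = card S"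
proof -
  have "Q.independent (rat_frag ` frag_of ` S)"
  proof (subst independent_rat_frag_iff)
    show "\<forall>c. (\<Sum>x\<in>frag_of ` S. frag_cmul (c x) x) = 0 \<longrightarrow> (\<forall>x\<in>frag_of ` S. c x = 0)"
    proof (intro allI impI ballI)
      fix c :: "('a \<Rightarrow>\<^sub>0 int) \<Rightarrow> int" and x
      assume s: "(\<Sum>x\<in>frag_of ` S. frag_cmul (c x) x) = 0" and "x \<in> frag_of ` S"
      then obtain k where k: "x = frag_of k" "k \<in> S" by blast
      have inj: "inj_on frag_of S" by (rule inj_onI) (metis keys_frag_of singleton_inject)
      have "0 = Poly_Mapping.lookup (\<Sum>s\<in>S. frag_cmul (c (frag_of s)) (frag_of s)) k"
        using s by (simp add: sum.reindex[OF inj])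
      also have "\<dots> = (\<Sum>s\<in>S. if s = k then c (frag_of s) else 0)"
        unfolding lookup_sum by (intro sum.cong) (auto simp: lookup_single when_def)
      also have "\<dots> = c x" using k assms by simp
      finally show "c x = 0" by simp
    qed
  qed (use assms in simp)
  moreover have "card (rat_frag ` frag_of ` S) = card S"
    by (subst card_image, use inj_rat_frag inj_on_subset in blast)
      (metis card_image inj_onI keys_frag_of singleton_inject)
  ultimately show ?thesis unfolding frag_rank_def
    by (intro Q.dim_unique[where B="rat_frag ` frag_of ` S"])
      (use rat_frag_in_span[OF assms] in auto)
qed

text \<open>A surjective homomorphism from a subgroup \<open>A\<close> of a finitely generated free
  abelian group, written additively, onto an abstract group \<open>G\<close>, written
  multiplicatively. The instances are a linear map onto its image, the identity of a subgroup, and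
  the passage from homogeneous cycles to their homology classes.\<close>

locale frag_quotient = comm_group G for G (structure) +
  fixes A :: "('b \<Rightarrow>\<^sub>0 int) set" and \<pi> :: "('b \<Rightarrow>\<^sub>0 int) \<Rightarrow> 'a" and S :: "'b set"
  assumes finite_S: "finite S"
    and keys_A: "x \<in> A \<Longrightarrow> Poly_Mapping.keys x \<subseteq> S"
    and zero_A: "0 \<in> A"
    and diff_A: "\<lbrakk>x \<in> A; y \<in> A\<rbrakk> \<Longrightarrow> x - y \<in> A"
    and add_hom: "\<lbrakk>x \<in> A; y \<in> A\<rbrakk> \<Longrightarrow> \<pi> (x + y) = \<pi> x \<otimes> \<pi> y"
    and image_A: "\<pi> ` A = carrier G"
begin

lemma closed [simp]: "x \<in> A \<Longrightarrow> \<pi> x \<in> carrier G"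
  using image_A by blast

lemma minus_A: "x \<in> A \<Longrightarrow> - x \<in> A"
  using diff_A[OF zero_A] by fastforce

lemma add_A: "\<lbrakk>x \<in> A; y \<in> A\<rbrakk> \<Longrightarrow> x + y \<in> A"
  using diff_A[of x "- y"] minus_A by simp

lemma zero_hom: "\<pi> 0 = \<one>"
  using add_hom[OF zero_A zero_A] zero_A by (simp add: r_cancel_one')

lemma minus_hom: "x \<in> A \<Longrightarrow> \<pi> (- x) = inv (\<pi> x)"
  using add_hom[of "-x" x] minus_A[of x] zero_hom by (intro inv_equality[symmetric]) auto

lemma nat_cmul: "x \<in> A \<Longrightarrow> frag_cmul (int n) x \<in> A \<and> \<pi> (frag_cmul (int n) x) = \<pi> x [^] n"
proof (induction n)
  case 0
  show ?case by (simp add: zero_A zero_hom)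
next
  case (Suc n)
  have eq: "frag_cmul (int (Suc n)) x = frag_cmul (int n) x + x"
    using frag_cmul_distrib[of "int n" 1 x] by (simp add: add.commute)
  have n: "frag_cmul (int n) x \<in> A" "\<pi> (frag_cmul (int n) x) = \<pi> x [^] n"
    using Suc by auto
  show ?case
    unfolding eq add_hom[OF n(1) Suc.prems] n(2) nat_pow_Suc
    using add_A[OF n(1) Suc.prems] by blast
qed

lemma cmul_A: "x \<in> A \<Longrightarrow> frag_cmul n x \<in> A"
  and cmul_hom: "x \<in> A \<Longrightarrow> \<pi> (frag_cmul n x) = \<pi> x [^] n"
proof -
  assume x: "x \<in> A"
  have "frag_cmul n x \<in> A \<and> \<pi> (frag_cmul n x) = \<pi> x [^] n"
  proof (cases n rule: int_cases2)
    case (nonneg m)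
    then show ?thesis using nat_cmul[OF x, of m] by (simp only: int_pow_int)
  next
    case (nonpos m)
    have "frag_cmul n x = - frag_cmul (int m) x" unfolding nonpos by simp
    moreover have "\<pi> x [^] n = inv (\<pi> x [^] m)"
      unfolding nonpos by (rule int_pow_neg_int[OF closed[OF x]])
    ultimately show ?thesis using nat_cmul[OF x, of m] minus_A[of "frag_cmul (int m) x"]
      minus_hom[of "frag_cmul (int m) x"] by metis
  qed
  then show "frag_cmul n x \<in> A" "\<pi> (frag_cmul n x) = \<pi> x [^] n" by blast+
qed

lemma sum_hom:
  assumes "finite I" "\<And>i. i \<in> I \<Longrightarrow> f i \<in> A"
  shows "sum f I \<in> A \<and> \<pi> (sum f I) = finprod G (\<lambda>i. \<pi> (f i)) I"
  using assms
proof (induction I)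
  case (insert i I)
  then have "finprod G (\<lambda>i. \<pi> (f i)) (insert i I) = \<pi> (f i) \<otimes> finprod G (\<lambda>i. \<pi> (f i)) I"
    by (intro finprod_insert) auto
  moreover have "f i \<in> A" "sum f I \<in> A" "\<pi> (sum f I) = finprod G (\<lambda>i. \<pi> (f i)) I"
    using insert by simp_all
  ultimately show ?case using insert(1,2) by (simp add: add_A add_hom)
qed (simp add: zero_A zero_hom)

text \<open>Independence in \<open>G\<close> speaks of products of integer powers; this replaces
  such a product by the image of a single integral combination in \<open>A\<close>, where linear
  algebra is available.\<close>

lemma finprod_pow:
  assumes "finite T" "T \<subseteq> A"
  shows "finprod G (\<lambda>x. \<pi> x [^] (c x :: int)) T = \<pi> (\<Sum>x\<in>T. frag_cmul (c x) x)"
proof -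
  have "\<pi> (\<Sum>x\<in>T. frag_cmul (c x) x) = finprod G (\<lambda>x. \<pi> (frag_cmul (c x) x)) T"
    using sum_hom[of T "\<lambda>x. frag_cmul (c x) x"] assms cmul_A by auto
  also have "\<dots> = finprod G (\<lambda>x. \<pi> x [^] (c x :: int)) T"
    using assms by (intro finprod_cong') (auto simp: cmul_hom)
  finally show ?thesis by simp
qed

definition ker where "ker = {x \<in> A. \<pi> x = \<one>}"

text \<open>Extend a basis \<open>B\<close> of the span of the kernel to a basis \<open>C\<close> of
  the span of \<open>A\<close>. The elements of \<open>C\<close> outside \<open>B\<close> have
  independent images in \<open>G\<close>, because a combination of them that lies in the kernel also
  depends on \<open>B\<close>. Conversely, an independent family of \<open>G\<close>, lifted to
  \<open>A\<close>, stays independent when joined with \<open>B'\<close>, so it has at most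
  \<open>card C - card B\<close> members.\<close>

theorem rank_quotient: "abelian_rank G + frag_rank ker = frag_rank A"
proof -
  let ?X = "rat_frag ` ker" and ?Y = "rat_frag ` A"
  have XY: "?X \<subseteq> ?Y" by (auto simp: ker_def)
  obtain B where B: "B \<subseteq> ?X" "Q.independent B" "?X \<subseteq> Q.span B"
    by (rule Q.maximal_independent_subset) (rule that)
  obtain C where C: "B \<subseteq> C" "C \<subseteq> ?Y" "Q.independent C" "?Y \<subseteq> Q.span C"
    by (rule Q.maximal_independent_subset_extend[OF subset_trans[OF B(1) XY] B(2)]) (rule that)
  have "?Y \<subseteq> Q.span (rat_frag ` frag_of ` S)"
    by (rule image_subsetI) (rule rat_frag_in_span[OF finite_S keys_A])
  with C(2) have "C \<subseteq> Q.span (rat_frag ` frag_of ` S)" by (rule subset_trans)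
  with C(3) have finC: "finite C" using Q.independent_span_bound finite_S by (metis finite_imageI)
  with C(1) have finB: "finite B" by (rule finite_subset)
  have rX: "frag_rank ker = card B" and rY: "frag_rank A = card C"
    unfolding frag_rank_def
    by (rule Q.dim_unique[OF B(1,3,2) refl], rule Q.dim_unique[OF C(2,4,3) refl])
  obtain B' where B': "B' \<subseteq> ker" "rat_frag ` B' = B"
    using B(1) unfolding subset_image_iff by metis
  have "C - B \<subseteq> ?Y" using C(2) by (rule subset_trans[OF Diff_subset])
  then obtain C' where C': "C' \<subseteq> A" "rat_frag ` C' = C - B"
    unfolding subset_image_iff by metis
  have inj: "inj_on rat_frag U" for U :: "('b \<Rightarrow>\<^sub>0 int) set"
    using inj_rat_frag inj_on_subset by blast
  have finB': "finite B'" and finC': "finite C'"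
    using finite_imageD[OF _ inj, of B'] finite_imageD[OF _ inj, of C'] finB finC
    unfolding B'(2) C'(2) by simp_all
  have cardC': "card C' = card C - card B" and cardB': "card B' = card B"
    using card_image[OF inj, of C'] card_image[OF inj, of B'] C'(2) B'(2)
    by (simp_all add: card_Diff_subset[OF finB C(1)])
  have indC: "Q.independent (rat_frag ` (B' \<union> C'))"
    using C(1,3) B'(2) C'(2) by (metis Diff_partition image_Un)
  have key: "c x = 0" if ker: "(\<Sum>x\<in>C'. frag_cmul (c x) x) \<in> ker" and x: "x \<in> C'" for c x
  proof -
    have "rat_frag (\<Sum>x\<in>C'. frag_cmul (c x) x) \<in> Q.span B" using ker B(3) by blast
    then obtain u where "rat_frag (\<Sum>x\<in>C'. frag_cmul (c x) x) = (\<Sum>v\<in>B. rat_scale (u v) v)"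
      using Q.span_finite[OF finB] by auto
    then have eq: "(\<Sum>x\<in>C'. rat_scale (of_int (c x)) (rat_frag x)) = (\<Sum>v\<in>B. rat_scale (u v) v)"
      using rat_frag_sum_cmul[of c "\<lambda>x. x" C'] by simp
    \<comment> \<open>Coefficients of the difference of the two expressions in \<open>eq\<close>,
      read as a relation over the basis \<open>C\<close>.\<close>
    define w where "w = (\<lambda>v. if v \<in> B then - u v else of_int (c (the_inv_into UNIV rat_frag v)))"
    have w: "w (rat_frag x) = of_int (c x)" if "x \<in> C'" for x
      using that C'(2) the_inv_f_f[OF inj_rat_frag, of x] by (auto simp: w_def)
    have "(\<Sum>v\<in>C. rat_scale (w v) v) = (\<Sum>v\<in>C - B. rat_scale (w v) v) + (\<Sum>v\<in>B. rat_scale (w v) v)"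
      by (rule sum.subset_diff[OF C(1) finC])
    also have "(\<Sum>v\<in>C - B. rat_scale (w v) v) = (\<Sum>x\<in>C'. rat_scale (w (rat_frag x)) (rat_frag x))"
      using sum.reindex[OF inj, of "\<lambda>v. rat_scale (w v) v" C'] C'(2) by simp
    also have "\<dots> = (\<Sum>x\<in>C'. rat_scale (of_int (c x)) (rat_frag x))"
      by (intro sum.cong) (auto simp: w)
    also have "(\<Sum>v\<in>B. rat_scale (w v) v) = - (\<Sum>v\<in>B. rat_scale (u v) v)"
      by (simp add: w_def sum_negf)
    finally have "(\<Sum>v\<in>C. rat_scale (w v) v) = 0" using eq by simp
    then have "w (rat_frag x) = 0"
      by (rule Q.independentD[OF C(3) finC order_refl]) (use x C'(2) in blast)
    then show ?thesis using w[OF x] by simp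
  qed
  have finprod_image: "finprod G (\<lambda>y. y [^] (c y :: int)) (\<pi> ` T) = \<pi> (\<Sum>x\<in>T. frag_cmul (c (\<pi> x)) x)"
    if "finite T" "T \<subseteq> A" "inj_on \<pi> T" for c T
  proof -
    have "finprod G (\<lambda>y. y [^] (c y :: int)) (\<pi> ` T) = finprod G (\<lambda>x. \<pi> x [^] (c (\<pi> x) :: int)) T"
      using that by (intro finprod_reindex) auto
    then show ?thesis using finprod_pow[OF that(1,2)] by simp
  qed
  have injC': "inj_on \<pi> C'"
  proof (rule inj_onI, rule ccontr)
    fix x y assume xy: "x \<in> C'" "y \<in> C'" "\<pi> x = \<pi> y" "x \<noteq> y"
    then have xyA: "x \<in> A" "y \<in> A" using C'(1) by auto
    \<comment> \<open>Two elements with equal images would give a kernel element with the nonzero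
      coefficients 1 and -1, against \<open>key\<close>.\<close>
    define c where "c = (\<lambda>z. if z = x then 1 else if z = y then -1 else 0 :: int)"
    have "(\<Sum>z\<in>C'. frag_cmul (c z) z) = (\<Sum>z\<in>{x, y}. frag_cmul (c z) z)"
      using xy finC' by (intro sum.mono_neutral_right) (auto simp: c_def)
    also have "\<dots> = x - y" using xy(4) by (simp add: c_def)
    finally have "(\<Sum>z\<in>C'. frag_cmul (c z) z) = x - y" .
    moreover have "x - y \<in> ker"
      using xyA xy(3) add_hom[of x "- y"] minus_A minus_hom diff_A by (simp add: ker_def)
    ultimately show False using key[of c x] xy by (simp add: c_def)
  qed
  have lower: "indep_in G (\<pi> ` C')"
    unfolding indep_in_def
  proof (intro allI impI)
    fix c :: "'a \<Rightarrow> int"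
    assume "finprod G (\<lambda>x. x [^] c x) (\<pi> ` C') = \<one>"
    then have "(\<Sum>x\<in>C'. frag_cmul (c (\<pi> x)) x) \<in> ker"
      using finprod_image[OF finC' C'(1) injC'] sum_hom[of C' "\<lambda>x. frag_cmul (c (\<pi> x)) x"] finC'
        cmul_A C'(1) by (auto simp: ker_def)
    then show "\<forall>x\<in>\<pi> ` C'. c x = 0" using key[of "\<lambda>x. c (\<pi> x)"] by blast
  qed
  have upper: "card T \<le> card C - card B" if T: "finite T" "T \<subseteq> carrier G" "indep_in G T" for T
  proof -
    have "\<forall>s\<in>T. \<exists>x. x \<in> A \<and> \<pi> x = s" using T(2) unfolding image_A[symmetric] by blast
    from bchoice[OF this] obtain a where a: "\<And>s. s \<in> T \<Longrightarrow> a s \<in> A \<and> \<pi> (a s) = s" by blast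
    define U where "U = a ` T"
    have finU: "finite U" using T(1) by (simp add: U_def)
    have UA: "U \<subseteq> A" using a by (auto simp: U_def)
    have \<pi>U: "\<pi> ` U = T" using a by (force simp: U_def)
    have injU: "inj_on \<pi> U" using a by (auto simp: U_def inj_on_def)
    have cardU: "card U = card T" using card_image[OF injU] \<pi>U by simp
    have B'A: "B' \<subseteq> A" using B' by (auto simp: ker_def)
    \<comment> \<open>The unit is annihilated by the coefficient 1, so it cannot belong to an
      independent family. Hence no lift of a member of \<open>T\<close> lies in the kernel, and the
      lifts are disjoint from \<open>B'\<close>.\<close>
    have one: "\<one> \<notin> T"
    proof
      assume *: "\<one> \<in> T"
      have "finprod G (\<lambda>x. x [^] (if x = \<one> then 1 else 0 :: int)) T = finprod G (\<lambda>x. \<one>) T"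
        using T by (intro finprod_cong') auto
      then have "finprod G (\<lambda>x. x [^] (if x = \<one> then 1 else 0 :: int)) T = \<one>" by simp
      with T(3) have "\<forall>x\<in>T. (if x = \<one> then 1 else 0 :: int) = 0" unfolding indep_in_def by fast
      with * show False by auto
    qed
    have dis: "U \<inter> B' = {}"
      using one B'(1) a by (force simp: U_def ker_def)
    have "Q.independent (rat_frag ` (U \<union> B'))"
    proof (subst independent_rat_frag_iff)
      show "finite (U \<union> B')" using finU finB' by simp
      show "\<forall>c. (\<Sum>x\<in>U \<union> B'. frag_cmul (c x) x) = 0 \<longrightarrow> (\<forall>x\<in>U \<union> B'. c x = 0)"
      proof (intro allI impI)
        fix c :: "('b \<Rightarrow>\<^sub>0 int) \<Rightarrow> int"
        assume s: "(\<Sum>x\<in>U \<union> B'. frag_cmul (c x) x) = 0"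
        then have s': "(\<Sum>x\<in>U. frag_cmul (c x) x) + (\<Sum>x\<in>B'. frag_cmul (c x) x) = 0"
          using sum.union_disjoint[OF finU finB' dis, of "\<lambda>x. frag_cmul (c x) x"] by simp
        have sU: "(\<Sum>x\<in>U. frag_cmul (c x) x) \<in> A"
          using sum_hom[of U "\<lambda>x. frag_cmul (c x) x"] finU UA cmul_A by blast
        have sB: "(\<Sum>x\<in>B'. frag_cmul (c x) x) \<in> A"
          using sum_hom[of B' "\<lambda>x. frag_cmul (c x) x"] finB' B'A cmul_A by blast
        have "\<pi> (\<Sum>x\<in>B'. frag_cmul (c x) x) = finprod G (\<lambda>x. \<pi> x [^] c x) B'"
          using finprod_pow[OF finB' B'A] by simp
        also have "\<dots> = finprod G (\<lambda>x. \<one>) B'"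
          using B'(1) by (intro finprod_cong') (auto simp: ker_def)
        finally have "\<pi> (\<Sum>x\<in>B'. frag_cmul (c x) x) = \<one>" by simp
        then have "\<pi> (\<Sum>x\<in>U. frag_cmul (c x) x) = \<one>"
          using add_hom[OF sU sB] s' zero_hom sU by simp
        moreover have "(\<Sum>x\<in>U. frag_cmul (c x) x) = (\<Sum>x\<in>U. frag_cmul (c (a (\<pi> x))) x)"
          using a by (intro sum.cong) (auto simp: U_def)
        ultimately have "finprod G (\<lambda>y. y [^] c (a y)) T = \<one>"
          using finprod_image[OF finU UA injU, of "c \<circ> a"] \<pi>U by simp
        then have "\<forall>y\<in>T. c (a y) = 0" using T(3) unfolding indep_in_def
          by (elim allE[of _ "\<lambda>y. c (a y)"]) simp
        then have cU: "\<forall>x\<in>U. c x = 0" by (simp add: U_def)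
        then have "(\<Sum>x\<in>U. frag_cmul (c x) x) = 0" by simp
        then have "(\<Sum>x\<in>B'. frag_cmul (c x) x) = 0" using s' by simp
        then have "\<forall>x\<in>B'. c x = 0" using independent_rat_frag_iff[OF finB'] B(2) B'(2) by blast
        with cU show "\<forall>x\<in>U \<union> B'. c x = 0" by blast
      qed
    qed
    moreover have "rat_frag ` (U \<union> B') \<subseteq> Q.span C" using UA B'A C(4) by blast
    ultimately have "card (rat_frag ` (U \<union> B')) \<le> card C"
      using Q.independent_span_bound[OF finC] by blast
    then have "card U + card B' \<le> card C"
      using card_image[OF inj, of "U \<union> B'"] card_Un_disjoint[OF finU finB' dis] by simp
    then show ?thesis using cardU cardB' by simp
  qed
  have "abelian_rank G = card C - card B"
    unfolding abelian_rank_def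
  proof (rule cSup_eq_maximum)
    show "card C - card B \<in> {card S |S. finite S \<and> S \<subseteq> carrier G \<and> indep_in G S}"
      using lower card_image[OF injC'] cardC' finC' C'(1)
      by (intro CollectI exI[of _ "\<pi> ` C'"]) auto
  qed (use upper in blast)
  then show ?thesis using rX rY card_mono[OF finC C(1)] by simp
qed

end


section \<open>Orbits of permutations\<close>

lemma orbit_eq_orbit:
  assumes "permutation f" "y \<in> orbit f x"
  shows "orbit f y = orbit f x"
  using assms cyclic_on_orbit' orbit_cyclic_eq3 by metis

text \<open>The inductive set \<open>orbit f x\<close> starts at \<open>f x\<close> and not at
  \<open>x\<close>, hence the form of the base condition.\<close>

lemma orbit_subset_closed:
  assumes "f x \<in> A" "\<And>y. y \<in> A \<Longrightarrow> f y \<in> A"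
  shows "orbit f x \<subseteq> A"
proof
  fix y assume "y \<in> orbit f x"
  then show "y \<in> A" by induction (use assms in auto)
qed

text \<open>Here \<open>r\<close> is the first return map of \<open>f\<close> to \<open>T\<close>.
  It never jumps over a visit to \<open>T\<close>, so every visit is reached by successive returns;
  the induction is on the number of steps of \<open>f\<close> still to go.\<close>

lemma orbit_first_return:
  assumes ret: "\<And>y. y \<in> T \<Longrightarrow> 0 < k y \<and> r y = (f ^^ k y) y \<and> r y \<in> T
      \<and> (\<forall>i. 0 < i \<and> i < k y \<longrightarrow> (f ^^ i) y \<notin> T)"
    and "x \<in> T"
  shows "orbit r x = orbit f x \<inter> T"
proof
  show "orbit r x \<subseteq> orbit f x \<inter> T"
  proof (rule orbit_subset_closed)
    show "r x \<in> orbit f x \<inter> T"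
      using ret[OF \<open>x \<in> T\<close>] by (auto simp: orbit_altdef)
    fix y assume y: "y \<in> orbit f x \<inter> T"
    then show "r y \<in> orbit f x \<inter> T"
      using ret[of y] funpow_in_orbit[of y f x "k y"] by auto
  qed
next
  have *: "(f ^^ n) x \<in> orbit r x" if "x \<in> T" "0 < n" "(f ^^ n) x \<in> T" for n x
    using that
  proof (induction n arbitrary: x rule: less_induct)
    case (less n)
    note rx = ret[OF less.prems(1)]
    have "k x \<le> n" using rx less.prems by (meson not_le)
    show ?case
    proof (cases "n = k x")
      case True
      then show ?thesis using rx orbit.base[of r x] by simp
    next
      case False
      with \<open>k x \<le> n\<close> have n: "n = (n - k x) + k x" "0 < n - k x" "n - k x < n" using rx by auto
      have eq: "(f ^^ n) x = (f ^^ (n - k x)) (r x)"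
        using rx n(1) by (metis funpow_add comp_apply)
      have "(f ^^ (n - k x)) (r x) \<in> orbit r (r x)"
      proof (rule less.IH[OF n(3) _ n(2)])
        show "(f ^^ (n - k x)) (r x) \<in> T" using less.prems(3) unfolding eq .
      qed (use rx in blast)
      then show ?thesis unfolding eq by (rule orbit_subset)
    qed
  qed
  show "orbit f x \<inter> T \<subseteq> orbit r x"
    using *[OF \<open>x \<in> T\<close>] by (auto simp: orbit_altdef[of f])
qed

section \<open>Cycles of a permutation under multiplication by a transposition\<close>

locale transposed_perm =
  fixes f g :: "'a \<Rightarrow> 'a" and a b :: 'a
  assumes perm_f: "permutation f" and ab: "a \<noteq> b" and g_def: "g = f \<circ> transpose a b"
begin

lemma g_a: "g a = f b" and g_b: "g b = f a"
  and g_other: "x \<noteq> a \<Longrightarrow> x \<noteq> b \<Longrightarrow> g x = f x"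
  by (auto simp: g_def)

lemma perm_g: "permutation g"
  unfolding g_def by (intro permutation_compose perm_f permutation_swap_id)

text \<open>A transposition is an involution. Facts about joining cycles can therefore be read
  backwards as facts about cutting them.\<close>

lemma swap_roles: "transposed_perm g f a b"
  by unfold_locales (use ab perm_g in \<open>auto simp: g_def fun_eq_iff\<close>)

lemma swap_points: "transposed_perm f g b a"
  by unfold_locales (use ab perm_f in \<open>auto simp: g_def transpose_commute\<close>)

lemma orbit_avoiding:
  assumes "a \<notin> orbit f x" "b \<notin> orbit f x"
  shows "orbit g x = orbit f x"
proof (rule orbit_cong)
  show "x \<in> orbit f x" by (rule permutation_self_in_orbit[OF perm_f])
  fix y assume "y \<in> orbit f x"
  then show "g y = f y" using assms by (intro g_other) auto
qed

text \<open>From \<open>a\<close> the map \<open>g\<close> jumps to \<open>f b\<close>. On the cycle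
  of \<open>b\<close>, which avoids \<open>a\<close>, it then agrees with \<open>f\<close> until it
  arrives at \<open>b\<close>, so it sweeps the whole cycle.\<close>

lemma orbit_merge_subset:
  assumes "b \<notin> orbit f a"
  shows "orbit f b \<subseteq> orbit g a"
proof -
  have a: "a \<notin> orbit f b"
    using assms orbit_eq_orbit[OF perm_f, of a b] permutation_self_in_orbit[OF perm_f, of b] by metis
  have "orbit f b \<subseteq> orbit g a \<inter> orbit f b"
  proof (rule orbit_subset_closed)
    show "f b \<in> orbit g a \<inter> orbit f b" using orbit.base[of g a] orbit.base[of f b] g_a by simp
    fix y assume y: "y \<in> orbit g a \<inter> orbit f b"
    then have "f y \<in> orbit f b" by (auto intro: orbit.step)
    moreover have "f y \<in> orbit g a"
    proof (cases "y = b")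
      case True
      then show ?thesis using orbit.base[of g a] g_a by simp
    next
      case False
      then have "g y = f y" using y a by (intro g_other) auto
      then show ?thesis using y orbit.step[of y g a] by simp
    qed
    ultimately show "f y \<in> orbit g a \<inter> orbit f b" by blast
  qed
  then show ?thesis by blast
qed

lemma orbit_merge:
  assumes "b \<notin> orbit f a"
  shows "orbit g a = orbit f a \<union> orbit f b" "b \<in> orbit g a"
proof -
  have a: "a \<notin> orbit f b"
    using assms orbit_eq_orbit[OF perm_f, of a b] permutation_self_in_orbit[OF perm_f, of b] by metis
  have b: "orbit f b \<subseteq> orbit g a" by (rule orbit_merge_subset[OF assms])
  then show b': "b \<in> orbit g a" using permutation_self_in_orbit[OF perm_f, of b] by blast
  have "orbit f a \<subseteq> orbit g b" using transposed_perm.orbit_merge_subset[OF swap_points a] .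
  also have "\<dots> = orbit g a" using orbit_eq_orbit[OF perm_g b'] .
  finally have "orbit f a \<union> orbit f b \<subseteq> orbit g a" using b by blast
  moreover have "orbit g a \<subseteq> orbit f a \<union> orbit f b"
  proof (rule orbit_subset_closed)
    show "g a \<in> orbit f a \<union> orbit f b" using g_a orbit.base[of f b] by simp
    fix y assume y: "y \<in> orbit f a \<union> orbit f b"
    show "g y \<in> orbit f a \<union> orbit f b"
    proof (cases "y = a \<or> y = b")
      case True
      then show ?thesis using g_a g_b orbit.base[of f a] orbit.base[of f b] by auto
    next
      case False
      then have "g y = f y" by (intro g_other) auto
      then show ?thesis using y orbit.step[of y f a] orbit.step[of y f b] by auto
    qed
  qed
  ultimately show "orbit g a = orbit f a \<union> orbit f b" by blast
qed

text \<open>The map \<open>g\<close> sends \<open>a\<close> to \<open>f b\<close>, follows the cycle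
  of \<open>f\<close> up to the first visit to \<open>a\<close>, and jumps back to
  \<open>f b\<close>. This closed arc \<open>A\<close> misses \<open>b\<close>.\<close>

lemma orbit_split:
  assumes "b \<in> orbit f a"
  shows "b \<notin> orbit g a"
proof -
  have "a \<in> orbit f b"
    using orbit_eq_orbit[OF perm_f assms] permutation_self_in_orbit[OF perm_f, of a] by simp
  then have ex: "\<exists>k. 0 < k \<and> (f ^^ k) b = a" by (auto simp: orbit_altdef)
  define k where "k = (LEAST k. 0 < k \<and> (f ^^ k) b = a)"
  have k: "0 < k" "(f ^^ k) b = a" using LeastI_ex[OF ex] by (auto simp: k_def)
  have least: "(f ^^ i) b \<noteq> a" if i: "0 < i" "i < k" for i
    using not_less_Least[of i "\<lambda>k. 0 < k \<and> (f ^^ k) b = a"] i by (auto simp: k_def)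
  \<comment> \<open>A return to \<open>b\<close> after \<open>i\<close> steps would bring the first
    visit to \<open>a\<close> forward to step \<open>k - i\<close>.\<close>
  have nb: "(f ^^ i) b \<noteq> b" if i: "0 < i" "i \<le> k" for i
  proof
    assume eq: "(f ^^ i) b = b"
    with k ab have "i < k" using i by (cases "i = k") auto
    have "(f ^^ k) b = (f ^^ (k - i)) ((f ^^ i) b)"
      using \<open>i < k\<close> by (simp add: funpow_add[symmetric, THEN fun_cong, simplified])
    then show False using least[of "k - i"] i \<open>i < k\<close> k eq by simp
  qed
  define A where "A = (\<lambda>i. (f ^^ i) b) ` {1..k}"
  have "orbit g a \<subseteq> A"
  proof (rule orbit_subset_closed)
    show ga: "g a \<in> A" unfolding A_def g_a using k by (intro image_eqI[of _ _ 1]) auto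
    fix y assume "y \<in> A"
    then obtain i where i: "1 \<le> i" "i \<le> k" "y = (f ^^ i) b" by (auto simp: A_def)
    show "g y \<in> A"
    proof (cases "i = k")
      case True
      then show ?thesis using ga i k by simp
    next
      case False
      then have "g y = f y" using least[of i] nb[of i] i by (intro g_other) auto
      then show ?thesis unfolding A_def using i False by (intro image_eqI[of _ _ "Suc i"]) auto
    qed
  qed
  moreover have "b \<notin> A"
  proof
    assume "b \<in> A"
    then obtain i where i: "1 \<le> i" "i \<le> k" "b = (f ^^ i) b" by (auto simp: A_def)
    then show False using nb[of i] by simp
  qed
  ultimately show ?thesis by blast
qed

lemma same_orbit_iff: "b \<in> orbit g a \<longleftrightarrow> b \<notin> orbit f a"
  using orbit_split orbit_merge(2) by blast

lemma orbit_g_subset: "orbit g a \<subseteq> orbit f a \<union> orbit f b"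
proof (cases "b \<in> orbit f a")
  case True
  then have "b \<notin> orbit g a" by (rule orbit_split)
  then have "orbit f a = orbit g a \<union> orbit g b"
    by (rule transposed_perm.orbit_merge(1)[OF swap_roles])
  then show ?thesis by blast
next
  case False
  then show ?thesis using orbit_merge(1) by blast
qed

end

section \<open>Adding an edge to an equivalence relation\<close>

text \<open>The new edge unites the classes of \<open>u\<close> and \<open>v\<close> into
  \<open>U\<close> and leaves the set \<open>Q\<close> of all other classes alone. So the finer
  quotient has one or two classes besides \<open>Q\<close>, and the coarser one has exactly
  one.\<close>

lemma quotient_card_add_edge:
  fixes R :: "('v \<times> 'v) set"
  assumes fin: "finite V" and R: "R \<subseteq> V \<times> V" "sym R" and uv: "u \<in> V" "v \<in> V"
  defines "R' \<equiv> R \<union> {(u, v), (v, u)}"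
  shows "(u, v) \<in> R\<^sup>* \<Longrightarrow> card (V // R'\<^sup>*) = card (V // R\<^sup>*)"
    and "card (V // R\<^sup>*) = card (V // R'\<^sup>*) \<or> card (V // R\<^sup>*) = Suc (card (V // R'\<^sup>*))"
proof -
  have sR: "sym (R\<^sup>*)" using R(2) by (rule sym_rtrancl)
  have tR: "trans (R\<^sup>*)" by (rule trans_rtrancl)
  have sR': "sym (R'\<^sup>*)" unfolding R'_def by (rule sym_rtrancl) (use R(2) in \<open>auto simp: sym_def\<close>)
  have RR': "R\<^sup>* \<subseteq> R'\<^sup>*" unfolding R'_def by (rule rtrancl_mono) auto
  have uv': "(u, v) \<in> R'\<^sup>*" "(v, u) \<in> R'\<^sup>*" unfolding R'_def by auto
  define U where "U = R\<^sup>* `` {u} \<union> R\<^sup>* `` {v}"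
  have cl: "y \<in> U" if xU: "x \<in> U" and xy: "(x, y) \<in> R" for x y
    using that unfolding U_def by (auto intro: rtrancl.rtrancl_into_rtrancl)
  have U: "R'\<^sup>* `` {x} = U" if x: "x \<in> U" for x
  proof
    show "R'\<^sup>* `` {x} \<subseteq> U"
    proof
      fix y assume "y \<in> R'\<^sup>* `` {x}"
      then have "(x, y) \<in> R'\<^sup>*" by simp
      then show "y \<in> U"
      proof (induction rule: rtrancl_induct)
        case base then show ?case by (rule x)
      next
        case (step y z)
        then consider "(y, z) \<in> R" | "z = v" | "z = u" unfolding R'_def by auto
        then show ?case
          by cases (use cl[OF step.IH] in \<open>auto simp: U_def\<close>)
      qed
    qed
    have ux: "(u, x) \<in> R'\<^sup>*"
      using x RR' uv' unfolding U_def by (auto intro: rtrancl_trans)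
    then have xu: "(x, u) \<in> R'\<^sup>*" using sR' by (auto simp: sym_def)
    show "U \<subseteq> R'\<^sup>* `` {x}"
    proof
      fix y assume "y \<in> U"
      then have "(u, y) \<in> R'\<^sup>*" using RR' uv' unfolding U_def by (auto intro: rtrancl_trans)
      with xu show "y \<in> R'\<^sup>* `` {x}" by (auto intro: rtrancl_trans)
    qed
  qed
  have nU: "R'\<^sup>* `` {x} = R\<^sup>* `` {x}" if x: "x \<notin> U" for x
  proof
    show "R'\<^sup>* `` {x} \<subseteq> R\<^sup>* `` {x}"
    proof
      fix y assume "y \<in> R'\<^sup>* `` {x}"
      then have "(x, y) \<in> R'\<^sup>*" by simp
      then have "(x, y) \<in> R\<^sup>*"
      proof (induction rule: rtrancl_induct)
        case (step y z)
        \<comment> \<open>A path that starts outside \<open>U\<close> never reaches an end of the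
          new edge, so it cannot use that edge.\<close>
        have "y \<noteq> u" "y \<noteq> v"
          using step.IH x sR unfolding U_def sym_def by blast+
        then have "(y, z) \<in> R" using step.hyps unfolding R'_def by auto
        then show ?case using step.IH by (rule rtrancl.rtrancl_into_rtrancl[rotated])
      qed simp
      then show "y \<in> R\<^sup>* `` {x}" by simp
    qed
    show "R\<^sup>* `` {x} \<subseteq> R'\<^sup>* `` {x}" using RR' by auto
  qed
  have cls: "R\<^sup>* `` {x} = R\<^sup>* `` {w}" if xw: "(w, x) \<in> R\<^sup>*" for x w
    using xw sR unfolding sym_def by (auto intro: rtrancl_trans)
  define Q where "Q = (\<lambda>x. R\<^sup>* `` {x}) ` (V - U)"
  have finQ: "finite Q" using fin by (simp add: Q_def)
  have uvU: "u \<in> U" "v \<in> U" by (auto simp: U_def)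
  have VR': "V // R'\<^sup>* = insert U Q"
  proof -
    have "V // R'\<^sup>* = (\<lambda>x. R'\<^sup>* `` {x}) ` V" by (auto simp: quotient_def)
    also have "\<dots> = (\<lambda>x. R'\<^sup>* `` {x}) ` (V \<inter> U) \<union> (\<lambda>x. R'\<^sup>* `` {x}) ` (V - U)" by blast
    also have "(\<lambda>x. R'\<^sup>* `` {x}) ` (V \<inter> U) = {U}" using U uv uvU by auto
    also have "(\<lambda>x. R'\<^sup>* `` {x}) ` (V - U) = Q" unfolding Q_def by (intro image_cong) (auto simp: nU)
    finally show ?thesis by simp
  qed
  have VR: "V // R\<^sup>* = insert (R\<^sup>* `` {u}) (insert (R\<^sup>* `` {v}) Q)"
  proof -
    have "V // R\<^sup>* = (\<lambda>x. R\<^sup>* `` {x}) ` V" by (auto simp: quotient_def)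
    also have "\<dots> = (\<lambda>x. R\<^sup>* `` {x}) ` (V \<inter> U) \<union> (\<lambda>x. R\<^sup>* `` {x}) ` (V - U)" by blast
    also have "(\<lambda>x. R\<^sup>* `` {x}) ` (V \<inter> U) = {R\<^sup>* `` {u}, R\<^sup>* `` {v}}"
    proof
      show "(\<lambda>x. R\<^sup>* `` {x}) ` (V \<inter> U) \<subseteq> {R\<^sup>* `` {u}, R\<^sup>* `` {v}}"
      proof (rule image_subsetI)
        fix x assume "x \<in> V \<inter> U"
        then have "(u, x) \<in> R\<^sup>* \<or> (v, x) \<in> R\<^sup>*" by (auto simp: U_def)
        then show "R\<^sup>* `` {x} \<in> {R\<^sup>* `` {u}, R\<^sup>* `` {v}}" using cls by (elim disjE) simp_all
      qed
    qed (use uv uvU in auto)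
    finally show ?thesis unfolding Q_def by simp
  qed
  have notQ: "X \<notin> Q" if X: "w \<in> X" "w \<in> U" for X w
  proof
    assume "X \<in> Q"
    then obtain x where x: "x \<notin> U" "X = R\<^sup>* `` {x}" by (auto simp: Q_def)
    then have "(x, w) \<in> R\<^sup>*" using X by simp
    then have "(w, x) \<in> R\<^sup>*" using sR by (auto simp: sym_def)
    then have "x \<in> U" using X(2) unfolding U_def by (auto intro: rtrancl_trans)
    with x show False by simp
  qed
  have c': "card (V // R'\<^sup>*) = Suc (card Q)"
    unfolding VR' using finQ notQ[of u U] uvU by simp
  have nv: "R\<^sup>* `` {u} \<notin> Q" "R\<^sup>* `` {v} \<notin> Q" using notQ[of u] notQ[of v] uvU by auto
  show "card (V // R'\<^sup>*) = card (V // R\<^sup>*)" if e: "(u, v) \<in> R\<^sup>*"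
    unfolding c' VR using cls[OF e] nv finQ by simp
  show "card (V // R\<^sup>*) = card (V // R'\<^sup>*) \<or> card (V // R\<^sup>*) = Suc (card (V // R'\<^sup>*))"
    unfolding c' VR using nv finQ by (cases "R\<^sup>* `` {u} = R\<^sup>* `` {v}") auto
qed


section \<open>Boundary components of the states of a fatgraph\<close>

locale fatgraph_loc =
  fixes F :: "('v, 'h) fatgraph"
  assumes fatgraph: "is_fatgraph F"
begin

definition halfs_in :: "'h set set \<Rightarrow> 'h set" where
  "halfs_in W = {h \<in> halfs F. edge_of F h \<in> W}"

text \<open>
  The boundary components of all states are described by permutations of one and the same set, the
  half-edges of \<open>F\<close>: an absent edge is not crossed. Removing the edge \<open>{h, opp h}\<close> composes
  the permutation with the transposition of \<open>h\<close> and \<open>opp h\<close>. An orbit without half-edges of present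
  edges winds around an isolated vertex of the state.
\<close>

definition bdry_perm :: "'h set set \<Rightarrow> 'h \<Rightarrow> 'h" where
  "bdry_perm W x = (if x \<in> halfs F then nxt F (if edge_of F x \<in> W then opp F x else x) else x)"

definition comp_of :: "'h set set \<Rightarrow> 'h \<Rightarrow> 'h set + 'v" where
  "comp_of W x = (if orbit (bdry_perm W) x \<inter> halfs_in W = {} then Inr (vert_of F x)
     else Inl (orbit (bdry_perm W) x \<inter> halfs_in W))"

text \<open>Only the vertices without half-edges in \<open>F\<close> itself, which no orbit sees. A
  vertex that loses all its edges in a state still carries half-edges of \<open>F\<close> and is
  accounted for by \<open>comp_of\<close>.\<close>

definition isolated :: "('h set + 'v) set" where
  "isolated = Inr ` {v \<in> verts F. halfs_at F v = {}}"

lemma finite_verts: "finite (verts F)" and finite_halfs: "finite (halfs F)"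
  using fatgraph by (auto simp: is_fatgraph_def)

lemma vert_in: "h \<in> halfs F \<Longrightarrow> vert_of F h \<in> verts F"
  using fatgraph by (auto simp: is_fatgraph_def)

lemma opp_in: "h \<in> halfs F \<Longrightarrow> opp F h \<in> halfs F"
  and opp_neq: "h \<in> halfs F \<Longrightarrow> opp F h \<noteq> h"
  and opp_opp: "h \<in> halfs F \<Longrightarrow> opp F (opp F h) = h"
  using fatgraph by (auto simp: is_fatgraph_def)

lemma edge_of_opp: "h \<in> halfs F \<Longrightarrow> edge_of F (opp F h) = edge_of F h"
  by (auto simp: edge_of_def opp_opp)

lemma edge_of_eq_iff:
  "\<lbrakk>x \<in> halfs F; h \<in> halfs F\<rbrakk> \<Longrightarrow> edge_of F x = edge_of F h \<longleftrightarrow> x = h \<or> x = opp F h"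
  using edge_of_opp by (auto simp: edge_of_def)

lemma cyclic_at: "h \<in> halfs F \<Longrightarrow> cyclic_on (nxt F) (halfs_at F (vert_of F h))"
  using fatgraph by (auto simp: is_fatgraph_def halfs_at_def)

lemma nxt_in: "h \<in> halfs F \<Longrightarrow> nxt F h \<in> halfs F"
  and vert_nxt: "h \<in> halfs F \<Longrightarrow> vert_of F (nxt F h) = vert_of F h"
  using cyclic_on_inI[OF cyclic_at, of h h] by (auto simp: halfs_at_def)

lemma orbit_nxt: "h \<in> halfs F \<Longrightarrow> orbit (nxt F) h = halfs_at F (vert_of F h)"
  using orbit_cyclic_eq3[OF cyclic_at, of h h] by (auto simp: halfs_at_def)

text \<open>Every half-edge lies on its own cycle, so \<open>nxt F\<close> maps the finite set of
  half-edges onto itself.\<close>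

lemma inj_on_nxt: "inj_on (nxt F) (halfs F)"
proof (rule eq_card_imp_inj_on[OF finite_halfs])
  have "halfs F \<subseteq> nxt F ` halfs F"
  proof
    fix h assume h: "h \<in> halfs F"
    then have "h \<in> orbit (nxt F) h" by (simp add: orbit_nxt halfs_at_def)
    then obtain n where n: "h = (nxt F ^^ n) h" "0 < n" by (auto simp: orbit_altdef)
    have "(nxt F ^^ m) h \<in> halfs F" for m by (induction m) (simp_all add: h nxt_in)
    moreover have "h = nxt F ((nxt F ^^ (n - 1)) h)"
      using n by (cases n) simp_all
    ultimately show "h \<in> nxt F ` halfs F" by (rule image_eqI[rotated])
  qed
  moreover have "nxt F ` halfs F \<subseteq> halfs F" by (auto simp: nxt_in)
  ultimately show "card (nxt F ` halfs F) = card (halfs F)" by (metis subset_antisym)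
qed

lemma bdry_perm_in: "x \<in> halfs F \<Longrightarrow> bdry_perm W x \<in> halfs F"
  by (auto simp: bdry_perm_def intro: nxt_in opp_in)

text \<open>Both halves of an edge are treated alike, so crossing the present edges is an involution
  of the half-edges, and it is followed by the injective map \<open>nxt F\<close>.\<close>

lemma bdry_perm_permutes: "bdry_perm W permutes halfs F"
proof (rule bij_imp_permutes)
  have "inj_on (bdry_perm W) (halfs F)"
  proof (rule inj_onI)
    fix x y assume x: "x \<in> halfs F" and y: "y \<in> halfs F" and eq: "bdry_perm W x = bdry_perm W y"
    let ?z = "\<lambda>x. if edge_of F x \<in> W then opp F x else x"
    have zx: "?z x \<in> halfs F" and zy: "?z y \<in> halfs F" using x y opp_in by auto
    have "nxt F (?z x) = nxt F (?z y)" using eq x y by (simp add: bdry_perm_def)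
    then have z: "?z x = ?z y" by (rule inj_onD[OF inj_on_nxt _ zx zy])
    show "x = y"
    proof (cases "edge_of F x \<in> W"; cases "edge_of F y \<in> W")
      assume "edge_of F x \<in> W" "edge_of F y \<in> W"
      then have "opp F x = opp F y" using z by simp
      then show "x = y" using opp_opp x y by metis
    next
      assume *: "edge_of F x \<in> W" "edge_of F y \<notin> W"
      then have "opp F x = y" using z by simp
      then show "x = y" using edge_of_opp[OF x] * by simp
    next
      assume *: "edge_of F x \<notin> W" "edge_of F y \<in> W"
      then have "opp F y = x" using z by simp
      then show "x = y" using edge_of_opp[OF y] * by simp
    qed (use z in simp)
  qed
  moreover have "bdry_perm W ` halfs F \<subseteq> halfs F" by (auto simp: bdry_perm_in)
  ultimately show "bij_betw (bdry_perm W) (halfs F) (halfs F)"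
    using finite_halfs by (simp add: bij_betw_def endo_inj_surj)
qed (simp add: bdry_perm_def)

lemma permutation_bdry_perm: "permutation (bdry_perm W)"
  using bdry_perm_permutes finite_halfs by (auto simp: permutation_permutes)

lemma self_in_orbit: "x \<in> orbit (bdry_perm W) x"
  by (rule permutation_self_in_orbit[OF permutation_bdry_perm])

lemma orbit_eq: "y \<in> orbit (bdry_perm W) x \<Longrightarrow> orbit (bdry_perm W) y = orbit (bdry_perm W) x"
  by (rule orbit_eq_orbit[OF permutation_bdry_perm])

lemma orbit_in_halfs: "x \<in> halfs F \<Longrightarrow> orbit (bdry_perm W) x \<subseteq> halfs F"
  by (rule permutes_orbit_subset[OF bdry_perm_permutes])

text \<open>No edge is crossed along such an orbit, so the permutation coincides there with
  \<open>nxt F\<close>, which cycles through the half-edges at a vertex.\<close>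

lemma orbit_without_halfs:
  assumes x: "x \<in> halfs F" and e: "orbit (bdry_perm W) x \<inter> halfs_in W = {}"
  shows "orbit (bdry_perm W) x = halfs_at F (vert_of F x)"
proof -
  have "orbit (nxt F) x = orbit (bdry_perm W) x"
  proof (rule orbit_cong[OF self_in_orbit])
    fix y assume y: "y \<in> orbit (bdry_perm W) x"
    then have "y \<in> halfs F" using orbit_in_halfs[OF x] by blast
    moreover from this have "edge_of F y \<notin> W" using e y by (auto simp: halfs_in_def)
    ultimately show "nxt F y = bdry_perm W y" by (simp add: bdry_perm_def)
  qed
  then show ?thesis using orbit_nxt[OF x] by simp
qed

text \<open>Either form of the value recovers the orbit: a nonempty trace on the present half-edges
  belongs to one orbit only, and an orbit with empty trace consists of all half-edges at the vertex
  that \<open>Inr\<close> records.\<close>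

lemma comp_of_eq_iff:
  assumes x: "x \<in> halfs F" and y: "y \<in> halfs F"
  shows "comp_of W x = comp_of W y \<longleftrightarrow> y \<in> orbit (bdry_perm W) x"
proof
  assume eq: "comp_of W x = comp_of W y"
  show "y \<in> orbit (bdry_perm W) x"
  proof (cases "orbit (bdry_perm W) x \<inter> halfs_in W = {}")
    case True
    then have "vert_of F x = vert_of F y"
      using eq by (auto simp: comp_of_def split: if_splits)
    then show ?thesis using orbit_without_halfs[OF x True] y by (simp add: halfs_at_def)
  next
    case False
    then have "orbit (bdry_perm W) x \<inter> halfs_in W = orbit (bdry_perm W) y \<inter> halfs_in W"
      using eq by (auto simp: comp_of_def split: if_splits)
    with False obtain z where "z \<in> orbit (bdry_perm W) x" "z \<in> orbit (bdry_perm W) y" by blast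
    then have "orbit (bdry_perm W) x = orbit (bdry_perm W) y" using orbit_eq by metis
    then show ?thesis using self_in_orbit by simp
  qed
next
  assume y': "y \<in> orbit (bdry_perm W) x"
  then have eq: "orbit (bdry_perm W) y = orbit (bdry_perm W) x" by (rule orbit_eq)
  show "comp_of W x = comp_of W y"
  proof (cases "orbit (bdry_perm W) x \<inter> halfs_in W = {}")
    case True
    then have "vert_of F y = vert_of F x"
      using orbit_without_halfs[OF x True] y' by (simp add: halfs_at_def)
    then show ?thesis using eq by (simp add: comp_of_def)
  next
    case False
    then show ?thesis using eq by (simp add: comp_of_def)
  qed
qed

lemma comp_of_Inl:
  "\<lbrakk>h \<in> halfs_in W; h \<in> orbit (bdry_perm W) x\<rbrakk>
    \<Longrightarrow> comp_of W x = Inl (orbit (bdry_perm W) x \<inter> halfs_in W)"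
  by (auto simp: comp_of_def)

text \<open>Induced cyclic orders skip absent half-edges, and so does the first return of
  \<open>bdry_perm W\<close> to the present ones: it crosses the present edge once and then moves
  around the vertex by \<open>nxt F\<close>. The boundary orbits of the state are thus traces of
  orbits of \<open>bdry_perm W\<close>, and the orbits without trace account for vertices that have
  half-edges only in \<open>F\<close>.\<close>

lemma bdry_comps_subfat:
  "bdry_comps (subfat F W) = comp_of W ` halfs F \<union> isolated"
proof -
  define r where "r = nxt (subfat F W) \<circ> opp F"
  define k where "k y = (LEAST k. 0 < k \<and> (nxt F ^^ k) (opp F y) \<in> halfs_in W)" for y
  have nxt_sub: "nxt (subfat F W) z = (nxt F ^^ (LEAST k. 0 < k \<and> (nxt F ^^ k) z \<in> halfs_in W)) z" for z
    by (simp add: subfat_def halfs_in_def)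
  have orb: "orbit r x = orbit (bdry_perm W) x \<inter> halfs_in W" if x: "x \<in> halfs_in W" for x
  proof (rule orbit_first_return[OF _ x, where k=k])
    fix y assume y: "y \<in> halfs_in W"
    then have yh: "y \<in> halfs F" "opp F y \<in> halfs F" and oW: "opp F y \<in> halfs_in W"
      using opp_in edge_of_opp by (auto simp: halfs_in_def)
    \<comment> \<open>The half-edge \<open>opp F y\<close> is itself present and recurs on its
      vertex cycle, so the search for a present successor ends.\<close>
    have "opp F y \<in> orbit (nxt F) (opp F y)" using orbit_nxt[OF yh(2)] yh by (simp add: halfs_at_def)
    then have ex: "\<exists>k. 0 < k \<and> (nxt F ^^ k) (opp F y) \<in> halfs_in W"
      using oW by (auto simp: orbit_altdef)
    have k: "0 < k y" "(nxt F ^^ k y) (opp F y) \<in> halfs_in W"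
      using LeastI_ex[OF ex] by (auto simp: k_def)
    have least: "(nxt F ^^ i) (opp F y) \<notin> halfs_in W" if i: "0 < i" "i < k y" for i
      using not_less_Least[of i "\<lambda>k. 0 < k \<and> (nxt F ^^ k) (opp F y) \<in> halfs_in W"] i
      by (auto simp: k_def)
    have nin: "(nxt F ^^ i) (opp F y) \<in> halfs F" for i
      by (induction i) (simp_all add: yh nxt_in)
    \<comment> \<open>Only the first step crosses an edge; all half-edges met strictly before the
      return are absent.\<close>
    have pow: "(bdry_perm W ^^ i) y = (nxt F ^^ i) (opp F y)" if i: "0 < i" "i \<le> k y" for i
      using i
    proof (induction i)
      case (Suc i)
      show ?case
      proof (cases "i = 0")
        case True
        then show ?thesis using y by (simp add: bdry_perm_def halfs_in_def)
      next
        case False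
        then have "(bdry_perm W ^^ i) y = (nxt F ^^ i) (opp F y)" using Suc by simp
        moreover have "edge_of F ((nxt F ^^ i) (opp F y)) \<notin> W"
          using least[of i] Suc.prems False nin[of i] by (simp add: halfs_in_def)
        then have "bdry_perm W ((nxt F ^^ i) (opp F y)) = nxt F ((nxt F ^^ i) (opp F y))"
          using nin[of i] by (simp add: bdry_perm_def)
        ultimately show ?thesis by simp
      qed
    qed simp
    have r: "r y = (nxt F ^^ k y) (opp F y)" by (simp add: r_def nxt_sub k_def)
    show "0 < k y \<and> r y = (bdry_perm W ^^ k y) y \<and> r y \<in> halfs_in W
      \<and> (\<forall>i. 0 < i \<and> i < k y \<longrightarrow> (bdry_perm W ^^ i) y \<notin> halfs_in W)"
      using k r pow least by simp
  qed
  have hs: "halfs (subfat F W) = halfs_in W" by (auto simp: subfat_def halfs_in_def)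
  have at: "halfs_at (subfat F W) v = halfs_at F v \<inter> halfs_in W" for v
    by (auto simp: halfs_at_def subfat_def halfs_in_def)
  have sub: "verts (subfat F W) = verts F" "opp (subfat F W) = opp F"
    by (simp_all add: subfat_def)
  have "bdry_comps (subfat F W) = (\<lambda>h. Inl (orbit r h)) ` halfs_in W
      \<union> Inr ` {v \<in> verts F. halfs_at F v \<inter> halfs_in W = {}}"
    unfolding bdry_comps_def hs at sub r_def ..
  also have "(\<lambda>h. Inl (orbit r h)) ` halfs_in W = comp_of W ` halfs_in W"
    by (intro image_cong refl) (simp add: orb comp_of_Inl self_in_orbit)
  finally have *: "bdry_comps (subfat F W) = comp_of W ` halfs_in W
      \<union> Inr ` {v \<in> verts F. halfs_at F v \<inter> halfs_in W = {}}" .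
  have hF: "halfs_in W \<subseteq> halfs F" by (auto simp: halfs_in_def)
  show ?thesis
  proof
    show "bdry_comps (subfat F W) \<subseteq> comp_of W ` halfs F \<union> isolated"
    proof
      fix c assume "c \<in> bdry_comps (subfat F W)"
      then consider "c \<in> comp_of W ` halfs_in W"
        | v where "c = Inr v" "v \<in> verts F" "halfs_at F v \<inter> halfs_in W = {}"
        unfolding * by blast
      then show "c \<in> comp_of W ` halfs F \<union> isolated"
      proof cases
        case 1
        then show ?thesis using hF by blast
      next
        case 2
        show ?thesis
        proof (cases "halfs_at F v = {}")
          case True
          then show ?thesis using 2 by (auto simp: isolated_def)
        next
          case False
          then obtain x where x: "x \<in> halfs F" "vert_of F x = v" by (auto simp: halfs_at_def)
          \<comment> \<open>All edges at \<open>v\<close> are absent, so the walk never leaves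
            \<open>v\<close>.\<close>
          have "orbit (bdry_perm W) x \<subseteq> halfs_at F v"
          proof (rule orbit_subset_closed)
            have out: "edge_of F y \<notin> W" if y: "y \<in> halfs_at F v" for y
              using y 2(3) by (auto simp: halfs_at_def halfs_in_def)
            show cl: "bdry_perm W y \<in> halfs_at F v" if y: "y \<in> halfs_at F v" for y
              using y out[OF y] nxt_in vert_nxt by (auto simp: bdry_perm_def halfs_at_def)
            show "bdry_perm W x \<in> halfs_at F v" by (rule cl) (use x in \<open>simp add: halfs_at_def\<close>)
          qed
          then have "comp_of W x = Inr v" using 2(3) x by (auto simp: comp_of_def)
          then show ?thesis using x 2(1) by force
        qed
      qed
    qed
    show "comp_of W ` halfs F \<union> isolated \<subseteq> bdry_comps (subfat F W)"
    proof
      fix c assume "c \<in> comp_of W ` halfs F \<union> isolated"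
      then consider x where "x \<in> halfs F" "c = comp_of W x" | "c \<in> isolated" by blast
      then show "c \<in> bdry_comps (subfat F W)"
      proof cases
        case 1
        show ?thesis
        proof (cases "orbit (bdry_perm W) x \<inter> halfs_in W = {}")
          case True
          then have "c = Inr (vert_of F x)" using 1 by (simp add: comp_of_def)
          moreover have "halfs_at F (vert_of F x) \<inter> halfs_in W = {}"
            using orbit_without_halfs[OF 1(1) True] True by simp
          ultimately show ?thesis unfolding * using vert_in[OF 1(1)] by blast
        next
          case False
          then obtain y where y: "y \<in> orbit (bdry_perm W) x" "y \<in> halfs_in W" by blast
          then have "c = comp_of W y" using comp_of_eq_iff[OF 1(1), of y W] hF 1(2) by blast
          then show ?thesis unfolding * using y by blast
        qed
      next
        case 2
        then show ?thesis unfolding * isolated_def by auto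
      qed
    qed
  qed
qed

abbreviation bdry :: "'h set set \<Rightarrow> ('h set + 'v) set" where
  "bdry W \<equiv> bdry_comps (subfat F W)"

lemma finite_bdry: "finite (bdry W)"
  unfolding bdry_comps_subfat isolated_def using finite_halfs finite_verts by simp

text \<open>A set of half-edges that is a component of two states can thus be located in both by any
  of its elements.\<close>

lemma Inl_in_bdry:
  assumes "Inl S \<in> bdry W" "y \<in> S"
  shows "y \<in> halfs_in W" "comp_of W y = Inl S"
proof -
  from assms(1) obtain x where x: "x \<in> halfs F" "comp_of W x = Inl S"
    unfolding bdry_comps_subfat isolated_def by auto
  then have S: "S = orbit (bdry_perm W) x \<inter> halfs_in W"
    by (auto simp: comp_of_def split: if_splits)
  then show y: "y \<in> halfs_in W" using assms(2) by simp
  have "y \<in> orbit (bdry_perm W) x" using S assms(2) by simp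
  then show "comp_of W y = Inl S"
    using comp_of_eq_iff[OF x(1), of y W] x y by (simp add: halfs_in_def)
qed

lemma comp_in_bdry: "x \<in> halfs F \<Longrightarrow> comp_of W x \<in> bdry W"
  unfolding bdry_comps_subfat by simp

lemma isolated_in_bdry: "c \<in> isolated \<Longrightarrow> c \<in> bdry W"
  unfolding bdry_comps_subfat by simp

lemma in_bdryE:
  assumes "c \<in> bdry W"
  obtains x where "x \<in> halfs F" "c = comp_of W x" | "c \<in> isolated"
  using assms unfolding bdry_comps_subfat by blast

text \<open>The component contains \<open>h\<close>, whereas components of \<open>W'\<close> contain
  only half-edges present there.\<close>

lemma comp_notin_bdry:
  assumes "h \<in> halfs_in W" "h \<notin> halfs_in W'"
  shows "comp_of W h \<notin> bdry W'"
proof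
  assume "comp_of W h \<in> bdry W'"
  then have "Inl (orbit (bdry_perm W) h \<inter> halfs_in W) \<in> bdry W'"
    using comp_of_Inl[OF assms(1) self_in_orbit] by simp
  then have "h \<in> halfs_in W'"
    by (rule Inl_in_bdry(1)) (use assms self_in_orbit in simp)
  with assms show False by simp
qed

text \<open>With the edge, \<open>h\<close> goes to \<open>nxt F (opp F h)\<close> and
  \<open>opp F h\<close> to \<open>nxt F h\<close>; without it the two values are exchanged. All
  other half-edges keep their image.\<close>

lemma transposed:
  assumes h: "h \<in> halfs F" and e: "edge_of F h \<in> W"
  shows "transposed_perm (bdry_perm W) (bdry_perm (W - {edge_of F h})) h (opp F h)"
proof
  show "permutation (bdry_perm W)" by (rule permutation_bdry_perm)
  show "h \<noteq> opp F h" using opp_neq[OF h] by simp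
  show "bdry_perm (W - {edge_of F h}) = bdry_perm W \<circ> transpose h (opp F h)"
  proof
    fix x
    consider "x = h" | "x = opp F h" | "x \<noteq> h" "x \<noteq> opp F h" by blast
    then show "bdry_perm (W - {edge_of F h}) x = (bdry_perm W \<circ> transpose h (opp F h)) x"
    proof cases
      case 1
      then show ?thesis using h e opp_in[OF h] edge_of_opp[OF h] opp_opp[OF h]
        by (simp add: bdry_perm_def)
    next
      case 2
      then show ?thesis using h e opp_in[OF h] edge_of_opp[OF h] opp_opp[OF h]
        by (simp add: bdry_perm_def)
    next
      case 3
      then have "edge_of F x \<noteq> edge_of F h" if "x \<in> halfs F"
        using edge_of_eq_iff[OF that h] by simp
      then show ?thesis using 3 by (auto simp: bdry_perm_def transpose_def)
    qed
  qed
qed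

section \<open>Effect of removing one edge on the boundary components\<close>

context
  fixes W h e W'
  assumes h: "h \<in> halfs F" and eW: "e \<in> W" and e: "e = edge_of F h" and W': "W' = W - {e}"
begin

interpretation transposed_perm "bdry_perm W" "bdry_perm W'" h "opp F h"
  unfolding W' e by (rule transposed) (use h eW e in auto)

lemma halfs_in_remove: "halfs_in W' = halfs_in W - {h, opp F h}"
  using edge_of_eq_iff[OF _ h] e by (auto simp: halfs_in_def W')

lemma ends_in: "h \<in> halfs_in W" "opp F h \<in> halfs_in W"
  using h eW e opp_in edge_of_opp by (auto simp: halfs_in_def)

lemma comp_of_remove:
  assumes x: "x \<in> halfs F" "h \<notin> orbit (bdry_perm W) x" "opp F h \<notin> orbit (bdry_perm W) x"
  shows "orbit (bdry_perm W') x = orbit (bdry_perm W) x" "comp_of W' x = comp_of W x"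
proof -
  show o: "orbit (bdry_perm W') x = orbit (bdry_perm W) x" by (rule orbit_avoiding[OF x(2,3)])
  have "orbit (bdry_perm W) x \<inter> halfs_in W' = orbit (bdry_perm W) x \<inter> halfs_in W"
    using x unfolding halfs_in_remove by blast
  then show "comp_of W' x = comp_of W x" by (simp add: comp_of_def o)
qed

lemma orbit_remove_subset:
  "orbit (bdry_perm W') h \<subseteq> orbit (bdry_perm W) h \<union> orbit (bdry_perm W) (opp F h)"
  "orbit (bdry_perm W') (opp F h) \<subseteq> orbit (bdry_perm W) h \<union> orbit (bdry_perm W) (opp F h)"
  using orbit_g_subset transposed_perm.orbit_g_subset[OF swap_points] by blast+

text \<open>An orbit that avoids both ends of the edge names the same component before and after.
  The components at the ends contain half-edges that disappear, so they cannot survive.\<close>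

lemma bdry_diff: "bdry W - bdry W' = {comp_of W h, comp_of W (opp F h)}"
proof
  show "bdry W - bdry W' \<subseteq> {comp_of W h, comp_of W (opp F h)}"
  proof
    fix c assume c: "c \<in> bdry W - bdry W'"
    then obtain x where x: "x \<in> halfs F" "c = comp_of W x"
      using isolated_in_bdry in_bdryE[of c W] by blast
    have "comp_of W' x \<noteq> comp_of W x" using comp_in_bdry[OF x(1), of W'] c x(2) by auto
    then have "h \<in> orbit (bdry_perm W) x \<or> opp F h \<in> orbit (bdry_perm W) x"
      using comp_of_remove(2)[OF x(1)] by blast
    then show "c \<in> {comp_of W h, comp_of W (opp F h)}"
      using comp_of_eq_iff[OF x(1) h, of W] comp_of_eq_iff[OF x(1) opp_in[OF h], of W] x(2) by blast
  qed
  have "comp_of W h \<notin> bdry W'" "comp_of W (opp F h) \<notin> bdry W'"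
    using comp_notin_bdry[of _ W W'] ends_in halfs_in_remove by auto
  then show "{comp_of W h, comp_of W (opp F h)} \<subseteq> bdry W - bdry W'"
    using comp_in_bdry h opp_in[OF h] by auto
qed

text \<open>If the new orbit has no present half-edge, it names a vertex which in \<open>W\<close>
  still carries \<open>z\<close>, hence is not a component there. Otherwise it shares a half-edge
  \<open>y\<close> with the old orbit of an end \<open>w\<close>; were its trace a component of
  \<open>W\<close>, it would be the one through \<open>y\<close>, which contains the removed
  half-edge \<open>w\<close>.\<close>

lemma comp_of_remove_new:
  assumes z: "z \<in> {h, opp F h}"
  shows "comp_of W' z \<notin> bdry W"
proof
  assume in_W: "comp_of W' z \<in> bdry W"
  have zh: "z \<in> halfs F" and zW: "z \<in> halfs_in W"
    using z h opp_in[OF h] ends_in by auto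
  show False
  proof (cases "orbit (bdry_perm W') z \<inter> halfs_in W' = {}")
    case True
    then have "Inr (vert_of F z) \<in> bdry W" using in_W by (simp add: comp_of_def)
    then obtain x where x: "x \<in> halfs F" "comp_of W x = Inr (vert_of F z)"
      by (rule in_bdryE) (use zh in \<open>auto simp: isolated_def halfs_at_def\<close>)
    then have "orbit (bdry_perm W) x \<inter> halfs_in W = {}" "vert_of F x = vert_of F z"
      by (auto simp: comp_of_def split: if_splits)
    with orbit_without_halfs[OF x(1)] zW zh show False by (auto simp: halfs_at_def)
  next
    case False
    then obtain y where y: "y \<in> orbit (bdry_perm W') z" "y \<in> halfs_in W'" by blast
    have yh: "y \<in> halfs F" using y by (simp add: halfs_in_def)
    have S: "comp_of W' z = Inl (orbit (bdry_perm W') z \<inter> halfs_in W')" (is "_ = Inl ?S")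
      by (rule comp_of_Inl[OF y(2,1)])
    have "y \<in> ?S" using y by simp
    with in_W S have cy: "comp_of W y = Inl ?S" using Inl_in_bdry(2)[of ?S W y] by simp
    have "y \<in> orbit (bdry_perm W) h \<union> orbit (bdry_perm W) (opp F h)"
      using y(1) z orbit_remove_subset by blast
    then have "\<exists>w\<in>{h, opp F h}. y \<in> orbit (bdry_perm W) w" by blast
    then obtain w where w: "w \<in> {h, opp F h}" "y \<in> orbit (bdry_perm W) w" by blast
    have wh: "w \<in> halfs F" "w \<in> halfs_in W" using w(1) h opp_in[OF h] ends_in by auto
    have "comp_of W y = comp_of W w" using comp_of_eq_iff[OF wh(1) yh, of W] w(2) by simp
    also have "\<dots> = Inl (orbit (bdry_perm W) w \<inter> halfs_in W)"
      by (rule comp_of_Inl[OF wh(2) self_in_orbit])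
    finally have "w \<in> ?S" using cy wh(2) self_in_orbit[of w W] by auto
    then show False using w(1) unfolding halfs_in_remove by blast
  qed
qed

text \<open>Orbits can also be compared from \<open>W'\<close> back to \<open>W\<close>, as
  multiplying by the same transposition undoes the removal.\<close>

lemma bdry_diff': "bdry W' - bdry W = {comp_of W' h, comp_of W' (opp F h)}"
proof
  show "bdry W' - bdry W \<subseteq> {comp_of W' h, comp_of W' (opp F h)}"
  proof
    fix c assume c: "c \<in> bdry W' - bdry W"
    then obtain x where x: "x \<in> halfs F" "c = comp_of W' x"
      using isolated_in_bdry in_bdryE[of c W'] by blast
    have "h \<in> orbit (bdry_perm W') x \<or> opp F h \<in> orbit (bdry_perm W') x"
    proof (rule ccontr)
      assume *: "\<not> ?thesis"
      then have "orbit (bdry_perm W) x = orbit (bdry_perm W') x"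
        using transposed_perm.orbit_avoiding[OF swap_roles, of x] by simp
      then have "comp_of W' x = comp_of W x" using comp_of_remove(2)[OF x(1)] * by simp
      then show False using c x comp_in_bdry[OF x(1), of W] by simp
    qed
    then show "c \<in> {comp_of W' h, comp_of W' (opp F h)}"
      using comp_of_eq_iff[OF x(1) h, of W'] comp_of_eq_iff[OF x(1) opp_in[OF h], of W'] x(2)
      by blast
  qed
  show "{comp_of W' h, comp_of W' (opp F h)} \<subseteq> bdry W' - bdry W"
    using comp_of_remove_new comp_in_bdry h opp_in[OF h] by auto
qed

lemma merge_iff: "comp_of W' h = comp_of W' (opp F h) \<longleftrightarrow> comp_of W h \<noteq> comp_of W (opp F h)"
  using comp_of_eq_iff[OF h opp_in[OF h]] same_orbit_iff by simp

text \<open>The lost and the gained components are both named by the two ends of the edge, and by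
  \<open>merge_iff\<close> the ends name distinct components on exactly one of the two
  sides.\<close>

lemma card_bdry_diff:
  "card (bdry W - bdry W') = 2 \<and> card (bdry W' - bdry W) = 1
   \<or> card (bdry W - bdry W') = 1 \<and> card (bdry W' - bdry W) = 2"
  unfolding bdry_diff bdry_diff' using merge_iff by (auto simp: card_insert_if)

end

end


section \<open>Removal of edges\<close>

context fatgraph_loc
begin

lemma edgesE:
  assumes "e \<in> edges F"
  obtains h where "h \<in> halfs F" "e = edge_of F h"
  using assms by (auto simp: edges_def)

lemma finite_edges: "finite (edges F)"
  using finite_halfs by (simp add: edges_def)

lemma num_edges_subfat: "W \<subseteq> edges F \<Longrightarrow> num_edges (subfat F W) = card W"
proof -
  assume "W \<subseteq> edges F"
  then have "edges (subfat F W) = W"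
    by (auto simp: edges_def subfat_def edge_of_def)
  then show ?thesis by (simp add: num_edges_def)
qed

lemma halfs_in_remove_edge:
  "halfs_in (W - {e}) = {x \<in> halfs_in W. edge_of F x \<noteq> e}"
  by (auto simp: halfs_in_def)

subsection \<open>Genus\<close>

lemma adj_subfat: "adj (subfat F W) = (\<lambda>x. (vert_of F x, vert_of F (opp F x))) ` halfs_in W"
  by (auto simp: adj_def subfat_def halfs_in_def)

lemma sym_adj: "sym (adj (subfat F W))"
proof (rule symI)
  fix u v assume "(u, v) \<in> adj (subfat F W)"
  then obtain x where x: "x \<in> halfs_in W" "u = vert_of F x" "v = vert_of F (opp F x)"
    unfolding adj_subfat by blast
  then have "x \<in> halfs F" by (simp add: halfs_in_def)
  then have "opp F x \<in> halfs_in W" "u = vert_of F (opp F (opp F x))"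
    using x opp_in edge_of_opp opp_opp by (auto simp: halfs_in_def)
  then show "(v, u) \<in> adj (subfat F W)" unfolding adj_subfat using x(3) by blast
qed

text \<open>
  Hence the ends of a removed edge stay connected when its removal merges two boundary components.
\<close>

lemma orbit_connected:
  assumes x: "x \<in> halfs F" and y: "y \<in> orbit (bdry_perm W) x"
  shows "(vert_of F x, vert_of F y) \<in> (adj (subfat F W))\<^sup>*"
proof -
  have step: "(vert_of F z, vert_of F (bdry_perm W z)) \<in> (adj (subfat F W))\<^sup>*" if z: "z \<in> halfs F" for z
  proof (cases "edge_of F z \<in> W")
    case True
    then have "bdry_perm W z = nxt F (opp F z)" and "z \<in> halfs_in W"
      using z by (simp_all add: bdry_perm_def halfs_in_def)
    then show ?thesis unfolding adj_subfat using vert_nxt[OF opp_in[OF z]] by auto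
  next
    case False
    then show ?thesis using z vert_nxt[OF z] by (simp add: bdry_perm_def)
  qed
  from y show ?thesis
  proof induction
    case base
    then show ?case by (rule step[OF x])
  next
    case (step y)
    then have "y \<in> halfs F" using orbit_in_halfs[OF x] by blast
    with step.IH show ?case using \<open>\<And>z. z \<in> halfs F \<Longrightarrow> _\<close> by (meson rtrancl_trans)
  qed
qed

text \<open>
  As the expression \<open>2 k - v + e - p\<close> is unchanged or drops by \<open>2\<close>, this also holds for the truncated
  values of \<open>genus\<close>, without knowing that the expression is even and nonnegative.
\<close>

lemma genus_remove:
  assumes W: "W \<subseteq> edges F" and e: "e \<in> W"
  shows "genus (subfat F (W - {e})) = genus (subfat F W)
    \<or> genus (subfat F (W - {e})) = genus (subfat F W) - 1"
proof -
  define W' where "W' = W - {e}"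
  obtain h where h: "h \<in> halfs F" and eh: "e = edge_of F h"
    using W e by (auto elim: edgesE)
  note cd = card_bdry_diff[OF h e eh W'_def]
  let ?R = "adj (subfat F W')" and ?u = "vert_of F h" and ?v = "vert_of F (opp F h)"
  have hin: "halfs_in W = halfs_in W' \<union> {h, opp F h}"
    using ends_in[OF h e eh W'_def] halfs_in_remove[OF h e eh W'_def] by blast
  have R': "adj (subfat F W) = ?R \<union> {(?u, ?v), (?v, ?u)}"
    unfolding adj_subfat hin using opp_opp[OF h] by auto
  have Rsub: "?R \<subseteq> verts F \<times> verts F"
    unfolding adj_subfat by (auto simp: halfs_in_def vert_in opp_in)
  have vs: "verts (subfat F W) = verts F" for W by (simp add: subfat_def)
  note q = quotient_card_add_edge[OF finite_verts Rsub sym_adj vert_in[OF h] vert_in[OF opp_in[OF h]],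
      folded R']
  let ?k = "int (num_comps (subfat F W))" and ?k' = "int (num_comps (subfat F W'))"
  have k: "?k' = ?k \<or> ?k' = ?k + 1"
    using q(2) by (auto simp: num_comps_def vs)
  have W'sub: "W' \<subseteq> edges F" using W by (auto simp: W'_def)
  have "finite W" using W finite_edges finite_subset by blast
  then have "card W = Suc (card W')" using e by (metis W'_def card_Suc_Diff1)
  then have ed: "int (num_edges (subfat F W)) = int (num_edges (subfat F W')) + 1"
    using num_edges_subfat[OF W] num_edges_subfat[OF W'sub] by simp
  have b1: "num_bdry (subfat F W) = card (bdry W \<inter> bdry W') + card (bdry W - bdry W')"
    unfolding num_bdry_def by (metis card_Int_Diff finite_bdry)
  have b2: "num_bdry (subfat F W') = card (bdry W \<inter> bdry W') + card (bdry W' - bdry W)"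
    unfolding num_bdry_def by (metis card_Int_Diff finite_bdry Int_commute)
  \<comment> \<open>After a merge both ends lie on one boundary orbit of the smaller state, so its
    remaining edges connect them.\<close>
  have merge: "?k' = ?k" if m: "card (bdry W - bdry W') = 2"
  proof -
    have "comp_of W h \<noteq> comp_of W (opp F h)"
      using m unfolding bdry_diff[OF h e eh W'_def] by auto
    then have "comp_of W' h = comp_of W' (opp F h)" using merge_iff[OF h e eh W'_def] by blast
    then have "opp F h \<in> orbit (bdry_perm W') h" using comp_of_eq_iff[OF h opp_in[OF h]] by blast
    then have "(?u, ?v) \<in> ?R\<^sup>*" by (rule orbit_connected[OF h])
    then show ?thesis using q(1) by (simp add: num_comps_def vs)
  qed
  define X X' where "X = 2 * ?k - int (num_verts (subfat F W)) + int (num_edges (subfat F W))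
      - int (num_bdry (subfat F W))"
    and "X' = 2 * ?k' - int (num_verts (subfat F W')) + int (num_edges (subfat F W'))
      - int (num_bdry (subfat F W'))"
  have nv: "num_verts (subfat F W) = num_verts (subfat F W')" by (simp add: num_verts_def vs)
  \<comment> \<open>A merge lowers \<open>e\<close> and \<open>p\<close> by one and fixes
    \<open>k\<close>, so the expression stays. A split lowers \<open>e\<close> and raises
    \<open>p\<close>, a change of -2, which is compensated exactly when the removal disconnects and
    \<open>k\<close> grows by one.\<close>
  from cd have "X' = X \<or> X' = X - 2"
  proof
    assume m: "card (bdry W - bdry W') = 2 \<and> card (bdry W' - bdry W) = 1"
    then show ?thesis using merge b1 b2 ed nv unfolding X_def X'_def by simp
  next
    assume "card (bdry W - bdry W') = 1 \<and> card (bdry W' - bdry W) = 2"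
    then show ?thesis using k b1 b2 ed nv unfolding X_def X'_def by auto
  qed
  then have "nat (X' div 2) = nat (X div 2) \<or> nat (X' div 2) = nat (X div 2) - 1"
    by (elim disjE) (simp_all, linarith)
  then show ?thesis unfolding genus_def X_def X'_def W'_def by simp
qed

subsection \<open>Removal of two edges\<close>

text \<open>A component lost with \<open>e\<close> contains a half of \<open>e\<close>, so no state
  without \<open>e\<close> has it again. This excludes components that vanish in between and
  reappear.\<close>

lemma bdry_two_edges_subset:
  assumes W: "W \<subseteq> edges F" and e: "e \<in> W" and f: "f \<in> W" "f \<noteq> e"
  shows "bdry W \<inter> bdry (W - {e} - {f}) \<subseteq> bdry (W - {e})"
proof
  fix c assume c: "c \<in> bdry W \<inter> bdry (W - {e} - {f})"
  obtain h where h: "h \<in> halfs F" and eh: "e = edge_of F h"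
    using W e by (auto elim: edgesE)
  show "c \<in> bdry (W - {e})"
  proof (rule ccontr)
    assume "c \<notin> bdry (W - {e})"
    then have "c \<in> {comp_of W h, comp_of W (opp F h)}"
      using c bdry_diff[OF h e eh refl] by blast
    moreover have "comp_of W z \<notin> bdry (W - {e} - {f})" if z: "z \<in> {h, opp F h}" for z
    proof (rule comp_notin_bdry)
      show "z \<in> halfs_in W" using z ends_in[OF h e eh refl] by blast
      show "z \<notin> halfs_in (W - {e} - {f})"
        using z eh edge_of_opp[OF h] by (auto simp: halfs_in_remove_edge)
    qed
    ultimately show False using c by blast
  qed
qed

text \<open>Orbits stand for boundary components, so linked edges have a common adjacent component.\<close>

definition linked :: "'h set set \<Rightarrow> 'h set \<Rightarrow> 'h set \<Rightarrow> bool" where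
  "linked W e f \<longleftrightarrow> (\<exists>x\<in>e. \<exists>y\<in>f. y \<in> orbit (bdry_perm W) x)"

lemma linked_sym: "linked W e f \<longleftrightarrow> linked W f e"
  unfolding linked_def using orbit_eq self_in_orbit by blast

lemma edge_half:
  assumes "W \<subseteq> edges F" "e \<in> W" "x \<in> e"
  shows "x \<in> halfs F" "e = edge_of F x" "x \<in> halfs_in W"
proof -
  obtain h where h: "h \<in> halfs F" and eh: "e = edge_of F h"
    using assms by (auto elim: edgesE)
  then have "x = h \<or> x = opp F h" using assms(3) by (auto simp: edge_of_def)
  then show "x \<in> halfs F" "e = edge_of F x"
    using h eh opp_in edge_of_opp by auto
  then show "x \<in> halfs_in W" using assms by (simp add: halfs_in_def)
qed

text \<open>The component of \<open>k\<close> after the removal of \<open>e\<close> is a witness. It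
  is new because in \<open>W\<close> the component of \<open>k\<close> also contains the removed
  \<open>h\<close>, and it is destroyed with \<open>f\<close> because it contains
  \<open>k\<close>.\<close>

lemma linked_new_comp:
  assumes W: "W \<subseteq> edges F" and e: "e \<in> W" and f: "f \<in> W" "f \<noteq> e" and l: "linked W e f"
  shows "bdry (W - {e}) - bdry W - bdry (W - {e} - {f}) \<noteq> {}"
proof -
  from l obtain h k where h: "h \<in> e" and k: "k \<in> f" and kh: "k \<in> orbit (bdry_perm W) h"
    by (auto simp: linked_def)
  note h' = edge_half[OF W e h] and k' = edge_half[OF W f(1) k]
  have kWe: "k \<in> halfs_in (W - {e})" using k' f by (auto simp: halfs_in_def)
  have c: "comp_of (W - {e}) k = Inl (orbit (bdry_perm (W - {e})) k \<inter> halfs_in (W - {e}))" (is "_ = Inl ?S")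
    by (rule comp_of_Inl[OF kWe self_in_orbit])
  have kS: "k \<in> ?S" using kWe self_in_orbit by simp
  have "comp_of (W - {e}) k \<notin> bdry (W - {e} - {f})"
    by (rule comp_notin_bdry[OF kWe]) (use k' in \<open>simp add: halfs_in_def\<close>)
  moreover have "comp_of (W - {e}) k \<notin> bdry W"
  proof
    assume "comp_of (W - {e}) k \<in> bdry W"
    then have "comp_of W k = Inl ?S" using Inl_in_bdry(2)[of ?S W k] kS c by simp
    moreover have "h \<in> orbit (bdry_perm W) k" using orbit_eq[OF kh] self_in_orbit by simp
    ultimately have "h \<in> ?S" using comp_of_Inl[OF k'(3) self_in_orbit] h'(3) by auto
    then show False using h' by (simp add: halfs_in_def)
  qed
  ultimately show ?thesis using comp_in_bdry[OF k'(1)] by blast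
qed

lemma bdry_diff_edge:
  assumes "V \<subseteq> edges F" "g \<in> V"
  shows "bdry V - bdry (V - {g}) = comp_of V ` g"
    and "bdry (V - {g}) - bdry V = comp_of (V - {g}) ` g"
proof -
  obtain h where h: "h \<in> halfs F" and eh: "g = edge_of F h"
    using assms by (auto elim: edgesE)
  have "comp_of X ` g = {comp_of X h, comp_of X (opp F h)}" for X
    unfolding eh edge_of_def by simp
  then show "bdry V - bdry (V - {g}) = comp_of V ` g"
    "bdry (V - {g}) - bdry V = comp_of (V - {g}) ` g"
    using bdry_diff[OF h assms(2) eh refl] bdry_diff'[OF h assms(2) eh refl] by simp_all
qed

lemma comp_of_remove_edge:
  assumes V: "V \<subseteq> edges F" "g \<in> V" and x: "x \<in> halfs F" "orbit (bdry_perm V) x \<inter> g = {}"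
  shows "orbit (bdry_perm (V - {g})) x = orbit (bdry_perm V) x" "comp_of (V - {g}) x = comp_of V x"
proof -
  obtain h where h: "h \<in> halfs F" and eh: "g = edge_of F h"
    using V by (auto elim: edgesE)
  then have n: "h \<notin> orbit (bdry_perm V) x" "opp F h \<notin> orbit (bdry_perm V) x"
    using x(2) by (auto simp: edge_of_def)
  show "orbit (bdry_perm (V - {g})) x = orbit (bdry_perm V) x" "comp_of (V - {g}) x = comp_of V x"
    by (rule comp_of_remove[OF h V(2) eh refl x(1) n])+
qed

section \<open>Two edges without a common adjacent component\<close>

context
  fixes W e f
  assumes W: "W \<subseteq> edges F" and e: "e \<in> W" and f: "f \<in> W" and ef: "f \<noteq> e"
    and unlinked: "\<not> linked W e f"
begin

lemma unlinked_notin: "\<lbrakk>x \<in> e; y \<in> f\<rbrakk> \<Longrightarrow> y \<notin> orbit (bdry_perm W) x"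
  using unlinked by (auto simp: linked_def)

text \<open>Removing \<open>e\<close> only recombines the orbits through its own ends, none of which
  meets \<open>f\<close>.\<close>

lemma orbit_after_e:
  assumes x: "x \<in> e"
  shows "orbit (bdry_perm (W - {e})) x \<inter> f = {}"
proof -
  obtain h where h: "h \<in> halfs F" and eh: "e = edge_of F h"
    using W e by (auto elim: edgesE)
  then have "e = {h, opp F h}" by (simp add: edge_of_def)
  then have "orbit (bdry_perm (W - {e})) x \<subseteq> orbit (bdry_perm W) h \<union> orbit (bdry_perm W) (opp F h)"
    using orbit_remove_subset[OF h e eh refl] x by blast
  moreover have "h \<in> e" "opp F h \<in> e" by (simp_all add: eh edge_of_def)
  ultimately show ?thesis using unlinked_notin by blast
qed

lemma comp_after_e:
  assumes x: "x \<in> e"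
  shows "comp_of (W - {e} - {f}) x = comp_of (W - {e}) x"
    "orbit (bdry_perm (W - {e} - {f})) x = orbit (bdry_perm (W - {e})) x"
proof -
  have V: "W - {e} \<subseteq> edges F" "f \<in> W - {e}" using W f ef by auto
  show "comp_of (W - {e} - {f}) x = comp_of (W - {e}) x"
    "orbit (bdry_perm (W - {e} - {f})) x = orbit (bdry_perm (W - {e})) x"
    using comp_of_remove_edge[OF V edge_half(1)[OF W e x] orbit_after_e[OF x]] by simp_all
qed

end

text \<open>Each removal acts on orbits that the other does not touch. Hence components created by
  one survive the other, and the losses and gains of the two removals simply add up.\<close>

lemma unlinked_diff:
  assumes W: "W \<subseteq> edges F" and e: "e \<in> W" and f: "f \<in> W" and ef: "f \<noteq> e"
    and unlinked: "\<not> linked W e f"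
  shows "bdry W - bdry (W - {e} - {f}) = (bdry W - bdry (W - {e})) \<union> (bdry W - bdry (W - {f}))"
    and "(bdry W - bdry (W - {e})) \<inter> (bdry W - bdry (W - {f})) = {}"
    and "bdry (W - {e} - {f}) - bdry W = (bdry (W - {e}) - bdry W) \<union> (bdry (W - {f}) - bdry W)"
    and "(bdry (W - {e}) - bdry W) \<inter> (bdry (W - {f}) - bdry W) = {}"
proof -
  have unlinked': "\<not> linked W f e" using unlinked linked_sym by blast
  have fe: "e \<noteq> f" using ef by simp
  have comm: "W - {f} - {e} = W - {e} - {f}" by blast
  note de = bdry_diff_edge[OF W e] and df = bdry_diff_edge[OF W f]
  note ce = comp_after_e[OF W e f ef unlinked]
  note cf = comp_after_e[OF W f e fe unlinked', unfolded comm]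
  have c1: "bdry W \<inter> bdry (W - {e} - {f}) \<subseteq> bdry (W - {e})"
    by (rule bdry_two_edges_subset[OF W e f ef])
  have c2: "bdry W \<inter> bdry (W - {e} - {f}) \<subseteq> bdry (W - {f})"
    using bdry_two_edges_subset[OF W f e fe] unfolding comm .
  have nW: "x \<in> halfs F \<Longrightarrow> comp_of W x \<notin> bdry (W - {g}) \<or> orbit (bdry_perm W) x \<inter> g = {}"
    if g: "g \<in> W" for g x
  proof (rule disjCI)
    assume x: "x \<in> halfs F" and "orbit (bdry_perm W) x \<inter> g \<noteq> {}"
    then obtain y where y: "y \<in> g" "y \<in> orbit (bdry_perm W) x" by blast
    then have "comp_of W x = comp_of W y"
      using comp_of_eq_iff[OF x edge_half(1)[OF W g y(1)], of W] by simp
    then have "comp_of W x \<in> bdry W - bdry (W - {g})"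
      unfolding bdry_diff_edge(1)[OF W g] using y(1) by blast
    then show "comp_of W x \<notin> bdry (W - {g})" by blast
  qed
  \<comment> \<open>A component that survives each single removal has an orbit meeting neither edge,
    so it also survives both in succession.\<close>
  have keep: "c \<in> bdry (W - {e} - {f})" if c: "c \<in> bdry W" "c \<in> bdry (W - {e})" "c \<in> bdry (W - {f})" for c
    using c(1)
  proof (cases rule: in_bdryE)
    case (1 x)
    have oe: "orbit (bdry_perm W) x \<inter> e = {}" and of': "orbit (bdry_perm W) x \<inter> f = {}"
      using nW[OF e 1(1)] nW[OF f 1(1)] c 1(2) by auto
    note r = comp_of_remove_edge[OF W e 1(1) oe]
    have V: "W - {e} \<subseteq> edges F" "f \<in> W - {e}" using W f ef by auto
    have "comp_of (W - {e} - {f}) x = comp_of (W - {e}) x"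
      by (rule comp_of_remove_edge(2)[OF V 1(1)]) (use r(1) of' in simp)
    then have "comp_of (W - {e} - {f}) x = c" using r(2) 1(2) by simp
    then show ?thesis using comp_in_bdry[OF 1(1), of "W - {e} - {f}"] by simp
  next
    case 2
    then show ?thesis by (rule isolated_in_bdry)
  qed
  show "bdry W - bdry (W - {e} - {f}) = (bdry W - bdry (W - {e})) \<union> (bdry W - bdry (W - {f}))"
    using c1 c2 keep by blast
  show "(bdry W - bdry (W - {e})) \<inter> (bdry W - bdry (W - {f})) = {}"
  proof (rule equals0I)
    fix c assume "c \<in> (bdry W - bdry (W - {e})) \<inter> (bdry W - bdry (W - {f}))"
    then have "c \<in> comp_of W ` e" "c \<in> comp_of W ` f" unfolding de(1) df(1) by simp_all
    then obtain x y where xy: "x \<in> e" "y \<in> f" "comp_of W x = comp_of W y" by auto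
    then have "y \<in> orbit (bdry_perm W) x"
      using comp_of_eq_iff[OF edge_half(1)[OF W e xy(1)] edge_half(1)[OF W f xy(2)]] by simp
    then show False using unlinked_notin[OF W e f ef unlinked xy(1,2)] by simp
  qed
  have inef: "c \<in> bdry (W - {e} - {f})"
    if "c \<in> comp_of (W - {e}) ` e \<or> c \<in> comp_of (W - {f}) ` f" for c
    using that
  proof
    assume "c \<in> comp_of (W - {e}) ` e"
    then obtain x where x: "x \<in> e" "c = comp_of (W - {e} - {f}) x" using ce(1) by auto
    then show ?thesis using comp_in_bdry[OF edge_half(1)[OF W e x(1)]] by simp
  next
    assume "c \<in> comp_of (W - {f}) ` f"
    then obtain x where x: "x \<in> f" "c = comp_of (W - {e} - {f}) x" using cf(1) by auto
    then show ?thesis using comp_in_bdry[OF edge_half(1)[OF W f x(1)]] by simp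
  qed
  have Vf: "W - {f} \<subseteq> edges F" "e \<in> W - {f}" using W e ef by auto
  \<comment> \<open>What removing \<open>e\<close> creates after \<open>f\<close> is gone lies at an
    end of \<open>e\<close>, and there the absence of \<open>f\<close> makes no difference.\<close>
  have new: "c \<in> comp_of (W - {e}) ` e"
    if c: "c \<in> bdry (W - {e} - {f})" "c \<notin> bdry (W - {f})" for c
  proof -
    have "c \<in> bdry (W - {f} - {e}) - bdry (W - {f})" using c unfolding comm by simp
    then have "c \<in> comp_of (W - {f} - {e}) ` e" unfolding bdry_diff_edge(2)[OF Vf] .
    then obtain x where x: "x \<in> e" "c = comp_of (W - {e} - {f}) x" unfolding comm by blast
    then show ?thesis using ce(1)[OF x(1)] by simp
  qed
  show "bdry (W - {e} - {f}) - bdry W = (bdry (W - {e}) - bdry W) \<union> (bdry (W - {f}) - bdry W)"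
  proof
    show "bdry (W - {e} - {f}) - bdry W \<subseteq> (bdry (W - {e}) - bdry W) \<union> (bdry (W - {f}) - bdry W)"
      using new unfolding de(2) by blast
    show "(bdry (W - {e}) - bdry W) \<union> (bdry (W - {f}) - bdry W) \<subseteq> bdry (W - {e} - {f}) - bdry W"
      using inef de(2) df(2) by blast
  qed
  show "(bdry (W - {e}) - bdry W) \<inter> (bdry (W - {f}) - bdry W) = {}"
  proof (rule equals0I)
    fix c assume "c \<in> (bdry (W - {e}) - bdry W) \<inter> (bdry (W - {f}) - bdry W)"
    then have "c \<in> comp_of (W - {e}) ` e" "c \<in> comp_of (W - {f}) ` f" unfolding de(2) df(2) by simp_all
    then obtain x y where xy: "x \<in> e" "y \<in> f" "comp_of (W - {e}) x = comp_of (W - {f}) y" by auto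
    \<comment> \<open>A common new component would put \<open>x\<close> and \<open>y\<close> on one
      orbit after both removals. But the orbit of \<open>x\<close> is already final once
      \<open>e\<close> is gone, and it misses \<open>f\<close>.\<close>
    then have "comp_of (W - {e} - {f}) x = comp_of (W - {e} - {f}) y" using ce(1) cf(1) by simp
    then have "y \<in> orbit (bdry_perm (W - {e} - {f})) x"
      using comp_of_eq_iff[OF edge_half(1)[OF W e xy(1)] edge_half(1)[OF W f xy(2)]] by simp
    then show False using ce(2)[OF xy(1)] orbit_after_e[OF W e f ef unlinked xy(1)] xy(2) by blast
  qed
qed

lemma card_bdry_step:
  assumes "W \<subseteq> edges F" "e \<in> W"
  shows "card (bdry W - bdry (W - {e})) = 2 \<and> card (bdry (W - {e}) - bdry W) = 1
   \<or> card (bdry W - bdry (W - {e})) = 1 \<and> card (bdry (W - {e}) - bdry W) = 2"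
proof -
  obtain h where h: "h \<in> halfs F" and eh: "e = edge_of F h"
    using assms by (auto elim: edgesE)
  show ?thesis by (rule card_bdry_diff[OF h assms(2) eh refl])
qed

end


section \<open>The maps on boundary factors\<close>

lemma finite_tensors: "finite I \<Longrightarrow> finite (tensors I)"
proof -
  have "(UNIV :: sign set) = {Plus, Minus}" using sign.exhaust by auto
  then have "finite (UNIV :: sign set)" by (metis finite.emptyI finite.insertI)
  then show "finite I \<Longrightarrow> finite (tensors I)" unfolding tensors_def by (intro finite_PiE) auto
qed

lemma tensors_arb: "\<lbrakk>b \<in> tensors I; i \<notin> I\<rbrakk> \<Longrightarrow> b i = undefined"
  unfolding tensors_def by (rule PiE_arb)

lemma tensors_eqI: "\<lbrakk>b \<in> tensors I; b' \<in> tensors I; \<And>i. i \<in> I \<Longrightarrow> b i = b' i\<rbrakk> \<Longrightarrow> b = b'"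
  unfolding tensors_def by (rule PiE_ext)

lemma restrict_in_tensors: "restrict t I \<in> tensors I"
  by (simp add: tensors_def)

definition agree_on :: "'i set \<Rightarrow> ('i \<Rightarrow> sign) \<Rightarrow> ('i \<Rightarrow> sign) \<Rightarrow> bool" where
  "agree_on A b b' \<longleftrightarrow> (\<forall>i\<in>A. b' i = b i)"

definition bdry_targets :: "'i set \<Rightarrow> 'i set \<Rightarrow> ('i \<Rightarrow> sign) \<Rightarrow> ('i \<Rightarrow> sign) set" where
  "bdry_targets P P' b =
     {b' \<in> tensors P'. agree_on (P \<inter> P') b b' \<and> tdeg P' b' = tdeg P b - 1}"

definition bdry_step :: "'i set \<Rightarrow> 'i set \<Rightarrow> bool" where
  "bdry_step P P' \<longleftrightarrow> card (P - P') = 2 \<and> card (P' - P) = 1 \<or> card (P - P') = 1 \<and> card (P' - P) = 2"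

lemma finite_bdry_targets: "finite P' \<Longrightarrow> finite (bdry_targets P P' b)"
  using finite_tensors[of P'] by (simp add: bdry_targets_def)

lemma tdeg_split: "finite P \<Longrightarrow> tdeg P b = tdeg (P \<inter> Q) b + tdeg (P - Q) b"
  unfolding tdeg_def by (rule sum.Int_Diff)

lemma tdeg_cong: "(\<And>i. i \<in> P \<Longrightarrow> b i = b' i) \<Longrightarrow> tdeg P b = tdeg P b'"
  unfolding tdeg_def by (intro sum.cong) auto

lemma tdeg_agree: "agree_on A b b' \<Longrightarrow> tdeg A b' = tdeg A b"
  by (rule tdeg_cong) (simp add: agree_on_def)

lemma tdeg_Un: "\<lbrakk>finite A; finite B; A \<inter> B = {}\<rbrakk> \<Longrightarrow> tdeg (A \<union> B) b = tdeg A b + tdeg B b"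
  unfolding tdeg_def by (rule sum.union_disjoint)

lemma ordered_pair_of:
  assumes "card A = 2"
  shows "fst (ordered_pair_of A) \<noteq> snd (ordered_pair_of A)"
    and "A = {fst (ordered_pair_of A), snd (ordered_pair_of A)}"
proof -
  have "\<exists>p. case p of (c, d) \<Rightarrow> c \<noteq> d \<and> A = {c, d}"
    using assms by (auto simp: card_2_iff)
  from someI_ex[OF this]
  show "fst (ordered_pair_of A) \<noteq> snd (ordered_pair_of A)"
    "A = {fst (ordered_pair_of A), snd (ordered_pair_of A)}"
    unfolding ordered_pair_of_def[symmetric] by (simp_all add: case_prod_beta)
qed

lemma agree_restrict_eq:
  assumes "b' \<in> tensors P'" "agree_on (P \<inter> P') b b'" "\<And>i. i \<in> P' - P \<Longrightarrow> t i = b' i"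
    "\<And>i. i \<in> P \<inter> P' \<Longrightarrow> t i = b i"
  shows "b' = restrict t P'"
proof
  fix i
  consider "i \<notin> P'" | "i \<in> P' - P" | "i \<in> P \<inter> P'" by blast
  then show "b' i = restrict t P' i"
  proof cases
    case 1
    then show ?thesis using tensors_arb[OF assms(1) 1] by simp
  next
    case 2
    then show ?thesis using assms(3) by simp
  next
    case 3
    then have "b' i = b i" using assms(2) unfolding agree_on_def by (rule bspec[rotated])
    then show ?thesis using assms(4)[OF 3] 3 by simp
  qed
qed

text \<open>Agreement on the old factors leaves only the sign at \<open>c'\<close> free, and the
  degree condition on the whole tensor becomes one on that sign. It has no solution when both merged
  factors are \<open>Minus\<close>.\<close>

lemma bdry_targets_merge:
  assumes P: "finite P" "finite P'" and cd: "P - P' = {c, d}" "c \<noteq> d" and c': "P' - P = {c'}"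
  shows "bdry_targets P P' b =
    (\<lambda>s. restrict (b(c' := s)) P') ` {s. sdeg s = sdeg (b c) + sdeg (b d) - 1}"
proof -
  have c'P: "c' \<in> P'" "c' \<notin> P" using c' by blast+
  have tP: "tdeg P b = tdeg (P \<inter> P') b + (sdeg (b c) + sdeg (b d))"
    unfolding tdeg_split[OF P(1), of b P'] cd(1) using cd(2) by (simp add: tdeg_def)
  have tP': "tdeg P' b' = tdeg (P \<inter> P') b' + sdeg (b' c')" for b'
    unfolding tdeg_split[OF P(2), of b' P] c' by (simp add: tdeg_def Int_commute)
  show ?thesis
  proof (intro equalityI subsetI)
    fix b' assume b': "b' \<in> bdry_targets P P' b"
    then have ag: "agree_on (P \<inter> P') b b'" and t: "b' \<in> tensors P'" and dg: "tdeg P' b' = tdeg P b - 1"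
      by (auto simp: bdry_targets_def)
    have "b' = restrict (b(c' := b' c')) P'"
      by (rule agree_restrict_eq[OF t ag]) (use c' c'P in auto)
    moreover have "sdeg (b' c') = sdeg (b c) + sdeg (b d) - 1"
      using dg unfolding tP tP' tdeg_agree[OF ag] by simp
    ultimately show "b' \<in> (\<lambda>s. restrict (b(c' := s)) P') ` {s. sdeg s = sdeg (b c) + sdeg (b d) - 1}"
      by blast
  next
    fix b' assume "b' \<in> (\<lambda>s. restrict (b(c' := s)) P') ` {s. sdeg s = sdeg (b c) + sdeg (b d) - 1}"
    then obtain s where s: "sdeg s = sdeg (b c) + sdeg (b d) - 1" and b': "b' = restrict (b(c' := s)) P'"
      by blast
    have ag: "agree_on (P \<inter> P') b b'" using c'P by (auto simp: agree_on_def b')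
    have "b' c' = s" using c'P by (simp add: b')
    then have "tdeg P' b' = tdeg P b - 1" unfolding tP tP' tdeg_agree[OF ag] using s by simp
    with ag show "b' \<in> bdry_targets P P' b" by (simp add: bdry_targets_def tensors_def b')
  qed
qed

text \<open>As for merging, the degrees of the old factors cancel and only the signs on the two new
  factors are constrained.\<close>

lemma bdry_targets_split:
  assumes P: "finite P" "finite P'" and cd: "P' - P = {c, d}" "c \<noteq> d" and c': "P - P' = {c'}"
  shows "bdry_targets P P' b =
    (\<lambda>(s, s'). restrict (b(c := s, d := s')) P') ` {(s, s'). sdeg s + sdeg s' = sdeg (b c') - 1}"
proof -
  have cP: "c \<in> P'" "c \<notin> P" "d \<in> P'" "d \<notin> P" using cd by blast+
  have tP: "tdeg P b = tdeg (P \<inter> P') b + sdeg (b c')"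
    unfolding tdeg_split[OF P(1), of b P'] c' by (simp add: tdeg_def)
  have tP': "tdeg P' b' = tdeg (P \<inter> P') b' + (sdeg (b' c) + sdeg (b' d))" for b'
    unfolding tdeg_split[OF P(2), of b' P] cd(1) using cd(2) by (simp add: tdeg_def Int_commute)
  show ?thesis
  proof (intro equalityI subsetI)
    fix b' assume b': "b' \<in> bdry_targets P P' b"
    then have ag: "agree_on (P \<inter> P') b b'" and t: "b' \<in> tensors P'" and dg: "tdeg P' b' = tdeg P b - 1"
      by (auto simp: bdry_targets_def)
    have "b' = restrict (b(c := b' c, d := b' d)) P'"
      by (rule agree_restrict_eq[OF t ag]) (use cd cP in auto)
    moreover have "sdeg (b' c) + sdeg (b' d) = sdeg (b c') - 1"
      using dg unfolding tP tP' tdeg_agree[OF ag] by simp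
    ultimately show "b' \<in> (\<lambda>(s, s'). restrict (b(c := s, d := s')) P') `
        {(s, s'). sdeg s + sdeg s' = sdeg (b c') - 1}"
      by (intro image_eqI[of _ _ "(b' c, b' d)"]) simp_all
  next
    fix b' assume "b' \<in> (\<lambda>(s, s'). restrict (b(c := s, d := s')) P') `
        {(s, s'). sdeg s + sdeg s' = sdeg (b c') - 1}"
    then obtain s s' where s: "sdeg s + sdeg s' = sdeg (b c') - 1"
      and b': "b' = restrict (b(c := s, d := s')) P'"
      by auto
    have ag: "agree_on (P \<inter> P') b b'" using cP by (auto simp: agree_on_def b')
    have "b' c = s" "b' d = s'" using cP cd(2) by (simp_all add: b')
    then have "tdeg P' b' = tdeg P b - 1" unfolding tP tP' tdeg_agree[OF ag] using s by simp
    with ag show "b' \<in> bdry_targets P P' b" by (simp add: bdry_targets_def tensors_def b')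
  qed
qed

lemma sdeg_cases: "sdeg s = 1 \<and> s = Plus \<or> sdeg s = -1 \<and> s = Minus"
  by (cases s) auto

text \<open>The required degree is 1, -1 or -3. The first two each determine a sign, and the last is
  the degree of none, which accounts for the value 0.\<close>

lemma merge_sign_eq: "merge_sign s t = (\<Sum>u | sdeg u = sdeg s + sdeg t - 1. frag_of u)"
proof -
  have "u = Plus" if "sdeg u = 1" for u using sdeg_cases[of u] that by auto
  then have "{u. sdeg u = 1} = {Plus}" by auto
  moreover have "u = Minus" if "sdeg u = -1" for u using sdeg_cases[of u] that by auto
  then have "{u. sdeg u = -1} = {Minus}" by auto
  moreover have "sdeg u \<noteq> -3" for u using sdeg_cases[of u] by auto
  then have "{u. sdeg u = -3} = {}" by simp
  ultimately show ?thesis by (cases s; cases t) simp_all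
qed

lemma split_sign_eq: "split_sign s = (\<Sum>u\<in>{(u, v). sdeg u + sdeg v = sdeg s - 1}. frag_of u)"
proof (cases s)
  case Plus
  have "{(u, v). sdeg u + sdeg v = 0} = {(Plus, Minus), (Minus, Plus)}"
  proof (intro equalityI subsetI)
    fix p assume "p \<in> {(u, v). sdeg u + sdeg v = 0}"
    then show "p \<in> {(Plus, Minus), (Minus, Plus)}"
      using sdeg_cases[of "fst p"] sdeg_cases[of "snd p"] by (cases p) auto
  qed auto
  then show ?thesis using Plus by simp
next
  case Minus
  have "{(u, v). sdeg u + sdeg v = -2} = {(Minus, Minus)}"
  proof (intro equalityI subsetI)
    fix p assume "p \<in> {(u, v). sdeg u + sdeg v = -2}"
    then show "p \<in> {(Minus, Minus)}"
      using sdeg_cases[of "fst p"] sdeg_cases[of "snd p"] by (cases p) auto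
  qed auto
  then show ?thesis using Minus by simp
qed

lemma finite_sign_set: "finite (A :: sign set)"
  by (rule finite_subset[of _ "{Plus, Minus}"]) (use sign.exhaust in auto)

lemma finite_sign_pairs: "finite (A :: (sign \<times> sign) set)"
proof (rule finite_subset)
  show "finite ((UNIV :: sign set) \<times> (UNIV :: sign set))"
    by (intro finite_cartesian_product finite_sign_set)
qed auto

lemma frag_extend_sum_of:
  "finite A \<Longrightarrow> frag_extend f (\<Sum>x\<in>A. frag_of x) = (\<Sum>x\<in>A. f x)"
  by (simp add: frag_extend_sum o_def)

text \<open>The new factors parametrise the targets injectively, so the sums for single signs carry
  over. The arbitrary order chosen by \<open>ordered_pair_of\<close> disappears here, as the set of
  targets does not refer to it.\<close>

theorem bdry_map_eq:
  assumes P: "finite P" "finite P'" and st: "bdry_step P P'"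
  shows "bdry_map P P' b = (\<Sum>b'\<in>bdry_targets P P' b. frag_of b')"
proof (cases "card (P - P') = 2")
  case True
  obtain c d where cd: "ordered_pair_of (P - P') = (c, d)" by fastforce
  have PP: "P - P' = {c, d}" "c \<noteq> d" using ordered_pair_of[OF True] unfolding cd by simp_all
  from st True obtain c' where c': "P' - P = {c'}" by (auto simp: bdry_step_def card_1_singleton_iff)
  have c'P: "c' \<in> P'" using c' by blast
  let ?f = "\<lambda>s. restrict (b(c' := s)) P'" and ?A = "{s. sdeg s = sdeg (b c) + sdeg (b d) - 1}"
  have inj: "inj_on ?f ?A"
    by (rule inj_onI) (use c'P in \<open>metis fun_upd_same restrict_apply\<close>)
  have "bdry_map P P' b = frag_extend (\<lambda>s. frag_of (?f s)) (merge_sign (b c) (b d))"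
    unfolding bdry_map_def cd c' using True by simp
  also have "\<dots> = (\<Sum>s\<in>?A. frag_of (?f s))"
    unfolding merge_sign_eq by (rule frag_extend_sum_of[OF finite_sign_set])
  also have "\<dots> = (\<Sum>b'\<in>bdry_targets P P' b. frag_of b')"
    unfolding bdry_targets_merge[OF P PP c'] by (simp add: sum.reindex[OF inj])
  finally show ?thesis .
next
  case False
  with st have c2: "card (P' - P) = 2" and "card (P - P') = 1" by (auto simp: bdry_step_def)
  then obtain c' where c': "P - P' = {c'}" by (auto simp: card_1_singleton_iff)
  obtain c d where cd: "ordered_pair_of (P' - P) = (c, d)" by fastforce
  have PP: "P' - P = {c, d}" "c \<noteq> d" using ordered_pair_of[OF c2] unfolding cd by simp_all
  have cP: "c \<in> P'" "d \<in> P'" using PP by blast+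
  let ?f = "\<lambda>(s, s'). restrict (b(c := s, d := s')) P'"
    and ?A = "{(s, s'). sdeg s + sdeg s' = sdeg (b c') - 1}"
  have inj: "inj_on ?f ?A"
  proof (rule inj_onI)
    fix p q assume eq: "?f p = ?f q"
    have "?f r c = fst r" "?f r d = snd r" for r using cP PP(2) by (auto simp: case_prod_beta)
    then show "p = q" using eq by (metis prod_eqI)
  qed
  have "bdry_map P P' b = frag_extend (\<lambda>p. frag_of (?f p)) (split_sign (b c'))"
    unfolding bdry_map_def cd c' using False by (simp add: case_prod_unfold)
  also have "\<dots> = (\<Sum>p\<in>?A. frag_of (?f p))"
    unfolding split_sign_eq by (rule frag_extend_sum_of[OF finite_sign_pairs])
  also have "\<dots> = (\<Sum>b'\<in>bdry_targets P P' b. frag_of b')"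
    unfolding bdry_targets_split[OF P PP c'] by (simp only: sum.reindex[OF inj] o_def)
  finally show ?thesis .
qed

subsection \<open>Composition of two steps\<close>

definition middles :: "'i set \<Rightarrow> 'i set \<Rightarrow> 'i set \<Rightarrow> ('i \<Rightarrow> sign) \<Rightarrow> ('i \<Rightarrow> sign) \<Rightarrow> ('i \<Rightarrow> sign) set" where
  "middles P P' P'' b b'' = {b' \<in> bdry_targets P P' b. b'' \<in> bdry_targets P' P'' b'}"

lemma lookup_two_steps:
  assumes "finite P'" "finite P''"
  shows "Poly_Mapping.lookup
      (\<Sum>b'\<in>bdry_targets P P' b. \<Sum>b''\<in>bdry_targets P' P'' b'. frag_of b'') b''
    = int (card (middles P P' P'' b b''))"
proof -
  have "Poly_Mapping.lookup (\<Sum>b''\<in>bdry_targets P' P'' b'. frag_of b'') b''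
      = (if b'' \<in> bdry_targets P' P'' b' then 1 else 0)" for b'
    using finite_bdry_targets[OF assms(2), of P' b']
    by (simp add: lookup_sum lookup_single when_def)
  then have "Poly_Mapping.lookup
      (\<Sum>b'\<in>bdry_targets P P' b. \<Sum>b''\<in>bdry_targets P' P'' b'. frag_of b'') b''
    = (\<Sum>b'\<in>bdry_targets P P' b. if b'' \<in> bdry_targets P' P'' b' then 1 else 0)"
    by (simp add: lookup_sum)
  also have "\<dots> = int (card (middles P P' P'' b b''))"
    using finite_bdry_targets[OF assms(1), of P b]
    by (simp add: sum.If_cases middles_def Int_def conj_commute)
  finally show ?thesis .
qed

text \<open>What two steps impose on their end result without reference to the intermediate set; the
  2 is one unit of degree for each step.\<close>

definition composable :: "'i set \<Rightarrow> 'i set \<Rightarrow> ('i \<Rightarrow> sign) \<Rightarrow> ('i \<Rightarrow> sign) \<Rightarrow> bool" where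
  "composable P P'' b b'' \<longleftrightarrow>
     b'' \<in> tensors P'' \<and> agree_on (P \<inter> P'') b b'' \<and> tdeg P'' b'' = tdeg P b - 2"

lemma middles_empty:
  assumes "P \<inter> P'' \<subseteq> P'" "\<not> composable P P'' b b''"
  shows "middles P P' P'' b b'' = {}"
proof (rule equals0I)
  fix b' assume "b' \<in> middles P P' P'' b b''"
  then have "agree_on (P \<inter> P') b b'" "agree_on (P' \<inter> P'') b' b''" "b'' \<in> tensors P''"
    "tdeg P'' b'' = tdeg P b - 2"
    by (auto simp: middles_def bdry_targets_def)
  moreover from this have "agree_on (P \<inter> P'') b b''"
    using assms(1) by (auto simp: agree_on_def subset_iff)
  ultimately show False using assms(2) by (simp add: composable_def)
qed

text \<open>
  Only the components that are created by the first step and destroyed by the second leave a choice.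
\<close>

lemma card_middles:
  assumes fin: "finite P" "finite P'" "finite P''" and sub: "P \<inter> P'' \<subseteq> P'"
    and co: "composable P P'' b b''"
  shows "card (middles P P' P'' b b'') =
    card {y \<in> tensors (P' - P - P''). tdeg (P' - P - P'') y
      = tdeg (P - P') b - 1 - tdeg (P' \<inter> P'' - P) b''}"
proof -
  let ?Y = "P' - P - P''"
  \<comment> \<open>An intermediate tensor is forced by \<open>b\<close> on factors that come from
    \<open>P\<close> and by \<open>b''\<close> on those that persist to \<open>P''\<close>;
    \<open>y\<close> fills in the rest.\<close>
  define f where "f y = restrict (\<lambda>i. if i \<in> P then b i else if i \<in> P'' then b'' i else y i) P'"
    for y :: "'a \<Rightarrow> sign"
  have agPP'': "agree_on (P \<inter> P'') b b''" using co by (simp add: composable_def)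
  have split': "tdeg P' t = tdeg (P \<inter> P') t + tdeg (P' \<inter> P'' - P) t + tdeg ?Y t" for t
  proof -
    have "P' \<inter> P = P \<inter> P'" "(P' - P) \<inter> P'' = P' \<inter> P'' - P" by blast+
    then show ?thesis
      using tdeg_split[OF fin(2), of t P] tdeg_split[of "P' - P" t P''] fin(2) by simp
  qed
  have char: "b' \<in> middles P P' P'' b b'' \<longleftrightarrow>
    b' \<in> tensors P' \<and> agree_on (P \<inter> P') b b' \<and> agree_on (P' \<inter> P'' - P) b'' b'
    \<and> tdeg ?Y b' = tdeg (P - P') b - 1 - tdeg (P' \<inter> P'' - P) b''" for b'
  proof -
    have d1: "tdeg P' b' = tdeg P b - 1 \<longleftrightarrow>
        tdeg ?Y b' = tdeg (P - P') b - 1 - tdeg (P' \<inter> P'' - P) b''"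
      if ag: "agree_on (P \<inter> P') b b'" "agree_on (P' \<inter> P'' - P) b'' b'"
      using split'[of b'] tdeg_agree[OF ag(1)] tdeg_agree[OF ag(2)] tdeg_split[OF fin(1), of b P']
      by linarith
    have a1: "agree_on (P' \<inter> P'') b' b'' \<longleftrightarrow> agree_on (P' \<inter> P'' - P) b'' b'"
      if ag: "agree_on (P \<inter> P') b b'"
    proof
      show "agree_on (P' \<inter> P'') b' b'' \<Longrightarrow> agree_on (P' \<inter> P'' - P) b'' b'"
        by (simp add: agree_on_def)
      assume r: "agree_on (P' \<inter> P'' - P) b'' b'"
      show "agree_on (P' \<inter> P'') b' b''"
        unfolding agree_on_def
      proof
        fix i assume i: "i \<in> P' \<inter> P''"
        show "b'' i = b' i"
          using i r ag agPP'' by (cases "i \<in> P") (simp_all add: agree_on_def)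
      qed
    qed
    have "b' \<in> middles P P' P'' b b'' \<longleftrightarrow> b' \<in> tensors P' \<and> agree_on (P \<inter> P') b b'
      \<and> tdeg P' b' = tdeg P b - 1 \<and> agree_on (P' \<inter> P'') b' b''"
      using co by (auto simp: middles_def bdry_targets_def composable_def)
    then show ?thesis using a1 d1 by blast
  qed
  have inY: "f y i = y i" if i: "i \<in> ?Y" for y i using i by (simp add: f_def)
  have "bij_betw f {y \<in> tensors ?Y. tdeg ?Y y = tdeg (P - P') b - 1 - tdeg (P' \<inter> P'' - P) b''}
    (middles P P' P'' b b'')"
  proof (rule bij_betw_byWitness[where f' = "\<lambda>b'. restrict b' ?Y"])
    show "\<forall>y\<in>{y \<in> tensors ?Y. tdeg ?Y y = tdeg (P - P') b - 1 - tdeg (P' \<inter> P'' - P) b''}.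
      restrict (f y) ?Y = y"
    proof
      fix y assume "y \<in> {y \<in> tensors ?Y. tdeg ?Y y = tdeg (P - P') b - 1 - tdeg (P' \<inter> P'' - P) b''}"
      then have y: "y \<in> tensors ?Y" by simp
      show "restrict (f y) ?Y = y"
      proof
        fix i show "restrict (f y) ?Y i = y i"
          using inY[of i y] tensors_arb[OF y, of i] by (cases "i \<in> ?Y") (simp_all add: restrict_def)
      qed
    qed
    show "\<forall>b'\<in>middles P P' P'' b b''. f (restrict b' ?Y) = b'"
    proof
      fix b' assume "b' \<in> middles P P' P'' b b''"
      then have b': "b' \<in> tensors P'" "agree_on (P \<inter> P') b b'" "agree_on (P' \<inter> P'' - P) b'' b'"
        unfolding char by simp_all
      show "f (restrict b' ?Y) = b'"
      proof
        fix i show "f (restrict b' ?Y) i = b' i"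
          using b'(2,3) tensors_arb[OF b'(1), of i] unfolding f_def
          by (cases "i \<in> P'"; cases "i \<in> P"; cases "i \<in> P''") (simp_all add: agree_on_def)
      qed
    qed
    show "f ` {y \<in> tensors ?Y. tdeg ?Y y = tdeg (P - P') b - 1 - tdeg (P' \<inter> P'' - P) b''}
      \<subseteq> middles P P' P'' b b''"
    proof (rule image_subsetI)
      fix y assume y: "y \<in> {y \<in> tensors ?Y. tdeg ?Y y = tdeg (P - P') b - 1 - tdeg (P' \<inter> P'' - P) b''}"
      have "tdeg ?Y (f y) = tdeg ?Y y" by (rule tdeg_cong) (rule inY)
      moreover have "f y \<in> tensors P'" by (simp add: f_def tensors_def)
      moreover have "agree_on (P \<inter> P') b (f y)" "agree_on (P' \<inter> P'' - P) b'' (f y)"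
        by (simp_all add: agree_on_def f_def)
      ultimately show "f y \<in> middles P P' P'' b b''" unfolding char using y by simp
    qed
    show "(\<lambda>b'. restrict b' ?Y) ` middles P P' P'' b b''
      \<subseteq> {y \<in> tensors ?Y. tdeg ?Y y = tdeg (P - P') b - 1 - tdeg (P' \<inter> P'' - P) b''}"
    proof (rule image_subsetI)
      fix b' assume "b' \<in> middles P P' P'' b b''"
      moreover have "tdeg ?Y (restrict b' ?Y) = tdeg ?Y b'" by (rule tdeg_cong) simp
      ultimately show "restrict b' ?Y
        \<in> {y \<in> tensors ?Y. tdeg ?Y y = tdeg (P - P') b - 1 - tdeg (P' \<inter> P'' - P) b''}"
        unfolding char by (simp add: tensors_def)
    qed
  qed
  then show ?thesis using bij_betw_same_card by fastforce
qed

section \<open>Counting the intermediate tensors of two steps\<close>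

lemma tdeg_values:
  "card A = 0 \<Longrightarrow> finite A \<Longrightarrow> tdeg A t = 0"
  "card A = 1 \<Longrightarrow> tdeg A t = 1 \<or> tdeg A t = -1"
  "card A = 2 \<Longrightarrow> tdeg A t = 2 \<or> tdeg A t = 0 \<or> tdeg A t = -2"
proof -
  show "card A = 0 \<Longrightarrow> finite A \<Longrightarrow> tdeg A t = 0" by (simp add: tdeg_def)
  show "tdeg A t = 1 \<or> tdeg A t = -1" if c: "card A = 1"
  proof -
    obtain i where "A = {i}" using c by (auto simp: card_1_singleton_iff)
    then show ?thesis using sdeg_cases[of "t i"] by (auto simp: tdeg_def)
  qed
  show "tdeg A t = 2 \<or> tdeg A t = 0 \<or> tdeg A t = -2" if c: "card A = 2"
  proof -
    obtain i j where "A = {i, j}" "i \<noteq> j" using c by (auto simp: card_2_iff)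
    then show ?thesis using sdeg_cases[of "t i"] sdeg_cases[of "t j"] by (auto simp: tdeg_def)
  qed
qed

lemma card_tensors_one:
  assumes "card Y = 1" "s = 1 \<or> s = -1"
  shows "card {y \<in> tensors Y. tdeg Y y = s} = 1"
proof -
  obtain i where Y: "Y = {i}" using assms by (auto simp: card_1_singleton_iff)
  obtain u where u: "sdeg u = s" using assms(2) sdeg.simps by metis
  have "{y \<in> tensors Y. tdeg Y y = s} = {restrict (\<lambda>_. u) Y}"
  proof (intro equalityI subsetI)
    fix y assume "y \<in> {y \<in> tensors Y. tdeg Y y = s}"
    then have y: "y \<in> tensors Y" "sdeg (y i) = s" by (auto simp: Y tdeg_def)
    then have "y i = u" using sdeg_cases[of u] sdeg_cases[of "y i"] u by auto
    then have "y = restrict (\<lambda>_. u) Y"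
      by (intro tensors_eqI[OF y(1) restrict_in_tensors]) (simp add: Y)
    then show "y \<in> {restrict (\<lambda>_. u) Y}" by simp
  qed (auto simp: Y tensors_def tdeg_def u)
  then show ?thesis by simp
qed

lemma card_tensors_two:
  assumes "card Y = 2"
  shows "card {y \<in> tensors Y. tdeg Y y = 0} = 2"
proof -
  obtain i j where Y: "Y = {i, j}" and ij: "i \<noteq> j" using assms by (auto simp: card_2_iff)
  define g where "g u v = restrict (\<lambda>k. if k = i then u else v) Y" for u v :: sign
  have "{y \<in> tensors Y. tdeg Y y = 0} = {g Plus Minus, g Minus Plus}"
  proof (intro equalityI subsetI)
    fix y assume "y \<in> {y \<in> tensors Y. tdeg Y y = 0}"
    then have y: "y \<in> tensors Y" "sdeg (y i) + sdeg (y j) = 0" using ij by (auto simp: Y tdeg_def)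
    have "y = g (y i) (y j)"
      unfolding g_def by (rule tensors_eqI[OF y(1) restrict_in_tensors]) (auto simp: Y)
    moreover have "y i = Plus \<and> y j = Minus \<or> y i = Minus \<and> y j = Plus"
      using y(2) sdeg_cases[of "y i"] sdeg_cases[of "y j"] by auto
    ultimately show "y \<in> {g Plus Minus, g Minus Plus}" by (metis insertCI)
  qed (use ij in \<open>auto simp: g_def Y tdeg_def intro: restrict_in_tensors\<close>)
  moreover have "g Plus Minus i \<noteq> g Minus Plus i" by (simp add: g_def Y)
  then have "g Plus Minus \<noteq> g Minus Plus" by metis
  ultimately show ?thesis by simp
qed

text \<open>The total degree drops by two and the factors common to \<open>P\<close> and
  \<open>P''\<close> cancel. The remaining ones are sorted by whether they belong to
  \<open>P'\<close>.\<close>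

lemma two_step_balance:
  assumes fin: "finite P" "finite P'" "finite P''" and sub: "P \<inter> P'' \<subseteq> P'"
    and co: "composable P P'' b b''"
  shows "tdeg (P'' - P') b'' + tdeg (P' \<inter> P'' - P) b'' = tdeg (P - P') b + tdeg (P \<inter> P' - P'') b - 2"
proof -
  have "P = P \<inter> P'' \<union> ((P - P') \<union> (P \<inter> P' - P''))" using sub by blast
  moreover have "tdeg (P \<inter> P'' \<union> ((P - P') \<union> (P \<inter> P' - P''))) b
      = tdeg (P \<inter> P'') b + (tdeg (P - P') b + tdeg (P \<inter> P' - P'') b)"
    using fin sub by (subst tdeg_Un, auto)+
  ultimately have 1: "tdeg P b = tdeg (P \<inter> P'') b + (tdeg (P - P') b + tdeg (P \<inter> P' - P'') b)"
    by metis
  have "P'' = P \<inter> P'' \<union> ((P'' - P') \<union> (P' \<inter> P'' - P))" using sub by blast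
  moreover have "tdeg (P \<inter> P'' \<union> ((P'' - P') \<union> (P' \<inter> P'' - P))) b''
      = tdeg (P \<inter> P'') b'' + (tdeg (P'' - P') b'' + tdeg (P' \<inter> P'' - P) b'')"
    using fin sub by (subst tdeg_Un, auto)+
  ultimately have 2: "tdeg P'' b'' = tdeg (P \<inter> P'') b'' + (tdeg (P'' - P') b'' + tdeg (P' \<inter> P'' - P) b'')"
    by metis
  have "agree_on (P \<inter> P'') b b''" "tdeg P'' b'' = tdeg P b - 2"
    using co by (simp_all add: composable_def)
  then show ?thesis using 1 2 tdeg_agree by fastforce
qed

text \<open>The free factors are those in \<open>?Y\<close>. If there are two, a component is split
  and its parts are merged again; the balance of degrees then forces total degree 0 on them, which
  has two solutions. If there is one, the balance makes its required degree 1 or -1, and its sign is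
  determined.\<close>

lemma card_middles_linked:
  assumes fin: "finite P" "finite P'" "finite P''" and sub: "P \<inter> P'' \<subseteq> P'"
    and st: "bdry_step P P'" "bdry_step P' P''"
    and Y: "P' - P - P'' \<noteq> {}" and co: "composable P P'' b b''"
  shows "card (middles P P' P'' b b'') = (if card (P - P'') = 1 \<and> card (P'' - P) = 1 then 2 else 1)"
proof -
  let ?Y = "P' - P - P''" and ?A = "P \<inter> P' - P''" and ?B = "P' \<inter> P'' - P"
  let ?s = "tdeg (P - P') b - 1 - tdeg ?B b''"
  have un: "card U = card U1 + card U2" if "U = U1 \<union> U2" "U1 \<inter> U2 = {}" "finite U1" "finite U2"
    for U U1 U2 :: "'a set"
    using that by (simp add: card_Un_disjoint)
  have c1: "card (P' - P) = card ?Y + card ?B" by (rule un) (use fin in auto)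
  have c2: "card (P' - P'') = card ?Y + card ?A" by (rule un) (use fin in auto)
  have c3: "card (P - P'') = card (P - P') + card ?A" by (rule un) (use fin sub in auto)
  have c4: "card (P'' - P) = card (P'' - P') + card ?B" by (rule un) (use fin sub in auto)
  have c5: "card ?Y \<noteq> 0" using Y fin by (metis card_0_eq finite_Diff)
  note bal = two_step_balance[OF fin sub co]
  have fAB: "finite ?A" "finite ?B" using fin by auto
  note vx = tdeg_values(2,3)[of "P - P'" b] and vz = tdeg_values(2,3)[of "P'' - P'" b'']
    and va = tdeg_values(1)[OF _ fAB(1), of b] tdeg_values(2)[of ?A b]
    and vb = tdeg_values(1)[OF _ fAB(2), of b''] tdeg_values(2)[of ?B b'']
  have cases: "card ?Y = 2 \<and> ?s = 0 \<and> card (P - P'') = 1 \<and> card (P'' - P) = 1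
    \<or> card ?Y = 1 \<and> (?s = 1 \<or> ?s = -1) \<and> \<not> (card (P - P'') = 1 \<and> card (P'' - P) = 1)"
  proof -
    obtain x y z \<alpha> \<beta> where n: "card (P - P') = x" "card ?Y = y" "card (P'' - P') = z"
      "card ?A = \<alpha>" "card ?B = \<beta>" by blast
    obtain tx tz ta tb where t: "tdeg (P - P') b = tx" "tdeg (P'' - P') b'' = tz"
      "tdeg ?A b = ta" "tdeg ?B b'' = tb" by blast
    have s1: "x = 2 \<and> y + \<beta> = 1 \<or> x = 1 \<and> y + \<beta> = 2"
      using st(1) unfolding bdry_step_def c1 n by simp
    have s2: "y + \<alpha> = 2 \<and> z = 1 \<or> y + \<alpha> = 1 \<and> z = 2"
      using st(2) unfolding bdry_step_def c2 n by simp
    \<comment> \<open>The five patterns are: merge then split, merge twice, split then merge the two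
      parts, split then split one part, and split then merge one part with an old component.\<close>
    have "x = 2 \<and> y = 1 \<and> \<beta> = 0 \<and> \<alpha> = 0 \<and> z = 2 \<or> x = 2 \<and> y = 1 \<and> \<beta> = 0 \<and> \<alpha> = 1 \<and> z = 1
      \<or> x = 1 \<and> y = 2 \<and> \<beta> = 0 \<and> \<alpha> = 0 \<and> z = 1 \<or> x = 1 \<and> y = 1 \<and> \<beta> = 1 \<and> \<alpha> = 0 \<and> z = 2
      \<or> x = 1 \<and> y = 1 \<and> \<beta> = 1 \<and> \<alpha> = 1 \<and> z = 1"
      using s1 s2 c5 unfolding n by presburger
    then show ?thesis
      using vx vz va vb bal unfolding c3 c4 n t by (elim disjE conjE; hypsubst) (simp; linarith?)+
  qed
  then show ?thesis
    unfolding card_middles[OF fin sub co]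
    using card_tensors_one[of ?Y ?s] card_tensors_two[of ?Y] by auto
qed

text \<open>There is no free factor, so at most one candidate exists, and the degree drop of the
  first step decides whether it is admissible.\<close>

lemma card_middles_unlinked:
  assumes fin: "finite P" "finite P'" "finite P''" and sub: "P \<inter> P'' \<subseteq> P'"
    and Y: "P' - P \<subseteq> P''" and co: "composable P P'' b b''"
  shows "card (middles P P' P'' b b'') =
    (if tdeg (P - P') b - 1 = tdeg (P' - P) b'' then 1 else 0)"
proof -
  have Y': "P' - P - P'' = {}" "P' \<inter> P'' - P = P' - P" using Y by blast+
  have "tensors ({} :: 'a set) = {\<lambda>_. undefined}" by (simp add: tensors_def)
  then have "{y \<in> tensors ({} :: 'a set). tdeg {} y = s} = (if s = 0 then {\<lambda>_. undefined} else {})" for s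
    by (auto simp: tdeg_def)
  then show ?thesis unfolding card_middles[OF fin sub co] Y' by simp
qed

text \<open>In the first alternative the count depends only on \<open>P\<close> and
  \<open>P''\<close>. In the second each count is 0 or 1, according to whether the factors changed
  by one removal lose one unit of degree. The total loss is two and is shared by two disjoint sets
  of factors, so one set loses one unit exactly when the other does.\<close>

theorem bdry_square:
  assumes fin: "finite P" "finite Q" "finite R" "finite P''"
    and st: "bdry_step P Q" "bdry_step Q P''" "bdry_step P R" "bdry_step R P''"
    and sub: "P \<inter> P'' \<subseteq> Q" "P \<inter> P'' \<subseteq> R"
    and cases: "Q - P - P'' \<noteq> {} \<and> R - P - P'' \<noteq> {} \<or>
      P - P'' = (P - Q) \<union> (P - R) \<and> (P - Q) \<inter> (P - R) = {} \<and>
      P'' - P = (Q - P) \<union> (R - P) \<and> (Q - P) \<inter> (R - P) = {}"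
  shows "frag_extend (bdry_map Q P'') (bdry_map P Q b) = frag_extend (bdry_map R P'') (bdry_map P R b)"
proof -
  have two: "frag_extend (bdry_map P' P'') (bdry_map P P' b) =
    (\<Sum>b'\<in>bdry_targets P P' b. \<Sum>b''\<in>bdry_targets P' P'' b'. frag_of b'')"
    if "finite P'" "bdry_step P P'" "bdry_step P' P''" for P'
    using that fin
    by (simp add: bdry_map_eq frag_extend_sum_of finite_bdry_targets)
  have "card (middles P Q P'' b b'') = card (middles P R P'' b b'')" for b''
  proof (cases "composable P P'' b b''")
    case False
    then show ?thesis using middles_empty[OF sub(1)] middles_empty[OF sub(2)] by simp
  next
    case co: True
    from cases show ?thesis
    proof
      assume "Q - P - P'' \<noteq> {} \<and> R - P - P'' \<noteq> {}"
      then show ?thesis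
        using card_middles_linked[OF fin(1,2,4) sub(1) st(1,2) _ co]
          card_middles_linked[OF fin(1,3,4) sub(2) st(3,4) _ co] by simp
    next
      assume u: "P - P'' = (P - Q) \<union> (P - R) \<and> (P - Q) \<inter> (P - R) = {} \<and>
        P'' - P = (Q - P) \<union> (R - P) \<and> (Q - P) \<inter> (R - P) = {}"
      then have "Q - P \<subseteq> P''" "R - P \<subseteq> P''" by blast+
      note c = card_middles_unlinked[OF fin(1,2,4) sub(1) this(1) co]
        card_middles_unlinked[OF fin(1,3,4) sub(2) this(2) co]
      have "tdeg (P - P'') b = tdeg (P - Q) b + tdeg (P - R) b"
        using u tdeg_Un[of "P - Q" "P - R" b] fin by simp
      moreover have "tdeg (P'' - P) b'' = tdeg (Q - P) b'' + tdeg (R - P) b''"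
        using u tdeg_Un[of "Q - P" "R - P" b''] fin by simp
      moreover have "tdeg (P'' - P) b'' = tdeg (P - P'') b - 2"
      proof -
        have ag: "agree_on (P \<inter> P'') b b''" and dg: "tdeg P'' b'' = tdeg P b - 2"
          using co by (simp_all add: composable_def)
        show ?thesis
          using tdeg_split[OF fin(1), of b P''] tdeg_split[OF fin(4), of b'' P] tdeg_agree[OF ag] dg
          by (simp add: Int_commute)
      qed
      ultimately show ?thesis unfolding c by auto
    qed
  qed
  then show ?thesis
    using fin st by (intro poly_mapping_eqI) (simp add: two lookup_two_steps)
qed


section \<open>The differential\<close>

lemma frag_extend_extend:
  "frag_extend f (frag_extend g x) = frag_extend (\<lambda>i. frag_extend f (g i)) x"
  unfolding frag_extend_def[of g] frag_extend_def[of "\<lambda>i. frag_extend f (g i)"]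
  by (simp add: frag_extend_sum frag_extend_cmul o_def)

lemma frag_extend_swap:
  "frag_extend (\<lambda>i. frag_extend (h i) y) x = frag_extend (\<lambda>j. frag_extend (\<lambda>i. h i j) x) y"
  unfolding frag_extend_def frag_cmul_sum frag_cmul_cmul
  by (subst sum.swap) (simp add: mult.commute)

lemma frag_extend_sum_fun:
  "finite J \<Longrightarrow> frag_extend (\<lambda>x. \<Sum>j\<in>J. f j x) y = (\<Sum>j\<in>J. frag_extend (f j) y)"
  unfolding frag_extend_def frag_cmul_sum by (rule sum.swap)

lemma frag_extend_cmul_fun:
  "frag_extend (\<lambda>x. frag_cmul n (f x)) y = frag_cmul n (frag_extend f y)"
  unfolding frag_extend_def frag_cmul_sum by (simp add: mult.commute)

text \<open>This is \<open>a \<otimes> X \<otimes> Y\<close> in the summand of the state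
  \<open>W\<close>. It exhibits an edge map as a tensor product of maps, so that squares can be
  checked factor by factor.\<close>

definition gen_tensor ::
  "'h set set \<Rightarrow> ('v \<Rightarrow> sign) \<Rightarrow> (('h set + 'v \<Rightarrow> sign) \<Rightarrow>\<^sub>0 int) \<Rightarrow> ((nat \<Rightarrow> sign) \<Rightarrow>\<^sub>0 int)
    \<Rightarrow> (('v, 'h) gen \<Rightarrow>\<^sub>0 int)" where
  "gen_tensor W a X Y = frag_extend (\<lambda>b. frag_extend (\<lambda>c. frag_of (W, a, b, c)) Y) X"

lemma keys_gen_tensor:
  "Poly_Mapping.keys (gen_tensor W a X Y) \<subseteq> {W} \<times> {a} \<times> Poly_Mapping.keys X \<times> Poly_Mapping.keys Y"
proof
  fix y assume "y \<in> Poly_Mapping.keys (gen_tensor W a X Y)"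
  then obtain b where b: "b \<in> Poly_Mapping.keys X"
    "y \<in> Poly_Mapping.keys (frag_extend (\<lambda>c. frag_of (W, a, b, c)) Y)"
    unfolding gen_tensor_def using keys_frag_extend by fast
  then obtain c where "c \<in> Poly_Mapping.keys Y" "y \<in> Poly_Mapping.keys (frag_of (W, a, b, c))"
    using keys_frag_extend by fast
  then show "y \<in> {W} \<times> {a} \<times> Poly_Mapping.keys X \<times> Poly_Mapping.keys Y" using b by simp
qed

lemma edge_map_eq:
  "edge_map F e (W, a, b, c) = gen_tensor (W - {e}) a
     (bdry_map (bdry_comps (subfat F W)) (bdry_comps (subfat F (W - {e}))) b)
     (genus_map (genus (subfat F W)) (genus (subfat F (W - {e}))) c)"
  by (simp add: gen_tensor_def Let_def)

text \<open>Composition of tensor products of maps is factorwise; the only work is to interchange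
  the expansions over the boundary factor and the genus factor.\<close>

lemma extend_edge_map_gen_tensor:
  "frag_extend (edge_map F e) (gen_tensor W a X Y) = gen_tensor (W - {e}) a
     (frag_extend (bdry_map (bdry_comps (subfat F W)) (bdry_comps (subfat F (W - {e})))) X)
     (frag_extend (genus_map (genus (subfat F W)) (genus (subfat F (W - {e})))) Y)"
proof -
  let ?M = "bdry_map (bdry_comps (subfat F W)) (bdry_comps (subfat F (W - {e})))"
    and ?N = "genus_map (genus (subfat F W)) (genus (subfat F (W - {e})))"
  have "frag_extend (edge_map F e) (gen_tensor W a X Y)
      = frag_extend (\<lambda>b. frag_extend (\<lambda>c. gen_tensor (W - {e}) a (?M b) (?N c)) Y) X"
    unfolding gen_tensor_def[of W] by (simp only: frag_extend_extend frag_extend_of edge_map_eq)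
  also have "\<dots> = frag_extend (\<lambda>b. frag_extend (\<lambda>b'.
      frag_extend (\<lambda>c. frag_extend (\<lambda>c'. frag_of (W - {e}, a, b', c')) (?N c)) Y) (?M b)) X"
    unfolding gen_tensor_def by (subst frag_extend_swap) (rule refl)
  also have "\<dots> = gen_tensor (W - {e}) a (frag_extend ?M X) (frag_extend ?N Y)"
    unfolding gen_tensor_def by (simp only: frag_extend_extend)
  finally show ?thesis .
qed

text \<open>If the intermediate genera differ, one is \<open>g\<close> and the other
  \<open>g - 1\<close>, which forces \<open>g2 = g - 1\<close>. Either order then consists of an
  identity and the same single drop.\<close>

lemma genus_square:
  assumes "g1 = g \<or> g1 = g - 1" "g2 = g1 \<or> g2 = g1 - 1"
    and "g1' = g \<or> g1' = g - 1" "g2 = g1' \<or> g2 = g1' - 1"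
  shows "frag_extend (genus_map g1 g2) (genus_map g g1 c)
    = frag_extend (genus_map g1' g2) (genus_map g g1' c)"
proof (cases "g1 = g1'")
  case False
  have id: "frag_extend (genus_map k k) x = x" for k x
    unfolding genus_map_def by (simp flip: frag_expansion)
  have of_id: "genus_map k k x = frag_of x" for k x by (simp add: genus_map_def)
  from False assms consider "g1 = g" "g2 = g1'" | "g1' = g" "g2 = g1" by linarith
  then show ?thesis by cases (simp_all add: id of_id)
qed simp

lemma keys_sum_frag_of: "finite A \<Longrightarrow> Poly_Mapping.keys (\<Sum>x\<in>A. frag_of x) \<subseteq> A"
  using keys_sum[of frag_of A] by auto

lemma keys_genus_map:
  assumes "c \<in> tensors {..<2 * g}" "g' = g \<or> g' = g - 1" "c' \<in> Poly_Mapping.keys (genus_map g g' c)"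
  shows "c' \<in> tensors {..<2 * g'} \<and> tdeg {..<2 * g'} c' = tdeg {..<2 * g} c"
proof (cases "g' = g")
  case True
  then show ?thesis using assms by (simp add: genus_map_def)
next
  case False
  then have g': "g' = g - 1" using assms(2) by simp
  have "c' \<in> Poly_Mapping.keys (genus_drop g c)" using False assms(3) by (simp add: genus_map_def)
  then show ?thesis unfolding genus_drop_def g'
    using keys_sum_frag_of[of "{t' \<in> tensors {..<2 * (g - 1)}. tdeg {..<2 * (g - 1)} t' = tdeg {..<2 * g} c}"]
      finite_tensors[of "{..<2 * (g - 1)}"] by auto
qed

text \<open>Putting zeros on the diagonal turns the index set into a full square. Exchanging the
  summations shows the sum to be its own negative, hence zero, since the coefficients are
  integers.\<close>

lemma antisymmetric_sum_zero:
  fixes t :: "'i \<Rightarrow> 'i \<Rightarrow> ('a \<Rightarrow>\<^sub>0 int)"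
  assumes "finite J" "\<And>j k. \<lbrakk>j \<in> J; k \<in> J; j \<noteq> k\<rbrakk> \<Longrightarrow> t j k = - t k j"
  shows "(\<Sum>j\<in>J. \<Sum>k\<in>J - {j}. t j k) = 0"
proof -
  define s where "s j k = (if j = k then 0 else t j k)" for j k
  have anti: "s j k = - s k j" if "j \<in> J" "k \<in> J" for j k
  proof (cases "j = k")
    case False
    then show ?thesis using assms(2)[OF that False] by (simp only: s_def if_False) simp
  qed (simp add: s_def)
  have 1: "(\<Sum>k\<in>J - {j}. t j k) = (\<Sum>k\<in>J. s j k)" if "j \<in> J" for j
    using assms(1) that by (intro sum.mono_neutral_cong_left) (auto simp: s_def)
  have "(\<Sum>j\<in>J. \<Sum>k\<in>J. s j k) = (\<Sum>k\<in>J. \<Sum>j\<in>J. s j k)" by (rule sum.swap)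
  also have "\<dots> = (\<Sum>k\<in>J. \<Sum>j\<in>J. - s k j)"
    by (intro sum.cong refl anti)
  also have "\<dots> = - (\<Sum>k\<in>J. \<Sum>j\<in>J. s k j)" by (simp add: sum_negf)
  finally have eq: "(\<Sum>j\<in>J. \<Sum>k\<in>J. s j k) = - (\<Sum>k\<in>J. \<Sum>j\<in>J. s k j)" .
  have "(\<Sum>j\<in>J. \<Sum>k\<in>J. s j k) = 0"
  proof (rule poly_mapping_eqI)
    fix i
    from arg_cong[OF eq, of "\<lambda>x. Poly_Mapping.lookup x i"]
    show "Poly_Mapping.lookup (\<Sum>j\<in>J. \<Sum>k\<in>J. s j k) i = Poly_Mapping.lookup 0 i" by simp
  qed
  then show ?thesis using 1 by simp
qed

context fatgraph_loc
begin

text \<open>The vertex factor is untouched, the genus factors commute by the bounds on the genus,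
  and the alternative between linked and unlinked edges supplies what \<open>bdry_square\<close>
  asks for the boundary factors.\<close>

lemma edge_maps_commute:
  assumes W: "W \<subseteq> edges F" and e: "e \<in> W" and f: "f \<in> W" and ef: "f \<noteq> e"
  shows "frag_extend (edge_map F f) (edge_map F e (W, x)) = frag_extend (edge_map F e) (edge_map F f (W, x))"
proof -
  obtain a b c where x: "x = (a, b, c)" by (cases x) auto
  have comm: "W - {f} - {e} = W - {e} - {f}" by blast
  have fe: "e \<noteq> f" using ef by simp
  have We: "W - {e} \<subseteq> edges F" "f \<in> W - {e}" and Wf: "W - {f} \<subseteq> edges F" "e \<in> W - {f}"
    using W e f ef by auto
  note step = card_bdry_step[folded bdry_step_def]
  have cases: "bdry (W - {e}) - bdry W - bdry (W - {e} - {f}) \<noteq> {}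
      \<and> bdry (W - {f}) - bdry W - bdry (W - {e} - {f}) \<noteq> {} \<or>
    bdry W - bdry (W - {e} - {f}) = (bdry W - bdry (W - {e})) \<union> (bdry W - bdry (W - {f})) \<and>
    (bdry W - bdry (W - {e})) \<inter> (bdry W - bdry (W - {f})) = {} \<and>
    bdry (W - {e} - {f}) - bdry W = (bdry (W - {e}) - bdry W) \<union> (bdry (W - {f}) - bdry W) \<and>
    (bdry (W - {e}) - bdry W) \<inter> (bdry (W - {f}) - bdry W) = {}"
  proof (cases "linked W e f")
    case True
    then have "linked W f e" using linked_sym by blast
    then show ?thesis
      using linked_new_comp[OF W e f ef True] linked_new_comp[OF W f e fe] unfolding comm by blast
  next
    case False
    show ?thesis using unlinked_diff[OF W e f ef False] by (intro disjI2 conjI)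
  qed
  have B: "frag_extend (bdry_map (bdry (W - {e})) (bdry (W - {e} - {f}))) (bdry_map (bdry W) (bdry (W - {e})) b)
    = frag_extend (bdry_map (bdry (W - {f})) (bdry (W - {e} - {f}))) (bdry_map (bdry W) (bdry (W - {f})) b)"
    by (rule bdry_square[OF finite_bdry finite_bdry finite_bdry finite_bdry
          step[OF W e] step[OF We] step[OF W f] step[OF Wf, unfolded comm]
          bdry_two_edges_subset[OF W e f ef] bdry_two_edges_subset[OF W f e fe, unfolded comm] cases])
  have G: "frag_extend (genus_map (genus (subfat F (W - {e}))) (genus (subfat F (W - {e} - {f}))))
      (genus_map (genus (subfat F W)) (genus (subfat F (W - {e}))) c)
    = frag_extend (genus_map (genus (subfat F (W - {f}))) (genus (subfat F (W - {e} - {f}))))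
      (genus_map (genus (subfat F W)) (genus (subfat F (W - {f}))) c)"
    by (rule genus_square[OF genus_remove[OF W e] genus_remove[OF We] genus_remove[OF W f]
          genus_remove[OF Wf, unfolded comm]])
  show ?thesis
    unfolding x edge_map_eq extend_edge_map_gen_tensor comm B G ..
qed

lemma height_eq: "W \<subseteq> edges F \<Longrightarrow> height F W = int (num_edges F) - int (card W)"
  by (simp add: height_def num_edges_subfat)

lemma height_remove:
  assumes "W \<subseteq> edges F" "e \<in> W"
  shows "height F (W - {e}) = height F W + 1"
proof -
  have "finite W" using assms finite_edges finite_subset by blast
  then have "card W = Suc (card (W - {e}))" using assms(2) by (metis card_Suc_Diff1)
  moreover have "W - {e} \<subseteq> edges F" using assms by blast
  ultimately show ?thesis using assms(1) by (simp add: height_eq)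
qed

text \<open>The boundary map lowers the degree by one, the genus map preserves it, and the height in
  the shift grows by one.\<close>

lemma edge_map_keys:
  assumes W: "W \<subseteq> edges F" and e: "e \<in> W" and x: "x \<in> state_basis F W"
    and y: "y \<in> Poly_Mapping.keys (edge_map F e x)"
  shows "y \<in> state_basis F (W - {e})" "gen_deg F y = gen_deg F x"
proof -
  obtain a b c where x': "x = (W, a, b, c)" and a: "a \<in> tensors (verts (subfat F W))"
    and b: "b \<in> tensors (bdry W)" and c: "c \<in> tensors {..<2 * genus (subfat F W)}"
    using x by (auto simp: state_basis_def)
  have vs: "verts (subfat F V) = verts F" for V by (simp add: subfat_def)
  from y obtain b' c' where y': "y = (W - {e}, a, b', c')"
    and b': "b' \<in> Poly_Mapping.keys (bdry_map (bdry W) (bdry (W - {e})) b)"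
    and c': "c' \<in> Poly_Mapping.keys (genus_map (genus (subfat F W)) (genus (subfat F (W - {e}))) c)"
    unfolding x' edge_map_eq using keys_gen_tensor by fast
  have "b' \<in> bdry_targets (bdry W) (bdry (W - {e})) b"
    using b' keys_sum_frag_of[OF finite_bdry_targets[OF finite_bdry]]
    unfolding bdry_map_eq[OF finite_bdry finite_bdry card_bdry_step[OF W e, folded bdry_step_def]]
    by blast
  then have b'': "b' \<in> tensors (bdry (W - {e}))" "tdeg (bdry (W - {e})) b' = tdeg (bdry W) b - 1"
    by (simp_all add: bdry_targets_def)
  note c'' = keys_genus_map[OF c genus_remove[OF W e] c']
  show "y \<in> state_basis F (W - {e})" using a b'' c'' by (simp add: state_basis_def y' vs)
  show "gen_deg F y = gen_deg F x"
    using b'' c'' height_remove[OF W e] by (simp add: x' y' vs)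
qed

end

section \<open>Signs and the square of the differential\<close>

locale numbered_fatgraph = fatgraph_loc F for F :: "('v, 'h) fatgraph" +
  fixes \<nu> :: "nat \<Rightarrow> 'h set"
  assumes numbering: "bij_betw \<nu> {1..num_edges F} (edges F)"
begin

definition present :: "'h set set \<Rightarrow> nat set" where
  "present W = {j \<in> {1..num_edges F}. \<nu> j \<in> W}"

definition edge_sign :: "'h set set \<Rightarrow> nat \<Rightarrow> int" where
  "edge_sign W j = (-1) ^ (\<Sum>i \<in> {1..<j}. if \<nu> i \<in> W then 0 else 1)"

lemma finite_present: "finite (present W)"
  by (simp add: present_def)

lemma inj_numbering: "\<lbrakk>i \<in> {1..num_edges F}; j \<in> {1..num_edges F}; \<nu> i = \<nu> j\<rbrakk> \<Longrightarrow> i = j"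
  using numbering by (auto simp: bij_betw_def dest: inj_onD)

lemma differential_of:
  "differential F \<nu> (frag_of x) =
     (\<Sum>j\<in>present (fst x). frag_cmul (edge_sign (fst x) j) (edge_map F (\<nu> j) x))"
  by (simp add: differential_def present_def edge_sign_def)

text \<open>On chains supported at one state, the signs and the set of removable edges are constant
  and can be taken out of the linear extension.\<close>

lemma differential_state:
  assumes "\<And>y. y \<in> Poly_Mapping.keys x \<Longrightarrow> fst y = W"
  shows "differential F \<nu> x =
    (\<Sum>j\<in>present W. frag_cmul (edge_sign W j) (frag_extend (edge_map F (\<nu> j)) x))"
proof -
  have "differential F \<nu> x = frag_extend (\<lambda>y. \<Sum>j\<in>present W. frag_cmul (edge_sign W j) (edge_map F (\<nu> j) y)) x"
    unfolding differential_def present_def edge_sign_def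
    by (rule frag_extend_eq) (simp add: assms)
  then show ?thesis by (simp add: frag_extend_sum_fun[OF finite_present] frag_extend_cmul_fun)
qed

lemma differential_add: "differential F \<nu> (x + y) = differential F \<nu> x + differential F \<nu> y"
  and differential_diff: "differential F \<nu> (x - y) = differential F \<nu> x - differential F \<nu> y"
  and differential_0: "differential F \<nu> 0 = 0"
  by (simp_all add: differential_def frag_extend_add frag_extend_diff)

lemma present_remove: "j \<in> present W \<Longrightarrow> present (W - {\<nu> j}) = present W - {j}"
  using inj_numbering by (auto simp: present_def)

lemma edge_sign_remove:
  assumes "j \<in> present W" "k \<in> present W" "j \<noteq> k"
  shows "edge_sign (W - {\<nu> j}) k = (if j < k then - edge_sign W k else edge_sign W k)"
proof -
  have j: "j \<in> {1..num_edges F}" "\<nu> j \<in> W" and k: "k \<in> {1..num_edges F}"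
    using assms by (auto simp: present_def)
  have eq: "(\<nu> i \<in> W - {\<nu> j}) = (\<nu> i \<in> W \<and> i \<noteq> j)" if "i \<in> {1..<k}" for i
    using that k inj_numbering[of i j] j by auto
  have "(\<Sum>i\<in>{1..<k}. if \<nu> i \<in> W - {\<nu> j} then 0 else 1 :: nat)
      = (\<Sum>i\<in>{1..<k}. (if \<nu> i \<in> W then 0 else 1) + (if i = j then 1 else 0))"
    by (intro sum.cong refl) (use eq j in auto)
  also have "\<dots> = (\<Sum>i\<in>{1..<k}. if \<nu> i \<in> W then 0 else 1) + (if j < k then 1 else 0)"
    using j by (simp add: sum.distrib)
  finally show ?thesis by (simp add: edge_sign_def)
qed

text \<open>By linearity a generator suffices. Its terms are indexed by ordered pairs of distinct
  present edges; the unsigned maps commute, while removing \<open>j\<close> before \<open>k\<close>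
  alters the sign of \<open>k\<close> only for \<open>j < k\<close>, so the two orders carry
  opposite signs.\<close>

theorem differential_differential:
  assumes "\<And>x. x \<in> Poly_Mapping.keys y \<Longrightarrow> fst x \<subseteq> edges F"
  shows "differential F \<nu> (differential F \<nu> y) = 0"
proof -
  have gen: "differential F \<nu> (differential F \<nu> (frag_of x)) = 0" if x: "fst x \<subseteq> edges F" for x
  proof -
    define W where "W = fst x"
    have W: "W \<subseteq> edges F" using x by (simp add: W_def)
    obtain z where xz: "x = (W, z)" by (metis W_def prod.collapse)
    define t where "t j k = frag_cmul (edge_sign W j * edge_sign (W - {\<nu> j}) k)
      (frag_extend (edge_map F (\<nu> k)) (edge_map F (\<nu> j) x))" for j k
    have inner: "differential F \<nu> (edge_map F (\<nu> j) x)
        = (\<Sum>k\<in>present W - {j}. frag_cmul (edge_sign (W - {\<nu> j}) k)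
            (frag_extend (edge_map F (\<nu> k)) (edge_map F (\<nu> j) x)))"
      if j: "j \<in> present W" for j
    proof -
      obtain a b c where z: "z = (a, b, c)" by (cases z) auto
      have "fst y = W - {\<nu> j}" if "y \<in> Poly_Mapping.keys (edge_map F (\<nu> j) x)" for y
        using that keys_gen_tensor unfolding xz z edge_map_eq by fastforce
      from differential_state[OF this] show ?thesis unfolding present_remove[OF j] .
    qed
    have "differential F \<nu> (differential F \<nu> (frag_of x))
        = (\<Sum>j\<in>present W. frag_cmul (edge_sign W j) (differential F \<nu> (edge_map F (\<nu> j) x)))"
      unfolding differential_of W_def[symmetric]
      by (simp add: differential_def frag_extend_sum[OF finite_present] frag_extend_cmul o_def)
    also have "\<dots> = (\<Sum>j\<in>present W. \<Sum>k\<in>present W - {j}. t j k)"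
      by (intro sum.cong refl) (simp add: inner frag_cmul_sum t_def)
    also have "\<dots> = 0"
    proof (rule antisymmetric_sum_zero[OF finite_present])
      fix j k assume jk: "j \<in> present W" "k \<in> present W" "j \<noteq> k"
      then have e: "\<nu> j \<in> W" "\<nu> k \<in> W" "\<nu> k \<noteq> \<nu> j"
        using inj_numbering[of k j] by (auto simp: present_def)
      have "edge_sign W j * edge_sign (W - {\<nu> j}) k = - (edge_sign W k * edge_sign (W - {\<nu> k}) j)"
        unfolding edge_sign_remove[OF jk] edge_sign_remove[OF jk(2,1) jk(3)[symmetric]]
        using jk(3) by (cases "j < k") simp_all
      then show "t j k = - t k j"
        unfolding t_def xz edge_maps_commute[OF W e] minus_frag_cmul by (simp only:)
    qed
    finally show ?thesis .
  qed
  have "differential F \<nu> (differential F \<nu> y)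
      = frag_extend (\<lambda>x. differential F \<nu> (differential F \<nu> (frag_of x))) y"
    by (simp add: differential_def frag_extend_extend)
  also have "\<dots> = 0" by (rule frag_extend_eq_0) (use gen assms in blast)
  finally show ?thesis .
qed

end


section \<open>Graded Euler characteristics\<close>

text \<open>Each factor contributes \<open>fls_X\<close> for \<open>Plus\<close> and
  \<open>fls_X_inv\<close> for \<open>Minus\<close>; expanding the product of these sums runs
  through all basis tensors.\<close>

lemma sum_tensors:
  assumes "finite I"
  shows "(\<Sum>t\<in>tensors I. fls_X_intpow (tdeg I t)) = (fls_X + fls_X_inv :: int fls) ^ card I"
proof -
  have UN: "(UNIV :: sign set) = {Plus, Minus}" using sign.exhaust by auto
  have pw: "fls_X_intpow (\<Sum>i\<in>A. f i) = (\<Prod>i\<in>A. fls_X_intpow (f i) :: int fls)"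
    if "finite A" for A and f :: "'a \<Rightarrow> int"
    using that
  proof induction
    case (insert i A)
    show ?case
      unfolding sum.insert[OF insert.hyps] prod.insert[OF insert.hyps] insert.IH[symmetric]
        fls_X_intpow_times_fls_X_intpow ..
  qed simp
  have "(\<Sum>t\<in>tensors I. fls_X_intpow (tdeg I t))
      = (\<Sum>t\<in>tensors I. \<Prod>i\<in>I. fls_X_intpow (sdeg (t i)) :: int fls)"
    unfolding tdeg_def pw[OF assms] ..
  also have "\<dots> = (\<Prod>i\<in>I. \<Sum>s\<in>UNIV. fls_X_intpow (sdeg s))"
    unfolding tensors_def
    by (rule prod_sum_PiE[symmetric, OF assms, of "\<lambda>_. UNIV" "\<lambda>_ s. fls_X_intpow (sdeg s)"])
      (rule finite_sign_set)
  also have "(\<Sum>s\<in>UNIV. fls_X_intpow (sdeg s) :: int fls) = fls_X + fls_X_inv"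
    unfolding UN by (simp add: fls_X_conv_shift_1 fls_X_inv_conv_shift_1)
  finally show ?thesis by simp
qed

lemma comm_group_frags:
  assumes "0 \<in> A" "\<And>x y. \<lbrakk>x \<in> A; y \<in> A\<rbrakk> \<Longrightarrow> x - y \<in> A"
  shows "comm_group \<lparr>carrier = A, monoid.mult = (+), one = (0 :: 'a \<Rightarrow>\<^sub>0 int)\<rparr>"
proof -
  have neg: "- x \<in> A" if "x \<in> A" for x using assms(2)[OF assms(1) that] by simp
  have add: "x + y \<in> A" if "x \<in> A" "y \<in> A" for x y using assms(2)[OF that(1) neg[OF that(2)]] by simp
  show ?thesis
  proof (rule comm_groupI)
    fix x assume "x \<in> carrier \<lparr>carrier = A, monoid.mult = (+), one = (0 :: 'a \<Rightarrow>\<^sub>0 int)\<rparr>"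
    then show "\<exists>y\<in>carrier \<lparr>carrier = A, monoid.mult = (+), one = (0 :: 'a \<Rightarrow>\<^sub>0 int)\<rparr>.
      y \<otimes>\<^bsub>\<lparr>carrier = A, monoid.mult = (+), one = (0 :: 'a \<Rightarrow>\<^sub>0 int)\<rparr>\<^esub> x
      = \<one>\<^bsub>\<lparr>carrier = A, monoid.mult = (+), one = (0 :: 'a \<Rightarrow>\<^sub>0 int)\<rparr>\<^esub>"
      using neg by (intro bexI[of _ "- x"]) simp_all
  qed (use assms(1) add in \<open>simp_all add: ac_simps\<close>)
qed

text \<open>The quotient formula is applied to \<open>d\<close> on \<open>A\<close>, and then to the
  identity on the image with kernel zero; the second application identifies the
  \<open>abelian_rank\<close> of the image with its \<open>frag_rank\<close>.\<close>

theorem frag_rank_nullity: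
  fixes d :: "('a \<Rightarrow>\<^sub>0 int) \<Rightarrow> ('b \<Rightarrow>\<^sub>0 int)"
  assumes S: "finite S" "\<And>x. x \<in> A \<Longrightarrow> Poly_Mapping.keys x \<subseteq> S"
    and T: "finite T" "\<And>x. x \<in> A \<Longrightarrow> Poly_Mapping.keys (d x) \<subseteq> T"
    and A: "0 \<in> A" "\<And>x y. \<lbrakk>x \<in> A; y \<in> A\<rbrakk> \<Longrightarrow> x - y \<in> A"
    and d: "\<And>x y. d (x + y) = d x + d y"
  shows "frag_rank (d ` A) + frag_rank {x \<in> A. d x = 0} = frag_rank A"
proof -
  let ?G = "\<lparr>carrier = d ` A, monoid.mult = (+), one = 0\<rparr>"
  have d0: "d 0 = 0" using d[of 0 0] by simp
  have dd: "d (x - y) = d x - d y" for x y using d[of "x - y" y] by simp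
  have im: "0 \<in> d ` A" "\<And>x y. \<lbrakk>x \<in> d ` A; y \<in> d ` A\<rbrakk> \<Longrightarrow> x - y \<in> d ` A"
    using A d0 dd by (metis imageI, metis (no_types, lifting) imageE imageI)
  have G: "comm_group ?G" by (rule comm_group_frags[OF im])
  interpret src: frag_quotient ?G A d S
    by (rule frag_quotient.intro[OF G], unfold_locales) (use S A d in auto)
  interpret tgt: frag_quotient ?G "d ` A" "\<lambda>x. x" T
    by (rule frag_quotient.intro[OF G], unfold_locales) (use T im in auto)
  have "src.ker = {x \<in> A. d x = 0}" "tgt.ker = {0}"
    using im by (auto simp: src.ker_def tgt.ker_def)
  then show ?thesis using src.rank_quotient tgt.rank_quotient by (simp add: frag_rank_zero)
qed

context fatgraph_loc
begin

definition basis :: "int \<Rightarrow> ('v, 'h) gen set" where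
  "basis h = (\<Union>W \<in> {W \<in> states F. height F W = h}. state_basis F W)"

definition basis_deg :: "int \<Rightarrow> int \<Rightarrow> ('v, 'h) gen set" where
  "basis_deg h m = {x \<in> basis h. gen_deg F x = m}"

lemma finite_states: "finite (states F)"
  using finite_edges by (simp add: states_def)

lemma finite_state_basis: "finite (state_basis F W)"
proof -
  have "finite (verts (subfat F W))" using finite_verts by (simp add: subfat_def)
  then show ?thesis unfolding state_basis_def
    by (intro finite_cartesian_product finite_tensors finite_bdry) auto
qed

lemma finite_basis: "finite (basis h)"
  unfolding basis_def using finite_states finite_state_basis by auto

lemma finite_basis_deg: "finite (basis_deg h m)"
  using finite_basis[of h] by (simp add: basis_deg_def)

lemma chain_group_eq: "chain_group F h = free_Abelian_group (basis h)"
  by (simp add: chain_group_def basis_def)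

lemma basisD:
  assumes "x \<in> basis h"
  shows "fst x \<subseteq> edges F" "x \<in> state_basis F (fst x)" "height F (fst x) = h"
proof -
  obtain W where W: "W \<in> states F" "height F W = h" "x \<in> state_basis F W"
    using assms by (auto simp: basis_def)
  then have "fst x = W" by (auto simp: state_basis_def)
  with W show "fst x \<subseteq> edges F" "x \<in> state_basis F (fst x)" "height F (fst x) = h"
    by (simp_all add: states_def)
qed

text \<open>Basis elements are triples and their degree is additive, so the sum is a product over
  the three tensor powers.\<close>

lemma sum_state_basis:
  "(\<Sum>x\<in>state_basis F W. fls_X_intpow (gen_deg F x))
   = fls_X_intpow (height F W) * (fls_X + fls_X_inv :: int fls) ^
      (num_verts (subfat F W) + num_bdry (subfat F W) + 2 * genus (subfat F W))"
proof -
  let ?V = "verts (subfat F W)" and ?G = "{..<2 * genus (subfat F W)}"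
  have fV: "finite ?V" using finite_verts by (simp add: subfat_def)
  have X: "fls_X_intpow (gen_deg F (W, a, b, c)) = fls_X_intpow (height F W) *
      (fls_X_intpow (tdeg ?V a) * (fls_X_intpow (tdeg (bdry W) b) * fls_X_intpow (tdeg ?G c)) :: int fls)"
    for a b c
    unfolding gen_deg.simps fls_X_intpow_times_fls_X_intpow by (simp add: algebra_simps)
  have "(\<Sum>x\<in>state_basis F W. fls_X_intpow (gen_deg F x) :: int fls)
      = (\<Sum>a\<in>tensors ?V. \<Sum>b\<in>tensors (bdry W). \<Sum>c\<in>tensors ?G. fls_X_intpow (gen_deg F (W, a, b, c)))"
    unfolding state_basis_def by (simp only: sum.cartesian_product' sum.insert[OF finite.emptyI] sum.empty
      empty_iff not_False_eq_True add_0_right)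
  also have "\<dots> = fls_X_intpow (height F W) * ((\<Sum>a\<in>tensors ?V. fls_X_intpow (tdeg ?V a))
      * ((\<Sum>b\<in>tensors (bdry W). fls_X_intpow (tdeg (bdry W) b)) * (\<Sum>c\<in>tensors ?G. fls_X_intpow (tdeg ?G c))))"
    unfolding X sum_distrib_left[symmetric] sum_distrib_right[symmetric] ..
  also have "\<dots> = fls_X_intpow (height F W) * (fls_X + fls_X_inv) ^
      (num_verts (subfat F W) + num_bdry (subfat F W) + 2 * genus (subfat F W))"
    unfolding sum_tensors[OF fV] sum_tensors[OF finite_bdry] sum_tensors[OF finite_lessThan]
    by (simp add: num_verts_def num_bdry_def power_add mult.assoc)
  finally show ?thesis .
qed

end

section \<open>Homogeneous chains, cycles and homology classes\<close>

context numbered_fatgraph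
begin

abbreviation d :: "(('v, 'h) gen \<Rightarrow>\<^sub>0 int) \<Rightarrow> (('v, 'h) gen \<Rightarrow>\<^sub>0 int)" where
  "d \<equiv> differential F \<nu>"

definition chains :: "int \<Rightarrow> int \<Rightarrow> (('v, 'h) gen \<Rightarrow>\<^sub>0 int) set" where
  "chains h m = {x. Poly_Mapping.keys x \<subseteq> basis_deg h m}"

lemma chains_iff: "x \<in> chains h m \<longleftrightarrow> Poly_Mapping.keys x \<subseteq> basis h \<and> homogeneous F m x"
  by (auto simp: chains_def basis_deg_def homogeneous_def)

lemma zero_chains: "0 \<in> chains h m"
  by (simp add: chains_def)

lemma diff_chains: "\<lbrakk>x \<in> chains h m; y \<in> chains h m\<rbrakk> \<Longrightarrow> x - y \<in> chains h m"
  unfolding chains_def using keys_diff[of x y] by blast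

lemma differential_of_keys:
  assumes x: "x \<in> basis h" and y: "y \<in> Poly_Mapping.keys (d (frag_of x))"
  shows "y \<in> basis (h + 1)" "gen_deg F y = gen_deg F x"
proof -
  note x' = basisD[OF x]
  have "Poly_Mapping.keys (d (frag_of x)) \<subseteq> (\<Union>j\<in>present (fst x).
      Poly_Mapping.keys (frag_cmul (edge_sign (fst x) j) (edge_map F (\<nu> j) x)))"
    unfolding differential_of by (rule keys_sum)
  with y obtain j where j: "j \<in> present (fst x)"
    and "y \<in> Poly_Mapping.keys (frag_cmul (edge_sign (fst x) j) (edge_map F (\<nu> j) x))"
    by blast
  then have y': "y \<in> Poly_Mapping.keys (edge_map F (\<nu> j) x)" by simp
  have j': "\<nu> j \<in> fst x" using j by (simp add: present_def)
  note k = edge_map_keys[OF x'(1) j' x'(2) y']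
  show "gen_deg F y = gen_deg F x" by (rule k(2))
  have "fst x - {\<nu> j} \<in> states F" using x'(1) by (auto simp: states_def)
  moreover have "height F (fst x - {\<nu> j}) = h + 1" using height_remove[OF x'(1) j'] x'(3) by simp
  ultimately show "y \<in> basis (h + 1)" unfolding basis_def using k(1) by blast
qed

lemma differential_keys:
  assumes x: "Poly_Mapping.keys x \<subseteq> basis h" and y: "y \<in> Poly_Mapping.keys (d x)"
  shows "y \<in> basis (h + 1)" "\<exists>z\<in>Poly_Mapping.keys x. gen_deg F y = gen_deg F z"
proof -
  have "d x = frag_extend (\<lambda>z. d (frag_of z)) x"
    by (simp add: differential_def)
  then obtain z where z: "z \<in> Poly_Mapping.keys x" "y \<in> Poly_Mapping.keys (d (frag_of z))"
    using y keys_frag_extend[of "\<lambda>z. d (frag_of z)" x] by auto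
  then have "z \<in> basis h" using x by blast
  from differential_of_keys[OF this z(2)] z(1)
  show "y \<in> basis (h + 1)" "\<exists>z\<in>Poly_Mapping.keys x. gen_deg F y = gen_deg F z" by blast+
qed

lemma d_chains:
  assumes "x \<in> chains h m"
  shows "d x \<in> chains (h + 1) m"
proof -
  have x: "Poly_Mapping.keys x \<subseteq> basis h" "\<And>z. z \<in> Poly_Mapping.keys x \<Longrightarrow> gen_deg F z = m"
    using assms by (auto simp: chains_def basis_deg_def)
  have "y \<in> basis_deg (h + 1) m" if y: "y \<in> Poly_Mapping.keys (d x)" for y
  proof -
    obtain z where "z \<in> Poly_Mapping.keys x" "gen_deg F y = gen_deg F z"
      using differential_keys(2)[OF x(1) y] by blast
    then show ?thesis using differential_keys(1)[OF x(1) y] x(2) by (simp add: basis_deg_def)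
  qed
  then show ?thesis by (auto simp: chains_def)
qed

lemma d_d_chain: "Poly_Mapping.keys x \<subseteq> basis h \<Longrightarrow> d (d x) = 0"
  by (rule differential_differential) (use basisD(1) in blast)

text \<open>Split \<open>y\<close> into its part \<open>y'\<close> of degree \<open>m\<close> and
  the rest \<open>y''\<close>. Since \<open>d\<close> preserves degrees, \<open>d y''\<close> has no
  generator of degree \<open>m\<close>; but it equals \<open>d y - d y'\<close>, which has no
  others. So it vanishes.\<close>

lemma homogeneous_boundary:
  assumes y: "Poly_Mapping.keys y \<subseteq> basis h" and hom: "homogeneous F m (d y)"
  shows "d y \<in> d ` chains h m"
proof -
  define y' where "y' = frag_extend (\<lambda>k. if gen_deg F k = m then frag_of k else 0) y"
  define y'' where "y'' = frag_extend (\<lambda>k. if gen_deg F k = m then 0 else frag_of k) y"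
  have sum: "y = y' + y''"
  proof -
    have "y = frag_extend frag_of y" by (rule frag_expansion)
    also have "\<dots> = y' + y''"
      unfolding y'_def y''_def frag_extend_def sum.distrib[symmetric]
      by (intro sum.cong refl) simp
    finally show ?thesis .
  qed
  have k': "Poly_Mapping.keys y' \<subseteq> basis_deg h m"
  proof
    fix k assume "k \<in> Poly_Mapping.keys y'"
    then obtain l where "l \<in> Poly_Mapping.keys y"
      "k \<in> Poly_Mapping.keys (if gen_deg F l = m then frag_of l else 0)"
      unfolding y'_def using keys_frag_extend by fast
    then show "k \<in> basis_deg h m" using y by (auto simp: basis_deg_def split: if_splits)
  qed
  have k'': "Poly_Mapping.keys y'' \<subseteq> {k \<in> basis h. gen_deg F k \<noteq> m}"
  proof
    fix k assume "k \<in> Poly_Mapping.keys y''"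
    then obtain l where "l \<in> Poly_Mapping.keys y"
      "k \<in> Poly_Mapping.keys (if gen_deg F l = m then 0 else frag_of l)"
      unfolding y''_def using keys_frag_extend by fast
    then show "k \<in> {k \<in> basis h. gen_deg F k \<noteq> m}" using y by (auto split: if_splits)
  qed
  have y'c: "y' \<in> chains h m" using k' by (simp add: chains_def)
  have dy'': "d y'' = d y - d y'" using differential_add[of y' y''] sum by simp
  have "Poly_Mapping.keys (d y'') = {}"
  proof (rule equals0I)
    fix k assume k: "k \<in> Poly_Mapping.keys (d y'')"
    have kb: "Poly_Mapping.keys y'' \<subseteq> basis h" using k'' by blast
    have "gen_deg F k \<noteq> m" using differential_keys(2)[OF kb k] k'' by auto
    moreover have "k \<in> Poly_Mapping.keys (d y) \<union> Poly_Mapping.keys (d y')"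
      using k keys_diff[of "d y" "d y'"] unfolding dy'' by blast
    then have "gen_deg F k = m"
      using hom d_chains[OF y'c] by (auto simp: homogeneous_def chains_def basis_deg_def)
    ultimately show False by simp
  qed
  then have "d y'' = 0" by simp
  then have "d y = d y'" using dy'' by simp
  then show ?thesis using y'c by blast
qed

definition cycles_deg :: "int \<Rightarrow> int \<Rightarrow> (('v, 'h) gen \<Rightarrow>\<^sub>0 int) set" where
  "cycles_deg h m = {x \<in> chains h m. d x = 0}"

lemma cycles_eq: "cycles F \<nu> h = {x. Poly_Mapping.keys x \<subseteq> basis h \<and> d x = 0}"
  by (simp add: cycles_def kernel_def chain_group_eq)

lemma boundaries_eq: "boundaries F \<nu> h = d ` {x. Poly_Mapping.keys x \<subseteq> basis (h - 1)}"
  by (simp add: boundaries_def chain_group_eq free_Abelian_group_def)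

lemma cycles_deg_eq: "{x \<in> cycles F \<nu> h. homogeneous F m x} = cycles_deg h m"
  by (auto simp: cycles_eq cycles_deg_def chains_iff)

lemma subgroup_cycles: "subgroup (cycles F \<nu> h) (chain_group F h)"
proof
  fix x y assume xy: "x \<in> cycles F \<nu> h" "y \<in> cycles F \<nu> h"
  show "x \<otimes>\<^bsub>chain_group F h\<^esub> y \<in> cycles F \<nu> h"
    using xy keys_add[of x y] unfolding chain_group_eq cycles_eq by (auto simp: differential_add)
next
  fix x assume x: "x \<in> cycles F \<nu> h"
  then show "inv\<^bsub>chain_group F h\<^esub> x \<in> cycles F \<nu> h"
    using differential_diff[of 0 x] unfolding chain_group_eq cycles_eq by (simp add: differential_0)
qed (auto simp: chain_group_eq cycles_eq differential_0)

lemma cycle_group_simps: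
  "carrier (cycle_group F \<nu> h) = cycles F \<nu> h"
  "x \<otimes>\<^bsub>cycle_group F \<nu> h\<^esub> y = x + y" "\<one>\<^bsub>cycle_group F \<nu> h\<^esub> = 0"
  using subgroup.carrier_subgroup_generated_subgroup[OF subgroup_cycles]
  by (simp_all add: cycle_group_def chain_group_eq)

lemma comm_group_cycle_group: "comm_group (cycle_group F \<nu> h)"
  unfolding cycle_group_def chain_group_eq
  by (rule group.abelian_subgroup_generated[OF group_free_Abelian_group abelian_free_Abelian_group])

lemma inv_cycle_group: "x \<in> cycles F \<nu> h \<Longrightarrow> inv\<^bsub>cycle_group F \<nu> h\<^esub> x = - x"
proof -
  assume x: "x \<in> cycles F \<nu> h"
  interpret comm_group "cycle_group F \<nu> h" by (rule comm_group_cycle_group)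
  have "- x \<in> cycles F \<nu> h" using x differential_diff[of 0 x] by (simp add: cycles_eq differential_0)
  then show ?thesis using x by (intro inv_equality) (simp_all add: cycle_group_simps)
qed

lemma subgroup_boundaries: "subgroup (boundaries F \<nu> h) (cycle_group F \<nu> h)"
proof -
  have sub: "boundaries F \<nu> h \<subseteq> cycles F \<nu> h"
  proof
    fix x assume "x \<in> boundaries F \<nu> h"
    then obtain y where y: "Poly_Mapping.keys y \<subseteq> basis (h - 1)" "x = d y"
      by (auto simp: boundaries_eq)
    have "Poly_Mapping.keys x \<subseteq> basis h"
      using differential_keys(1)[OF y(1)] y(2) by auto
    then show "x \<in> cycles F \<nu> h" using d_d_chain[OF y(1)] y(2) by (simp add: cycles_eq)
  qed
  show ?thesis
  proof
    show "boundaries F \<nu> h \<subseteq> carrier (cycle_group F \<nu> h)" by (simp add: cycle_group_simps sub)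
    fix x y assume "x \<in> boundaries F \<nu> h" "y \<in> boundaries F \<nu> h"
    then obtain x' y' where "Poly_Mapping.keys x' \<subseteq> basis (h - 1)" "x = d x'"
      "Poly_Mapping.keys y' \<subseteq> basis (h - 1)" "y = d y'"
      by (auto simp: boundaries_eq)
    then show "x \<otimes>\<^bsub>cycle_group F \<nu> h\<^esub> y \<in> boundaries F \<nu> h"
      using keys_add[of x' y'] unfolding cycle_group_simps boundaries_eq
      by (intro image_eqI[of _ _ "x' + y'"]) (auto simp: differential_add)
  next
    show "\<one>\<^bsub>cycle_group F \<nu> h\<^esub> \<in> boundaries F \<nu> h"
      unfolding cycle_group_simps boundaries_eq
      by (intro image_eqI[of _ _ 0]) (auto simp: differential_0)
  next
    fix x assume x: "x \<in> boundaries F \<nu> h"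
    then obtain x' where "Poly_Mapping.keys x' \<subseteq> basis (h - 1)" "x = d x'"
      by (auto simp: boundaries_eq)
    then have "- x \<in> boundaries F \<nu> h"
      using differential_diff[of 0 x'] unfolding boundaries_eq
      by (intro image_eqI[of _ _ "- x'"]) (auto simp: differential_0)
    then show "inv\<^bsub>cycle_group F \<nu> h\<^esub> x \<in> boundaries F \<nu> h"
      using inv_cycle_group sub x by (simp add: subset_iff)
  qed
qed

text \<open>The coset map sends the homogeneous cycles onto this piece of the homology. Its kernel
  consists of the homogeneous cycles that are boundaries, and \<open>homogeneous_boundary\<close>
  makes these the images of homogeneous chains.\<close>

theorem rank_homology_deg:
  "abelian_rank (homology_deg F \<nu> h m) + frag_rank (d ` chains (h - 1) m) = frag_rank (cycles_deg h m)"
proof -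
  let ?Z = "cycle_group F \<nu> h" and ?B = "boundaries F \<nu> h"
  let ?q = "\<lambda>x. ?B #>\<^bsub>?Z\<^esub> x"
  interpret Z: comm_group ?Z by (rule comm_group_cycle_group)
  have normal: "?B \<lhd> ?Z" using subgroup_boundaries Z.subgroup_imp_normal by blast
  interpret normal ?B ?Z by (rule normal)
  have H: "comm_group (homology F \<nu> h)"
    unfolding homology_def by (rule Z.abelian_FactGroup[OF subgroup_boundaries])
  interpret H: comm_group "homology F \<nu> h" by (rule H)
  have hom: "?q \<in> hom ?Z (homology F \<nu> h)"
    unfolding homology_def by (rule r_coset_hom_Mod)
  have sub: "cycles_deg h m \<subseteq> cycles F \<nu> h" unfolding cycles_deg_eq[symmetric] by blast
  have zero: "0 \<in> cycles_deg h m" by (simp add: cycles_deg_def zero_chains differential_0)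
  have diff: "x - y \<in> cycles_deg h m" if "x \<in> cycles_deg h m" "y \<in> cycles_deg h m" for x y
    using that diff_chains by (simp add: cycles_deg_def differential_diff)
  have neg: "- x \<in> cycles_deg h m" if "x \<in> cycles_deg h m" for x
    using diff[OF zero that] by simp
  have add: "x + y \<in> cycles_deg h m" if "x \<in> cycles_deg h m" "y \<in> cycles_deg h m" for x y
    using diff[OF that(1) neg[OF that(2)]] by simp
  have sgZ: "subgroup (cycles_deg h m) ?Z"
    by unfold_locales
      (use sub zero add neg inv_cycle_group in \<open>auto simp: cycle_group_simps subset_iff\<close>)
  interpret q: group_hom ?Z "homology F \<nu> h" ?q
    by (rule group_hom.intro[OF Z.is_group H.is_group], unfold_locales, rule hom)
  \<comment> \<open>The classes of homogeneous cycles already form a subgroup, so generating adds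
    nothing to them.\<close>
  have sgH: "subgroup (?q ` cycles_deg h m) (homology F \<nu> h)"
    by (rule q.subgroup_img_is_subgroup[OF sgZ])
  have def: "homology_deg F \<nu> h m = subgroup_generated (homology F \<nu> h) (?q ` cycles_deg h m)"
    unfolding homology_deg_def cycles_deg_eq ..
  have carr: "carrier (homology_deg F \<nu> h m) = ?q ` cycles_deg h m"
    unfolding def by (rule subgroup.carrier_subgroup_generated_subgroup[OF sgH])
  interpret R: frag_quotient "homology_deg F \<nu> h m" "cycles_deg h m" ?q "basis_deg h m"
  proof (rule frag_quotient.intro)
    show "comm_group (homology_deg F \<nu> h m)"
      unfolding def by (rule H.abelian_subgroup_generated[OF H])
    show "frag_quotient_axioms (homology_deg F \<nu> h m) (cycles_deg h m) ?q (basis_deg h m)"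
    proof
      fix x y assume xy: "x \<in> cycles_deg h m" "y \<in> cycles_deg h m"
      then show "x - y \<in> cycles_deg h m" by (rule diff)
      have "?q (x \<otimes>\<^bsub>?Z\<^esub> y) = ?q x \<otimes>\<^bsub>homology F \<nu> h\<^esub> ?q y"
        using xy sub by (intro q.hom_mult) (auto simp: cycle_group_simps)
      then show "?q (x + y) = ?q x \<otimes>\<^bsub>homology_deg F \<nu> h m\<^esub> ?q y"
        by (simp add: cycle_group_simps def)
    qed (use finite_basis_deg zero carr in \<open>auto simp: cycles_deg_def chains_def\<close>)
  qed
  have "R.ker = d ` chains (h - 1) m"
  proof
    have one: "\<one>\<^bsub>homology_deg F \<nu> h m\<^esub> = ?B" by (simp add: def homology_def)
    show "R.ker \<subseteq> d ` chains (h - 1) m"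
    proof
      fix x assume "x \<in> R.ker"
      then have x: "x \<in> cycles_deg h m" "?q x = ?B" by (auto simp: R.ker_def one)
      then have "x \<in> ?B"
        using Z.coset_join1[OF x(2) _ subgroup_boundaries] sub by (auto simp: cycle_group_simps)
      then obtain y where y: "Poly_Mapping.keys y \<subseteq> basis (h - 1)" "x = d y"
        by (auto simp: boundaries_eq)
      moreover have "homogeneous F m x" using x(1) by (simp add: cycles_deg_def chains_iff)
      ultimately show "x \<in> d ` chains (h - 1) m" using homogeneous_boundary by blast
    qed
    show "d ` chains (h - 1) m \<subseteq> R.ker"
    proof (rule image_subsetI)
      fix y assume y: "y \<in> chains (h - 1) m"
      then have ky: "Poly_Mapping.keys y \<subseteq> basis (h - 1)" by (simp add: chains_iff)
      have "d y \<in> cycles_deg h m"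
        using d_chains[OF y] d_d_chain[OF ky] by (simp add: cycles_deg_def)
      moreover have "d y \<in> ?B" using ky by (auto simp: boundaries_eq)
      ultimately show "d y \<in> R.ker"
        using Z.coset_join2[OF _ subgroup_boundaries, of "d y"] sub
        by (auto simp: R.ker_def one cycle_group_simps)
    qed
  qed
  then show ?thesis using R.rank_quotient by simp
qed

section \<open>Alternating sums of ranks over all heights\<close>

lemma rank_chains:
  "frag_rank (d ` chains h m) + frag_rank (cycles_deg h m) = card (basis_deg h m)"
proof -
  have "frag_rank (d ` chains h m) + frag_rank {x \<in> chains h m. d x = 0} = frag_rank (chains h m)"
  proof (rule frag_rank_nullity[where S = "basis_deg h m" and T = "basis_deg (h + 1) m"])
    fix x assume "x \<in> chains h m"
    then show "Poly_Mapping.keys (d x) \<subseteq> basis_deg (h + 1) m"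
      using d_chains unfolding chains_def by blast
  qed (use finite_basis_deg zero_chains diff_chains differential_add in \<open>auto simp: chains_def\<close>)
  then show ?thesis unfolding cycles_deg_def chains_def frag_rank_free[OF finite_basis_deg] .
qed

text \<open>There are no generators of negative height. From height \<open>num_edges F\<close> on,
  only the state without edges can occur, and there the differential is an empty sum.\<close>

lemma boundary_rank_outside:
  assumes "h < 0 \<or> h \<ge> int (num_edges F)"
  shows "frag_rank (d ` chains h m) = 0"
proof -
  have "d x = 0" if x: "x \<in> chains h m" for x
  proof -
    have "frag_extend (\<lambda>z. d (frag_of z)) x = 0"
    proof (rule frag_extend_eq_0)
      fix z assume "z \<in> Poly_Mapping.keys x"
      then have z: "z \<in> basis h" using x by (auto simp: chains_def basis_deg_def)
      note z' = basisD[OF z]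
      have "card (fst z) \<le> num_edges F"
        unfolding num_edges_def by (rule card_mono[OF finite_edges z'(1)])
      then have "card (fst z) = 0" using z'(3) assms height_eq[OF z'(1)] by auto
      moreover have "finite (fst z)" by (rule finite_subset[OF z'(1) finite_edges])
      ultimately have "present (fst z) = {}" by (simp add: present_def)
      then show "d (frag_of z) = 0" by (simp add: differential_of)
    qed
    then show ?thesis by (simp add: differential_def)
  qed
  then have "d ` chains h m = {0}" using zero_chains by force
  then show ?thesis by (simp add: frag_rank_zero)
qed

text \<open>A homology rank is the chain rank minus the ranks of the outgoing and the incoming
  differential. Each differential is counted at two adjacent heights with opposite signs.\<close>

lemma alternating_rank_sum:
  "(\<Sum>h\<le>num_edges F. (-1) ^ h * int (abelian_rank (homology_deg F \<nu> (int h) m)))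
   = (\<Sum>h\<le>num_edges F. (-1) ^ h * int (card (basis_deg (int h) m)))"
proof -
  define r where "r h = int (frag_rank (d ` chains h m))" for h
  have H: "int (abelian_rank (homology_deg F \<nu> h m)) = int (card (basis_deg h m)) - r h - r (h - 1)" for h
    using rank_homology_deg[of h m] rank_chains[of h m] unfolding r_def by linarith
  \<comment> \<open>Only the differential into height 0 and the one out of height \<open>n\<close>
    remain uncancelled.\<close>
  have tele: "(\<Sum>h\<le>n. (-1) ^ h * (r (int h) + r (int h - 1))) = (-1) ^ n * r (int n) + r (- 1)" for n
    by (induction n) (simp_all add: algebra_simps)
  have "r (int (num_edges F)) = 0" "r (- 1) = 0"
    unfolding r_def by (simp_all add: boundary_rank_outside)
  then have "(\<Sum>h\<le>num_edges F. (-1) ^ h * (r (int h) + r (int h - 1))) = 0"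
    unfolding tele by simp
  then show ?thesis
    unfolding H by (simp add: algebra_simps sum.distrib sum_subtractf)
qed

text \<open>The index set in \<open>qdim\<close> varies with the height. A common finite set of
  degrees allows the sums over heights and degrees to be exchanged.\<close>

definition degrees :: "int set" where
  "degrees = gen_deg F ` (\<Union>h\<le>num_edges F. basis (int h))"

lemma finite_degrees: "finite degrees"
  unfolding degrees_def using finite_basis by auto

lemma qdim_homology:
  assumes "h \<le> num_edges F"
  shows "qdim (homology_deg F \<nu> (int h))
    = (\<Sum>m\<in>degrees. fls_X_intpow m * of_nat (abelian_rank (homology_deg F \<nu> (int h) m)))"
  unfolding qdim_def
proof (rule sum.mono_neutral_left[OF finite_degrees])
  show "{m. abelian_rank (homology_deg F \<nu> (int h) m) \<noteq> 0} \<subseteq> degrees"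
  proof
    fix m assume "m \<in> {m. abelian_rank (homology_deg F \<nu> (int h) m) \<noteq> 0}"
    then have "card (basis_deg (int h) m) \<noteq> 0"
      using rank_homology_deg[of "int h" m] rank_chains[of "int h" m] by auto
    then obtain x where "x \<in> basis_deg (int h) m" by (metis card.empty ex_in_conv)
    then show "m \<in> degrees" using assms by (auto simp: degrees_def basis_deg_def)
  qed
qed auto

theorem euler_char:
  "homology_euler_char F \<nu> = restricted_BR_poly F"
proof -
  let ?n = "num_edges F"
  let ?X = "\<lambda>m. fls_X_intpow m :: int fls"
  have "homology_euler_char F \<nu> = (\<Sum>h\<le>?n. (-1) ^ h *
      (\<Sum>m\<in>degrees. ?X m * of_nat (abelian_rank (homology_deg F \<nu> (int h) m))))"
    unfolding homology_euler_char_def by (intro sum.cong refl) (simp add: qdim_homology)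
  also have "\<dots> = (\<Sum>m\<in>degrees. ?X m *
      of_int (\<Sum>h\<le>?n. (-1) ^ h * int (abelian_rank (homology_deg F \<nu> (int h) m))))"
    by (simp add: sum_distrib_left mult.left_commute sum.swap[of _ degrees])
  also have "\<dots> = (\<Sum>m\<in>degrees. ?X m * of_int (\<Sum>h\<le>?n. (-1) ^ h * int (card (basis_deg (int h) m))))"
    unfolding alternating_rank_sum ..
  also have "\<dots> = (\<Sum>h\<le>?n. (-1) ^ h * (\<Sum>m\<in>degrees. ?X m * of_nat (card (basis_deg (int h) m))))"
    by (simp add: sum_distrib_left mult.left_commute sum.swap[of _ degrees])
  also have "\<dots> = (\<Sum>h\<le>?n. (-1) ^ h * (\<Sum>x\<in>basis (int h). ?X (gen_deg F x)))"
  proof (intro sum.cong refl arg_cong2[where f = "(*)"])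
    fix h assume h: "h \<in> {..?n}"
    have "(\<Sum>x\<in>basis (int h). ?X (gen_deg F x))
        = (\<Sum>m\<in>degrees. \<Sum>x\<in>{x \<in> basis (int h). gen_deg F x = m}. ?X (gen_deg F x))"
      by (rule sum.group[symmetric, OF finite_basis finite_degrees]) (use h in \<open>auto simp: degrees_def\<close>)
    also have "\<dots> = (\<Sum>m\<in>degrees. ?X m * of_nat (card (basis_deg (int h) m)))"
      by (intro sum.cong refl) (simp add: basis_deg_def mult.commute)
    finally show "(\<Sum>m\<in>degrees. ?X m * of_nat (card (basis_deg (int h) m)))
        = (\<Sum>x\<in>basis (int h). ?X (gen_deg F x))" by simp
  qed
  also have "\<dots> = (\<Sum>h\<le>?n. \<Sum>W\<in>{W \<in> states F. nat (height F W) = h}.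
      (-1) ^ nat (height F W) * (\<Sum>x\<in>state_basis F W. ?X (gen_deg F x)))"
  proof (intro sum.cong refl)
    fix h assume "h \<in> {..?n}"
    \<comment> \<open>Heights are integers while the Euler characteristic sums over naturals;
      nonnegativity makes the passage through \<open>nat\<close> faithful.\<close>
    have ge: "height F W \<ge> 0" if "W \<in> states F" for W
    proof -
      have "W \<subseteq> edges F" using that by (simp add: states_def)
      then show ?thesis using card_mono[OF finite_edges] by (simp add: height_eq num_edges_def)
    qed
    have "{W \<in> states F. height F W = int h} = {W \<in> states F. nat (height F W) = h}"
      using ge by force
    then have b: "basis (int h) = (\<Union>W\<in>{W \<in> states F. nat (height F W) = h}. state_basis F W)"
      by (simp add: basis_def)
    have "(\<Sum>x\<in>basis (int h). ?X (gen_deg F x))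
        = (\<Sum>W\<in>{W \<in> states F. nat (height F W) = h}. \<Sum>x\<in>state_basis F W. ?X (gen_deg F x))"
      unfolding b
      by (rule sum.UNION_disjoint) (use finite_states finite_state_basis in \<open>auto simp: state_basis_def\<close>)
    then show "(-1) ^ h * (\<Sum>x\<in>basis (int h). ?X (gen_deg F x))
        = (\<Sum>W\<in>{W \<in> states F. nat (height F W) = h}.
            (-1) ^ nat (height F W) * (\<Sum>x\<in>state_basis F W. ?X (gen_deg F x)))"
      by (simp add: sum_distrib_left)
  qed
  also have "\<dots> = (\<Sum>W\<in>states F. (-1) ^ nat (height F W) * (\<Sum>x\<in>state_basis F W. ?X (gen_deg F x)))"
  proof (rule sum.group[OF finite_states])
    show "(\<lambda>W. nat (height F W)) ` states F \<subseteq> {..?n}"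
      by (auto simp: states_def height_eq)
  qed simp
  also have "\<dots> = restricted_BR_poly F"
    unfolding restricted_BR_poly_def Let_def
  proof (intro sum.cong refl)
    fix W assume "W \<in> states F"
    then have W: "W \<subseteq> edges F" by (simp add: states_def)
    let ?k = "?n - num_edges (subfat F W)"
    have "card W \<le> ?n" unfolding num_edges_def by (rule card_mono[OF finite_edges W])
    then have k: "height F W = int ?k" using height_eq[OF W] num_edges_subfat[OF W] by simp
    \<comment> \<open>The shift by the height and the alternating sign combine into the power of
      \<open>- fls_X\<close>.\<close>
    have "?X (int ?k) = fls_X ^ ?k" by (simp add: fls_X_power_conv_shift_1)
    moreover have "(- fls_X) ^ ?k = (-1) ^ ?k * (fls_X :: int fls) ^ ?k" by (rule power_minus)
    ultimately show "(-1) ^ nat (height F W) * (\<Sum>x\<in>state_basis F W. ?X (gen_deg F x))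
        = (fls_X + fls_X_inv) ^ (num_verts (subfat F W) + num_bdry (subfat F W) + 2 * genus (subfat F W))
          * (- fls_X) ^ ?k"
      unfolding sum_state_basis k by (simp add: mult_ac)
  qed
  finally show ?thesis .
qed

end

theorem theorem5p2:
  fixes F :: "('v, 'h) fatgraph" and \<nu> :: "nat \<Rightarrow> 'h set"
  assumes "is_fatgraph F"
    and "bij_betw \<nu> {1..num_edges F} (edges F)"
  shows "homology_euler_char F \<nu> = restricted_BR_poly F"
proof -
  interpret numbered_fatgraph F \<nu>
    by unfold_locales (use assms in auto)
  show ?thesis by (rule euler_char)
qed

end
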